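(* Let $k\in\mathbb{N}$ and let $Q_k$ be a polynomial of degree $\le 2k-1$ (with complex coefficients) satisfying $Q_k(x)=x^{2k}Q_k(1/x)$ and $Q_k(0)=0$. Let the numbers $b_{Q_k}(r),b'_{Q_k}(r)$, $1\le r\le k$, be defined by the decomposition $$\frac{Q_k(x)}{(1-x+x^2)^k}=\sum_{r=1}^k b_{Q_k}(r)\frac{\zeta_6x}{(1-\zeta_6x)^r}+\sum_{r=1}^k b'_{Q_k}(r)\frac{\zeta_6^{-1}x}{(1-\zeta_6^{-1}x)^r},$$ and set $$d_{Q_k}(\ell)=\sum_{r=\ell}^k\frac{b_{Q_k}(r)}{(r-1)!}\left[\begin{matrix}r-1\\ \ell-1\end{matrix}\right]\qquad(1\le\ell\le k).$$ Then, with $q=e^{2\pi i\tau}$, $\tau\in\mathbb{H}$, $$\sum_{n\ge1}\frac{Q_k(q^n)}{(1-q^n+q^{2n})^k}=-\frac{Q_k(1)}{2}+i\sqrt3\sum_{\substack{\ell=1\\ \ell\text{ odd}}}^k d_{Q_k}(\ell)\big(2^\ell G_\ell(\chi_{3,2};2\tau)+G_\ell(\chi_{3,2};\tau)\big)+\sum_{\substack{\ell=1\\ \ell\text{ even}}}^k d_{Q_k}(\ell)\big(6^\ell G_\ell(6\tau)-3^\ell G_\ell(3\tau)-2^\ell G_\ell(2\tau)+G_\ell(\tau)\big).$$ In particular, the left-hand side is a linear combination of modular forms (and quasimodular forms for weight $2$) with level $6$ and highest weight $k$.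
   Context: $\mathbb{N}=\{1,2,3,\ldots\}$; $\mathbb{H}$ is the complex upper half-plane; $\zeta_N=e^{2\pi i/N}$. $\left[\begin{matrix}n\\ r\end{matrix}\right]$ denotes the unsigned Stirling number of the first kind. $\chi_{3,2}$ is the primitive Dirichlet character modulo $3$ with $\chi_{3,2}(m)=0,1,-1$ for $m\equiv0,1,2\pmod3$, respectively. For even $\ell\ge2$, $G_\ell(\tau)=\frac{\zeta(1-\ell)}{2}+\sum_{n\ge1}\sigma_{\ell-1}(n)q^n$ with $\sigma_{\ell-1}(n)=\sum_{d\mid n}d^{\ell-1}$; for odd $\ell\ge1$, $G_\ell(\chi_{3,2};\tau)=\frac{L(\chi_{3,2},1-\ell)}{2}+\sum_{n\ge1}\Big(\sum_{d\mid n}\chi_{3,2}(d)d^{\ell-1}\Big)q^n$, where $\zeta$ and $L(\chi,\cdot)$ denote the (analytically continued) Riemann zeta and Dirichlet $L$-functions. $\Gamma_0(N)=\{\begin{pmatrix}a&b\\c&d\end{pmatrix}\in\mathrm{SL}_2(\mathbb{Z}): c\equiv0 \pmod N\}$. A holomorphic function $g:\mathbb{H}\to\mathbb{C}$ is a quasimodular form of weight $w$, depth $h\ge0$ and Dirichlet character $\chi$ (modulo $N$) on $\Gamma_0(N)$ if there are holomorphic $g_0,\ldots,g_h:\mathbb{H}\to\mathbb{C}$, $g_h\ne0$, with $g\big(\frac{a\tau+b}{c\tau+d}\big)=\chi(d)(c\tau+d)^{w}\sum_{j=0}^h g_j(\tau)\big(\frac{c}{c\tau+d}\big)^j$ for all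 $\begin{pmatrix}a&b\\c&d\end{pmatrix}\in\Gamma_0(N)$, and $(c\tau+d)^{-(w-2r)}g_r\big(\frac{a\tau+b}{c\tau+d}\big)$ bounded as $\mathrm{Im}(\tau)\to\infty$ for all $r\in\{0,\ldots,h\}$ and all $\begin{pmatrix}a&b\\c&d\end{pmatrix}\in\mathrm{SL}_2(\mathbb{Z})$; the zero function is also included. Modular forms are the case $h=0$ (together with $0$). "Level $N$" means (quasi)modular on $\Gamma_0(N)$ with some Dirichlet character modulo $N$. "Linear combination with highest weight $k$" means that all weights occurring are at most $k$; different terms may have different characters modulo $N$, and constants (weight $0$) are allowed. *)

theory Defs
  imports
    "HOL-Complex_Analysis.Complex_Analysis"
    "HOL-Combinatorics.Stirling"
    "HOL-Computational_Algebra.Polynomial"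
begin

definition upper_half_plane :: "complex set" where
  "upper_half_plane = {z. Im z > 0}"

definition nome :: "complex \<Rightarrow> complex" where
  "nome \<tau> = exp (2 * of_real pi * \<i> * \<tau>)"

definition root_of_unity :: "nat \<Rightarrow> complex" where
  "root_of_unity N = exp (2 * of_real pi * \<i> / of_nat N)"


text \<open>Dirichlet characters modulo \<open>N\<close> are functions on all of \<open>\<int>\<close>, because the lower right
  matrix entry \<open>d\<close> in the transformation law may be negative.\<close>

definition dirichlet_character :: "nat \<Rightarrow> (int \<Rightarrow> complex) \<Rightarrow> bool" where
  "dirichlet_character N chi \<longleftrightarrow>
     N > 0 \<and>
     (\<forall>m. chi (m + int N) = chi m) \<and>
     (\<forall>m n. chi (m * n) = chi m * chi n) \<and>
     (\<forall>m. chi m \<noteq> 0 \<longleftrightarrow> coprime m (int N))"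

definition chi32 :: "int \<Rightarrow> complex" where
  "chi32 m = (if m mod 3 = 1 then 1 else if m mod 3 = 2 then -1 else 0)"

text \<open>The analytically continued Dirichlet series \<open>L(chi, s)\<close>: the meromorphic function on the whole
  plane given by the series for \<open>Re s > 1\<close>.  Asking for a nicely meromorphic function (continuous
  off its poles, value \<open>0\<close> at the poles) makes it unique as a total function.\<close>

definition dirichlet_L :: "(int \<Rightarrow> complex) \<Rightarrow> complex \<Rightarrow> complex" where
  "dirichlet_L chi =
     (THE f. f nicely_meromorphic_on UNIV \<and>
        (\<forall>s. Re s > 1 \<longrightarrow>
           (\<lambda>n. chi (int (Suc n)) / of_nat (Suc n) powr s) sums f s))"

definition riemann_zeta :: "complex \<Rightarrow> complex" where
  "riemann_zeta = dirichlet_L (\<lambda>_. 1)"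


definition eisenstein_G :: "nat \<Rightarrow> complex \<Rightarrow> complex" where
  "eisenstein_G l \<tau> =
     riemann_zeta (1 - of_nat l) / 2 +
     (\<Sum>n. (\<Sum>d | d dvd Suc n. of_nat (d ^ (l - 1))) * nome \<tau> ^ Suc n)"

definition eisenstein_G_char :: "nat \<Rightarrow> (int \<Rightarrow> complex) \<Rightarrow> complex \<Rightarrow> complex" where
  "eisenstein_G_char l chi \<tau> =
     dirichlet_L chi (1 - of_nat l) / 2 +
     (\<Sum>n. (\<Sum>d | d dvd Suc n. chi (int d) * of_nat (d ^ (l - 1))) * nome \<tau> ^ Suc n)"


definition moebius_action :: "int \<Rightarrow> int \<Rightarrow> int \<Rightarrow> int \<Rightarrow> complex \<Rightarrow> complex" where
  "moebius_action a b c d \<tau> = (of_int a * \<tau> + of_int b) / (of_int c * \<tau> + of_int d)"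

text \<open>\<open>quasimodular_form N w h chi g\<close>: on \<open>\<Gamma>\<^sub>0(N)\<close>, of weight \<open>w\<close>, depth \<open>h\<close> and character \<open>chi\<close>.  Only
  the values of \<open>g\<close> on the upper half-plane matter.  Boundedness as \<open>Im \<tau> \<rightarrow> \<infinity>\<close> is uniform in the
  real part.\<close>

definition quasimodular_form ::
    "nat \<Rightarrow> int \<Rightarrow> nat \<Rightarrow> (int \<Rightarrow> complex) \<Rightarrow> (complex \<Rightarrow> complex) \<Rightarrow> bool" where
  "quasimodular_form N w h chi g \<longleftrightarrow>
     dirichlet_character N chi \<and>
     g holomorphic_on upper_half_plane \<and>
     ((\<forall>\<tau>\<in>upper_half_plane. g \<tau> = 0) \<or>
      (\<exists>gs :: nat \<Rightarrow> complex \<Rightarrow> complex.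
         (\<forall>j\<le>h. gs j holomorphic_on upper_half_plane) \<and>
         (\<exists>\<tau>\<in>upper_half_plane. gs h \<tau> \<noteq> 0) \<and>
         (\<forall>a b c d. a * d - b * c = 1 \<and> int N dvd c \<longrightarrow>
            (\<forall>\<tau>\<in>upper_half_plane.
               g (moebius_action a b c d \<tau>) =
                 chi d * (of_int c * \<tau> + of_int d) powi w *
                 (\<Sum>j\<le>h. gs j \<tau> * (of_int c / (of_int c * \<tau> + of_int d)) ^ j))) \<and>
         (\<forall>r\<le>h. \<forall>a b c d. a * d - b * c = 1 \<longrightarrow>
            (\<exists>B. \<exists>Y>0. \<forall>\<tau>. Im \<tau> \<ge> Y \<longrightarrow>
               norm ((of_int c * \<tau> + of_int d) powi (- (w - 2 * int r)) *
                     gs r (moebius_action a b c d \<tau>)) \<le> B))))"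

definition modular_form ::
    "nat \<Rightarrow> int \<Rightarrow> (int \<Rightarrow> complex) \<Rightarrow> (complex \<Rightarrow> complex) \<Rightarrow> bool" where
  "modular_form N w chi g \<longleftrightarrow> quasimodular_form N w 0 chi g"

text \<open>Linear combinations, with highest weight \<open>k\<close>, of modular forms of level \<open>N\<close>, where in weight
  \<open>2\<close> quasimodular forms of any depth are admitted as well.  The characters may differ from term to
  term.\<close>

definition modular_lincomb :: "nat \<Rightarrow> nat \<Rightarrow> (complex \<Rightarrow> complex) \<Rightarrow> bool" where
  "modular_lincomb N k F \<longleftrightarrow>
     (\<exists>(m :: nat) (c :: nat \<Rightarrow> complex) (w :: nat \<Rightarrow> nat) chi f.
        (\<forall>j<m. w j \<le> k \<and>
           (modular_form N (int (w j)) (chi j) (f j) \<or>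
            w j = 2 \<and> (\<exists>h. quasimodular_form N 2 h (chi j) (f j)))) \<and>
        (\<forall>\<tau>\<in>upper_half_plane. F \<tau> = (\<Sum>j<m. c j * f j \<tau>)))"


definition is_partial_fraction ::
    "nat \<Rightarrow> complex poly \<Rightarrow> (nat \<Rightarrow> complex) \<Rightarrow> (nat \<Rightarrow> complex) \<Rightarrow> bool" where
  "is_partial_fraction k Q b b' \<longleftrightarrow>
     (\<forall>x. 1 - x + x ^ 2 \<noteq> 0 \<longrightarrow>
        poly Q x / (1 - x + x ^ 2) ^ k =
          (\<Sum>r=1..k. b r * (root_of_unity 6 * x / (1 - root_of_unity 6 * x) ^ r)) +
          (\<Sum>r=1..k. b' r * (inverse (root_of_unity 6) * x /
                              (1 - inverse (root_of_unity 6) * x) ^ r)))"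

text \<open>For \<open>Q 0 = 0\<close> and \<open>degree Q < 2 * k\<close> the two families of coefficients exist and are unique
  for \<open>1 \<le> r \<le> k\<close>; they are set to \<open>0\<close> for all other \<open>r\<close> so that the description is definite.\<close>

definition partial_fraction ::
    "nat \<Rightarrow> complex poly \<Rightarrow> (nat \<Rightarrow> complex) \<times> (nat \<Rightarrow> complex)" where
  "partial_fraction k Q =
     (THE p. is_partial_fraction k Q (fst p) (snd p) \<and>
        (\<forall>r. r \<notin> {1..k} \<longrightarrow> fst p r = 0 \<and> snd p r = 0))"

definition b_coeff :: "nat \<Rightarrow> complex poly \<Rightarrow> nat \<Rightarrow> complex" where
  "b_coeff k Q = fst (partial_fraction k Q)"

definition d_coeff :: "nat \<Rightarrow> complex poly \<Rightarrow> nat \<Rightarrow> complex" where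
  "d_coeff k Q l =
     (\<Sum>r=l..k. b_coeff k Q r / fact (r - 1) * of_nat (stirling (r - 1) (l - 1)))"

end

theory Submission
  imports Defs
begin

text \<open>
  Let \<open>\<zeta>\<close> be the primitive sixth root of unity.  The rational functions \<open>Li\<^sub>-\<^sub>n\<close> have the power series
  \<open>\<Sum> m\<^sup>n y\<^sup>m\<close>, satisfy \<open>Li\<^sub>-\<^sub>n(1/y) = \<plusminus> Li\<^sub>-\<^sub>n(y)\<close> up to a constant for \<open>n = 0\<close>, and are related to
  \<open>y / (1 - y)\<^sup>r\<close> by Stirling numbers.  Hence the symmetric fraction \<open>Q(x) / (1 - x + x\<^sup>2)\<^sup>k\<close> equals
  \<open>\<Sum> d(l) (Li\<^bsub>1-l\<^esub>(\<zeta>x) + (-1)\<^sup>l Li\<^bsub>1-l\<^esub>(\<zeta>\<^sup>-\<^sup>1x))\<close>.  Summing over \<open>x = q\<^sup>n\<close> gives Lambert series, which are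
  the Eisenstein series because \<open>\<zeta>\<^sup>m + \<zeta>\<^sup>-\<^sup>m\<close> is a combination of the indicators of \<open>M | m\<close> for
  \<open>M = 1, 2, 3, 6\<close> and \<open>\<zeta>\<^sup>m - \<zeta>\<^sup>-\<^sup>m\<close> one of \<open>\<chi>(m)\<close> and \<open>\<chi>(m/2)\<close>.  The constant terms agree by evaluating at \<open>x = 1\<close>, as \<open>\<Sum> \<zeta>\<^sup>m m\<^sup>-\<^sup>s\<close> extends to an entire
  function with value \<open>Li\<^sub>-\<^sub>n(\<zeta>)\<close> at \<open>s = -n\<close>.

  For modularity, the Lambert series are the values at the torsion point \<open>z = 1/6\<close> of the
  \<open>z\<close>-derivatives of the logarithmic derivative of a theta function.  Liouville's theorem on the
  torus yields the transformation of that function under \<open>SL\<^sub>2(\<int>)\<close>, in the variables \<open>\<tau>\<close> and \<open>z\<close> jointly,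
  and differentiating in \<open>z\<close> gives all weights at once, including the weights 1 and 2.
\<close>


section \<open>Polylogarithms of non-positive order\<close>

text \<open>Modularity is read off the left-hand side, not off the Eisenstein series of the formula:
  up to a constant, each weight-\<open>l\<close> piece is \<open>kronecker_eis (l - 1)\<close> at
  \<open>1 / 6\<close>. The level is the order of this torsion point, and the transformation law
  under all of SL2(Z) also reduces every cusp to a bound at another torsion point.

  On the arithmetic side the obstacle is that zeta(s) and L(chi, s) are definite descriptions whose
  values at 1 - l are needed. As \<open>root_of_unity 6\<close> and its inverse differ from 1,
  summation by parts makes their Dirichlet series entire. Then zeta(s) and L(chi, s) are
  combinations of these entire functions divided by (1 - 2^(1-s)) (1 - 3^(1-s)) and i sqrt(3) (1 +
  2^(1-s)), which do not vanish at s = 1 - l.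

  One relation, Li_0(1/y) = - Li_0(y) - 1, explains the constants on the analytic side: half of its
  1 is added to \<open>kronecker_eis 0\<close> to make it odd, and the whole of it is the
  quasi-period in the direction tau.\<close>

fun eulerian_poly :: "nat \<Rightarrow> complex poly" where
  "eulerian_poly 0 = [:0, 1:]"
| "eulerian_poly (Suc n) =
     [:0, 1, -1:] * pderiv (eulerian_poly n) + of_nat (Suc n) * ([:0, 1:] * eulerian_poly n)"

text \<open>\<open>neg_polylog n\<close> is \<open>Li\<^sub>-\<^sub>n\<close>; the recursion above is \<open>y d/dy\<close> in terms of numerators.\<close>

definition neg_polylog :: "nat \<Rightarrow> complex \<Rightarrow> complex" where
  "neg_polylog n y = poly (eulerian_poly n) y / (1 - y) ^ Suc n"

lemma poly_eulerian_0 [simp]: "poly (eulerian_poly n) 0 = 0"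
  by (cases n) auto

text \<open>Being nonzero, this value gives \<open>neg_polylog n\<close> a pole of order exactly n +
  1 at 1, as \<open>pole_sum_independent\<close> requires of its numerators.\<close>

lemma poly_eulerian_1 [simp]: "poly (eulerian_poly n) 1 = fact n"
  by (induction n) auto

lemma neg_polylog_0 [simp]: "neg_polylog n 0 = 0"
  by (simp add: neg_polylog_def)

lemma neg_polylog_order_0: "neg_polylog 0 y = y / (1 - y)"
  by (simp add: neg_polylog_def)

lemma has_field_derivative_one_minus_power:
  "((\<lambda>y. (1 - y) ^ Suc n) has_field_derivative - of_nat (Suc n) * (1 - y) ^ n) (at (y :: complex))"
  using DERIV_power_Suc[of "\<lambda>y. 1 - y" "-1" y UNIV n, OF DERIV_cong[OF DERIV_diff[OF DERIV_const
      DERIV_ident]]]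
  by (simp add: algebra_simps)

lemma has_field_derivative_neg_polylog:
  assumes "y \<noteq> 0" "y \<noteq> 1"
  shows "(neg_polylog n has_field_derivative neg_polylog (Suc n) y / y) (at y)"
proof -
  let ?a = "poly (pderiv (eulerian_poly n)) y" and ?p = "poly (eulerian_poly n) y"
  have "((\<lambda>y. poly (eulerian_poly n) y / (1 - y) ^ Suc n) has_field_derivative
     (?a * (1 - y) ^ Suc n - ?p * (- of_nat (Suc n) * (1 - y) ^ n)) /
     ((1 - y) ^ Suc n * (1 - y) ^ Suc n)) (at y)"
    by (rule DERIV_divide[OF poly_DERIV has_field_derivative_one_minus_power]) (use assms in auto)
  moreover have "(?a * (1 - y) ^ Suc n - ?p * (- of_nat (Suc n) * (1 - y) ^ n)) /
     ((1 - y) ^ Suc n * (1 - y) ^ Suc n) = neg_polylog (Suc n) y / y"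
  proof -
    have *: "(a * (u * v) - p * (- m * v)) / ((u * v) * (u * v)) =
          (y * u * a + m * (y * p)) / (u * (u * v)) / y" if "u \<noteq> 0" "v \<noteq> 0" for u v a p m
      using assms that by (simp add: divide_simps) (simp add: algebra_simps)
    have "poly (eulerian_poly (Suc n)) y = y * (1 - y) * ?a + of_nat (Suc n) * (y * ?p)"
      by (simp add: algebra_simps)
    thus ?thesis
      unfolding neg_polylog_def power_Suc by (simp only:) (rule *, use assms in auto)
  qed
  ultimately show ?thesis
    unfolding neg_polylog_def[of n, abs_def] by simp
qed

lemma has_field_derivative_neg_polylog_compose:
  assumes "(f has_field_derivative f') (at s)" "f s \<noteq> 0" "f s \<noteq> 1"
  shows "((\<lambda>s. neg_polylog n (f s)) has_field_derivative
           neg_polylog (Suc n) (f s) * (f' / f s)) (at s)"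
  using DERIV_chain2[OF has_field_derivative_neg_polylog[OF assms(2,3), of n] assms(1)]
  by simp

lemma continuous_neg_polylog: "y \<noteq> 1 \<Longrightarrow> isCont (neg_polylog n) y"
  unfolding neg_polylog_def[abs_def] by (intro continuous_intros) auto

text \<open>The operator y d/dy changes sign under y -> 1/y, so each differentiation contributes a
  factor -1. The additive constant present at order 0 disappears with the first derivative.\<close>

lemma neg_polylog_inverse:
  assumes "y \<noteq> 0" "y \<noteq> 1"
  shows "neg_polylog n (inverse y) = (-1) ^ Suc n * neg_polylog n y - (if n = 0 then 1 else 0)"
  using assms
proof (induction n arbitrary: y)
  case 0
  thus ?case by (simp add: neg_polylog_order_0 field_simps)
next
  case (Suc n)
  have "((\<lambda>s. neg_polylog n (inverse s)) has_field_derivative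
          neg_polylog (Suc n) (inverse y) * (- (inverse y * inverse y) / inverse y)) (at y)"
    by (rule has_field_derivative_neg_polylog_compose)
       (use Suc.prems in \<open>auto intro!: derivative_eq_intros simp: power2_eq_square\<close>)
  moreover have "((\<lambda>s. neg_polylog n (inverse s)) has_field_derivative
          (-1) ^ Suc n * (neg_polylog (Suc n) y / y)) (at y)"
  proof (rule has_field_derivative_transform_within_open[where S = "- {0, 1}"])
    show "((\<lambda>s. (-1) ^ Suc n * neg_polylog n s - (if n = 0 then 1 else 0)) has_field_derivative
          (-1) ^ Suc n * (neg_polylog (Suc n) y / y)) (at y)"
      by (auto intro!: derivative_eq_intros has_field_derivative_neg_polylog Suc.prems)
  qed (use Suc in auto)
  ultimately have "neg_polylog (Suc n) (inverse y) * (- (inverse y * inverse y) / inverse y) =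
                   (-1) ^ Suc n * (neg_polylog (Suc n) y / y)"
    by (rule DERIV_unique)
  thus ?case using Suc.prems by (simp add: field_simps)
qed

text \<open>Termwise application of y d/dy to the geometric series.\<close>

lemma neg_polylog_sums:
  assumes "norm y < 1"
  shows "(\<lambda>m. of_nat (Suc m) ^ n * y ^ Suc m) sums neg_polylog n y"
  using assms
proof (induction n arbitrary: y)
  case 0
  show ?case
    using sums_mult[OF geometric_sums[OF 0], of y] by (simp add: neg_polylog_order_0)
next
  case (Suc n)
  \<comment> \<open>The case distinction removes the term m = 0, which would be 0 ^ 0 = 1 for n =
    0.\<close>
  define a where "a m = (if m = 0 then 0 else of_nat m ^ n :: complex)" for m
  have a: "(\<lambda>m. a m * z ^ m) sums neg_polylog n z" if "norm z < 1" for z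
    using Suc.IH[OF that] sums_Suc_iff[of "\<lambda>m. a m * z ^ m" "neg_polylog n z"]
    by (simp add: a_def)
  \<comment> \<open>Strictly between \<open>norm y\<close> and 1, so that y is interior to a disc on
    which the series may be differentiated.\<close>
  define r where "r = (norm y + 1) / 2"
  have r: "norm y < r" "r < 1" "0 < r"
    using Suc.prems by (auto simp: r_def intro: add_nonneg_pos)
  have "summable (\<lambda>m. a m * complex_of_real (r ^ m))"
    using a[of "of_real r"] r by (auto simp: sums_iff)
  then obtain g g' where "\<forall>z\<in>ball 0 r. ((\<lambda>m. a m * (z - 0) ^ m) sums g z) \<and>
      ((\<lambda>m. of_nat m * a m * (z - 0) ^ (m - 1)) sums g' z) \<and> (g has_field_derivative g' z) (at z)"
    by (rule power_series_and_derivative)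
  hence g: "(\<lambda>m. a m * z ^ m) sums g z" "(\<lambda>m. of_nat m * a m * z ^ (m - 1)) sums g' z"
      "(g has_field_derivative g' z) (at z)" if "norm z < r" for z
    using that by auto
  have g_eq: "g z = neg_polylog n z" if "norm z < r" for z
    using g(1)[OF that] a[of z] that r by (intro sums_unique2[of _ "g z"]) auto
  show ?case
  proof (cases "y = 0")
    case False
    have "(g has_field_derivative neg_polylog (Suc n) y / y) (at y)"
      by (rule has_field_derivative_transform_within_open
            [OF has_field_derivative_neg_polylog, where S = "ball 0 r"])
         (use r Suc.prems False g_eq in auto)
    hence "g' y = neg_polylog (Suc n) y / y"
      using DERIV_unique g(3) r by blast
    hence "(\<lambda>m. of_nat m * a m * y ^ (m - 1)) sums (neg_polylog (Suc n) y / y)"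
      using g(2)[of y] r by simp
    hence "(\<lambda>m. of_nat (Suc m) * a (Suc m) * y ^ m) sums (neg_polylog (Suc n) y / y)"
      using sums_Suc_iff[of "\<lambda>m. of_nat m * a m * y ^ (m - 1)" "neg_polylog (Suc n) y / y"]
      by (simp add: a_def)
    from sums_mult[OF this, of y] False show ?thesis by (simp add: a_def mult_ac)
  qed (auto simp: sums_0)
qed

lemma has_sum_Suc_iff:
  "((\<lambda>m. f (Suc m)) has_sum S) UNIV \<longleftrightarrow> (f has_sum S) {0<..}"
proof -
  have "bij_betw Suc UNIV {0<..}"
    by (rule bij_betw_byWitness[of _ "\<lambda>n. n - 1"]) auto
  thus ?thesis by (rule has_sum_reindex_bij_betw)
qed

lemma neg_polylog_has_sum:
  assumes "norm y < 1"
  shows "((\<lambda>m. of_nat m ^ n * y ^ m) has_sum neg_polylog n y) {0<..}"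
proof -
  have "((\<lambda>m. of_nat (Suc m) ^ n * y ^ Suc m) has_sum neg_polylog n y) UNIV"
  proof (rule norm_summable_imp_has_sum)
    \<comment> \<open>Absolute convergence: at the real point \<open>norm y\<close> the terms of the
      series are the norms of the terms at y.\<close>
    have "(\<lambda>m. of_nat (Suc m) ^ n * of_real (norm y) ^ Suc m) sums neg_polylog n (of_real (norm y))"
      by (rule neg_polylog_sums) (use assms in auto)
    hence "summable (\<lambda>m. Re (of_nat (Suc m) ^ n * of_real (norm y) ^ Suc m))"
      using sums_Re sums_summable by blast
    also have "(\<lambda>m. Re (of_nat (Suc m) ^ n * of_real (norm y) ^ Suc m)) =
               (\<lambda>m. norm (of_nat (Suc m) ^ n * y ^ Suc m))"
    proof
      fix m
      have "of_nat (Suc m) ^ n * of_real (norm y) ^ Suc m =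
            complex_of_real (real (Suc m) ^ n * norm y ^ Suc m)" by simp
      thus "Re (of_nat (Suc m) ^ n * of_real (norm y) ^ Suc m) = norm (of_nat (Suc m) ^ n * y ^ Suc m)"
        unfolding norm_mult norm_power norm_of_nat by (simp only: Re_complex_of_real)
    qed
    finally show "summable (\<lambda>m. norm (of_nat (Suc m) ^ n * y ^ Suc m))" .
  qed (rule neg_polylog_sums[OF assms])
  thus ?thesis
    unfolding has_sum_Suc_iff[of "\<lambda>m. of_nat m ^ n * y ^ m"] .
qed

text \<open>The numerator is divisible by y, and the remaining quotient is continuous on the closed
  disc of radius 1/2. The factor \<open>norm y\<close> is what makes sums of polylogarithms at
  powers of q converge geometrically.\<close>

lemma neg_polylog_bound:
  obtains C where "C > 0" "\<And>y. norm y \<le> 1 / 2 \<Longrightarrow> norm (neg_polylog n y) \<le> C * norm y"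
proof -
  obtain p where p: "eulerian_poly n = [:0, 1:] * p"
    using poly_eulerian_0[of n] by (subst (asm) poly_eq_0_iff_dvd) auto
  have "compact ((\<lambda>y. poly p y / (1 - y) ^ Suc n) ` cball 0 (1 / 2))"
    by (intro compact_continuous_image continuous_intros) auto
  then obtain C where C: "C > 0" "\<And>y. norm y \<le> 1 / 2 \<Longrightarrow> norm (poly p y / (1 - y) ^ Suc n) \<le> C"
    by (auto dest!: compact_imp_bounded simp: bounded_pos)
  have "norm (neg_polylog n y) \<le> C * norm y" if "norm y \<le> 1 / 2" for y
  proof -
    have "neg_polylog n y = poly p y / (1 - y) ^ Suc n * y"
      by (simp add: neg_polylog_def p)
    thus ?thesis using mult_right_mono[OF C(2)[OF that], of "norm y"]
      by (simp only: norm_mult norm_ge_zero)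
  qed
  with C(1) that show ?thesis by blast
qed

text \<open>With f_r = r! y / (1 - y)^(r+1) and theta = y d/dy one has f_(r+1) = (theta + r) f_r.
  Hence f_r is the rising factorial theta (theta + 1) ... (theta + r - 1) applied to Li_0, and the
  unsigned Stirling numbers of the first kind are the coefficients of that rising factorial.\<close>

lemma pole_eq_sum_neg_polylog:
  assumes "y \<noteq> 1"
  shows "y / (1 - y) ^ Suc r = (\<Sum>l\<le>r. of_nat (stirling r l) / fact r * neg_polylog l y)"
proof -
  have "fact r * (y / (1 - y) ^ Suc r) = (\<Sum>l\<le>r. of_nat (stirling r l) * neg_polylog l y)"
    if "y \<noteq> 0" "y \<noteq> 1" for y
    using that
  proof (induction r arbitrary: y)
    case 0
    thus ?case by (simp add: neg_polylog_order_0)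
  next
    case (Suc r)
    let ?S = "\<lambda>r y. (\<Sum>l\<le>r. of_nat (stirling r l) * neg_polylog l y)"
    have "((\<lambda>y. fact r * (y / (1 - y) ^ Suc r)) has_field_derivative
            fact r * ((1 * (1 - y) ^ Suc r - y * (- of_nat (Suc r) * (1 - y) ^ r)) /
              ((1 - y) ^ Suc r * (1 - y) ^ Suc r))) (at y)"
      by (intro DERIV_cmult DERIV_divide[OF DERIV_ident has_field_derivative_one_minus_power])
         (use Suc.prems in auto)
    moreover have "((\<lambda>y. fact r * (y / (1 - y) ^ Suc r)) has_field_derivative
            (\<Sum>l\<le>r. of_nat (stirling r l) * (neg_polylog (Suc l) y / y))) (at y)"
    proof (rule has_field_derivative_transform_within_open[where S = "- {0, 1}"])
      show "(?S r has_field_derivative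
               (\<Sum>l\<le>r. of_nat (stirling r l) * (neg_polylog (Suc l) y / y))) (at y)"
        by (intro DERIV_sum DERIV_cmult has_field_derivative_neg_polylog Suc.prems)
    qed (use Suc in auto)
    ultimately have eq: "fact r * ((1 * (1 - y) ^ Suc r - y * (- of_nat (Suc r) * (1 - y) ^ r)) /
              ((1 - y) ^ Suc r * (1 - y) ^ Suc r)) =
            (\<Sum>l\<le>r. of_nat (stirling r l) * (neg_polylog (Suc l) y / y))"
      by (rule DERIV_unique)
    have "?S (Suc r) y = (\<Sum>l\<le>r. of_nat (stirling (Suc r) (Suc l)) * neg_polylog (Suc l) y)"
      by (subst sum.atMost_Suc_shift) simp
    also have "\<dots> = of_nat r * (\<Sum>l\<le>r. of_nat (stirling r (Suc l)) * neg_polylog (Suc l) y) +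
                  (\<Sum>l\<le>r. of_nat (stirling r l) * neg_polylog (Suc l) y)"
      by (simp add: algebra_simps sum.distrib sum_distrib_left)
    also have "(\<Sum>l\<le>r. of_nat (stirling r l) * neg_polylog (Suc l) y) =
               y * (\<Sum>l\<le>r. of_nat (stirling r l) * (neg_polylog (Suc l) y / y))"
      using Suc.prems by (simp add: sum_distrib_left)
    \<comment> \<open>For r = 0 the factor vanishes. Otherwise the index shift costs nothing: the
      new top term has \<open>stirling r (Suc r) = 0\<close>, and the missing bottom term has
      \<open>stirling r 0 = 0\<close>.\<close>
    also have "of_nat r * (\<Sum>l\<le>r. of_nat (stirling r (Suc l)) * neg_polylog (Suc l) y) =
               of_nat r * ?S r y"
    proof (cases r)
      case (Suc r')
      have "(\<Sum>l\<le>r. of_nat (stirling r (Suc l)) * neg_polylog (Suc l) y) =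
            (\<Sum>l\<le>r'. of_nat (stirling r (Suc l)) * neg_polylog (Suc l) y)"
        unfolding Suc by simp
      also have "\<dots> = ?S r y"
        unfolding Suc by (subst sum.atMost_Suc_shift) simp
      finally show ?thesis by simp
    qed auto
    also have "?S r y = fact r * (y / (1 - y) ^ Suc r)"
      using Suc by simp
    also have "of_nat r * (fact r * (y / (1 - y) ^ Suc r)) +
        y * (\<Sum>l\<le>r. of_nat (stirling r l) * (neg_polylog (Suc l) y / y)) =
        fact (Suc r) * (y / (1 - y) ^ Suc (Suc r))"
    proof -
      have "m * (f * (y / (u * v))) + y * (f * ((1 * (u * v) - y * (- m' * v)) / ((u * v) * (u * v)))) =
            (m' * f) * (y / (u * (u * v)))" if "u = 1 - y" "v \<noteq> 0" "m' = m + 1" for u v m m' f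
        using Suc.prems that by (simp add: divide_simps) (simp add: algebra_simps)
      from this[of "1 - y" "(1 - y) ^ r" "of_nat (Suc r)" "of_nat r" "fact r"] show ?thesis
        using Suc.prems unfolding eq[symmetric] power_Suc fact_Suc by simp
    qed
    finally show ?case by simp
  qed
  hence "fact r * (y / (1 - y) ^ Suc r) = (\<Sum>l\<le>r. of_nat (stirling r l) * neg_polylog l y)"
    using assms by (cases "y = 0") auto
  hence "y / (1 - y) ^ Suc r = (\<Sum>l\<le>r. of_nat (stirling r l) * neg_polylog l y) / fact r"
    using eq_divide_eq[of "y / (1 - y) ^ Suc r" _ "fact r"] by (simp add: mult.commute)
  thus ?thesis by (simp add: sum_divide_distrib)
qed


section \<open>Partial fractions\<close>

lemma root_of_unity_6_eq: "root_of_unity 6 = Complex (1 / 2) (sqrt 3 / 2)"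
proof -
  have "root_of_unity 6 = cis (pi / 3)"
    unfolding root_of_unity_def cis_conv_exp by (simp add: field_simps)
  thus ?thesis by (simp add: cos_60 sin_60 cis.ctr)
qed

lemma root_of_unity_6_props:
  shows "root_of_unity 6 \<noteq> 0"
    and "norm (root_of_unity 6) = 1"
    and "root_of_unity 6 ^ 2 = root_of_unity 6 - 1"
    and "inverse (root_of_unity 6) = 1 - root_of_unity 6"
    and "root_of_unity 6 ^ 6 = 1"
    and "root_of_unity 6 \<noteq> 1"
    and "root_of_unity 6 \<noteq> inverse (root_of_unity 6)"
    and "root_of_unity 6 - inverse (root_of_unity 6) = \<i> * of_real (sqrt 3)"
proof -
  let ?z = "root_of_unity 6"
  show nz: "?z \<noteq> 0"
    by (simp add: root_of_unity_def)
  show "norm ?z = 1"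
    by (simp add: root_of_unity_def)
  show sq: "?z ^ 2 = ?z - 1"
    by (simp add: root_of_unity_6_eq complex_eq_iff power2_eq_square field_simps)
  have "?z * (1 - ?z) = 1"
    using sq by (simp add: algebra_simps power2_eq_square)
  thus inv: "inverse ?z = 1 - ?z"
    by (rule inverse_unique)
  have "?z ^ 6 = (?z ^ 2) ^ 2 * ?z ^ 2"
    by (simp flip: power_mult power_add)
  also have "(?z ^ 2) ^ 2 = - ?z"
    unfolding sq using sq by (simp add: power2_eq_square algebra_simps)
  also have "- ?z * ?z ^ 2 = 1"
    unfolding sq using sq by (simp add: power2_eq_square algebra_simps)
  finally show "?z ^ 6 = 1" .
  show "?z \<noteq> 1"
    by (simp add: root_of_unity_6_eq complex_eq_iff)
  show "?z - inverse ?z = \<i> * of_real (sqrt 3)" "?z \<noteq> inverse ?z"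
    unfolding inv by (simp_all add: root_of_unity_6_eq complex_eq_iff)
qed

lemma root_of_unity_6_factor:
  "1 - x + x ^ 2 = (1 - root_of_unity 6 * x) * (1 - inverse (root_of_unity 6) * x)"
proof -
  let ?z = "root_of_unity 6"
  have "(1 - ?z * x) * (1 - inverse ?z * x) = 1 - (?z + inverse ?z) * x + (?z * inverse ?z) * x ^ 2"
    by (simp add: algebra_simps power2_eq_square)
  also have "?z + inverse ?z = 1"
    by (simp add: root_of_unity_6_props(4))
  finally show ?thesis
    by (simp add: root_of_unity_6_props(1))
qed

text \<open>If \<open>m\<close> is the largest index with \<open>c m \<noteq> 0\<close>, then the left-hand side has a pole of order exactly \<open>m\<close>
  at \<open>1 / \<alpha>\<close>.\<close>

lemma pole_sum_independent:
  fixes \<alpha> \<beta> C :: complex and p :: "nat \<Rightarrow> complex poly"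
  assumes p: "\<And>r. r \<in> {1..k} \<Longrightarrow> poly (p r) 1 \<noteq> 0"
    and \<alpha>\<beta>: "\<alpha> \<noteq> 0" "\<alpha> \<noteq> \<beta>"
    and eq: "\<And>x. x \<noteq> 0 \<Longrightarrow> \<alpha> * x \<noteq> 1 \<Longrightarrow> \<beta> * x \<noteq> 1 \<Longrightarrow>
        (\<Sum>r=1..k. c r * (poly (p r) (\<alpha> * x) / (1 - \<alpha> * x) ^ r)) +
        (\<Sum>r=1..k. c' r * (poly (p r) (\<beta> * x) / (1 - \<beta> * x) ^ r)) = C"
    and r: "r \<in> {1..k}"
  shows "c r = 0"
proof (rule ccontr)
  assume "c r \<noteq> 0"
  define m where "m = Max {r \<in> {1..k}. c r \<noteq> 0}"
  have "m \<in> {r \<in> {1..k}. c r \<noteq> 0}"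
    unfolding m_def by (rule Max_in) (use r \<open>c r \<noteq> 0\<close> in auto)
  hence m: "m \<in> {1..k}" "c m \<noteq> 0" by auto
  have above: "c i = 0" if "i \<in> {m<..k}" for i
  proof (rule ccontr)
    assume "c i \<noteq> 0"
    hence "i \<le> m" unfolding m_def using that m by (intro Max_ge) auto
    thus False using that by simp
  qed
  \<comment> \<open>\<open>f\<close> and \<open>g\<close> arise by multiplying through with (1 -
    \<alpha> x)^m. Both are continuous at 1/\<alpha>, where \<open>g\<close> is 0 and only the term
    r = m of \<open>f\<close> survives.\<close>
  define f where "f x = (\<Sum>r=1..m. c r * (poly (p r) (\<alpha> * x) * (1 - \<alpha> * x) ^ (m - r)))" for x
  define g where "g x = (1 - \<alpha> * x) ^ m *
    (C - (\<Sum>r=1..k. c' r * (poly (p r) (\<beta> * x) / (1 - \<beta> * x) ^ r)))" for x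
  have "isCont f (1 / \<alpha>)" unfolding f_def by (intro continuous_intros)
  hence f: "(f \<longlongrightarrow> f (1 / \<alpha>)) (at (1 / \<alpha>))" by (simp add: isCont_def)
  have "isCont g (1 / \<alpha>)"
    unfolding g_def by (intro continuous_intros) (use \<alpha>\<beta> in auto)
  hence g: "(g \<longlongrightarrow> g (1 / \<alpha>)) (at (1 / \<alpha>))" by (simp add: isCont_def)
  have fg: "eventually (\<lambda>x. f x = g x) (at (1 / \<alpha>))"
  proof -
    have "((\<lambda>x. \<beta> * x) \<longlongrightarrow> \<beta> * (1 / \<alpha>)) (at (1 / \<alpha>))"
      by (intro tendsto_intros)
    hence "eventually (\<lambda>x. \<beta> * x \<noteq> 1) (at (1 / \<alpha>))"
      by (rule tendsto_imp_eventually_ne) (use \<alpha>\<beta> in auto)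
    moreover have "((\<lambda>x. x) \<longlongrightarrow> 1 / \<alpha>) (at (1 / \<alpha>))"
      by (intro tendsto_intros)
    hence "eventually (\<lambda>x. x \<noteq> 0) (at (1 / \<alpha>))"
      by (rule tendsto_imp_eventually_ne) (use \<alpha>\<beta> in auto)
    moreover have "eventually (\<lambda>x. x \<noteq> 1 / \<alpha>) (at (1 / \<alpha>))"
      by (rule eventually_neq_at_within)
    ultimately show ?thesis
    proof eventually_elim
      case (elim x)
      hence ax: "\<alpha> * x \<noteq> 1" using \<alpha>\<beta> by (auto simp: field_simps)
      have "(\<Sum>r=1..k. c r * (poly (p r) (\<alpha> * x) / (1 - \<alpha> * x) ^ r)) =
            (\<Sum>r=1..m. c r * (poly (p r) (\<alpha> * x) / (1 - \<alpha> * x) ^ r))"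
        by (rule sum.mono_neutral_right) (use m above in auto)
      moreover have "f x = (1 - \<alpha> * x) ^ m * (\<Sum>r=1..m. c r * (poly (p r) (\<alpha> * x) / (1 - \<alpha> * x) ^ r))"
        unfolding f_def sum_distrib_left
        by (intro sum.cong refl) (use ax in \<open>auto simp: power_diff field_simps\<close>)
      moreover note eq[of x]
      ultimately show ?case
        using elim ax by (simp add: g_def eq_diff_eq)
    qed
  qed
  have "(f \<longlongrightarrow> g (1 / \<alpha>)) (at (1 / \<alpha>))"
    using g tendsto_cong[OF fg] by simp
  with f have "f (1 / \<alpha>) = g (1 / \<alpha>)"
    by (rule tendsto_unique[OF trivial_limit_at])
  moreover have "g (1 / \<alpha>) = 0"
    using \<alpha>\<beta> m by (simp add: g_def)
  moreover have "f (1 / \<alpha>) = c m * poly (p m) 1"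
  proof -
    have "f (1 / \<alpha>) = (\<Sum>r=1..m. if r = m then c m * poly (p m) 1 else 0)"
      unfolding f_def by (intro sum.cong refl) (use \<alpha>\<beta> in auto)
    thus ?thesis using m by simp
  qed
  ultimately show False using p m by auto
qed

text \<open>Induction on k: subtracting the two poles of top order with suitable coefficients leaves
  a numerator divisible by 1 - x + x^2. The bound 2k and the zero at 0 both pass to the quotient,
  and at k = 0 together they force the numerator to vanish.\<close>

lemma is_partial_fraction_exists:
  assumes "degree Q \<le> 2 * k" "poly Q 0 = 0"
  shows "\<exists>b b'. is_partial_fraction k Q b b'"
  using assms
proof (induction k arbitrary: Q)
  case 0
  hence "Q = 0" by (auto elim: degree_eq_zeroE)
  thus ?case by (auto simp: is_partial_fraction_def)
next
  case (Suc k)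
  define z where "z = root_of_unity 6"
  define w where "w = inverse z"
  have zw: "z * w = 1" "w * z = 1" "z \<noteq> w" "z \<noteq> 0" "w \<noteq> 0"
    using root_of_unity_6_props(1,7) by (auto simp: z_def w_def)
  have ww: "w * w \<noteq> 1" "z * z \<noteq> 1"
    using zw by (metis mult_left_cancel)+
  define u v where "u = [:1, -z:]" and "v = [:1, -w:]"
  \<comment> \<open>\<open>w\<close> is the zero of \<open>u\<close> and \<open>z\<close> that of
    \<open>v\<close>. The two coefficients are forced by R(w) = R(z) = 0; since
    \<open>z * w = 1\<close>, the linear factors \<open>[:0, z:]\<close> and \<open>[:0, w:]\<close>
    take the value 1 there.\<close>
  define a where "a = poly Q w / poly v w ^ Suc k"
  define a' where "a' = poly Q z / poly u z ^ Suc k"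
  define R where "R = Q - smult a ([:0, z:] * v ^ Suc k) - smult a' ([:0, w:] * u ^ Suc k)"
  have uv0: "poly u w = 0" "poly v z = 0" "poly v w \<noteq> 0" "poly u z \<noteq> 0"
    using ww zw by (auto simp: u_def v_def)
  have "poly R w = poly Q w - a * (w * z * poly v w ^ Suc k)"
       "poly R z = poly Q z - a' * (z * w * poly u z ^ Suc k)"
    by (simp_all add: R_def uv0)
  hence "poly R w = 0" "poly R z = 0"
    unfolding zw(1,2) a_def a'_def using uv0 by simp_all
  then obtain S where S: "R = [:- w, 1:] * S" and "poly R z = 0"
    by (metis poly_eq_0_iff_dvd dvdE)
  hence "poly S z = 0" using zw by (simp add: S)
  then obtain T where "S = [:- z, 1:] * T"
    by (metis poly_eq_0_iff_dvd dvdE)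
  with S have T0: "R = [:- w, 1:] * [:- z, 1:] * T" by (simp only: mult.assoc)
  have uv: "u * v = [:- w, 1:] * [:- z, 1:]"
    using zw by (simp add: u_def v_def mult.commute)
  have T: "R = u * v * T" using T0 uv by simp
  have "degree R \<le> 2 * Suc k"
  proof -
    have 1: "degree ([:0, c:] * [:1, d:] ^ Suc k) \<le> 2 * Suc k" for c d :: complex
    proof -
      have "degree ([:1, d:] ^ Suc k) \<le> Suc k"
        using order.trans[OF degree_power_le mult_right_mono[of "degree [:1, d:]" 1 "Suc k"]] by simp
      moreover have "degree [:0, c:] \<le> 1" by simp
      ultimately have "degree ([:0, c:] * [:1, d:] ^ Suc k) \<le> 1 + Suc k"
        by (intro order.trans[OF degree_mult_le] add_mono)
      also have "1 + Suc k \<le> 2 * Suc k" by simp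
      finally show ?thesis .
    qed
    show ?thesis unfolding R_def u_def v_def
      by (intro degree_diff_le order.trans[OF degree_smult_le] 1 Suc.prems)
  qed
  have "degree T \<le> 2 * k"
  proof (cases "T = 0")
    case False
    have "u \<noteq> 0" "v \<noteq> 0" "degree u = 1" "degree v = 1"
      using zw by (auto simp: u_def v_def)
    hence "degree R = 2 + degree T"
      unfolding T using False by (simp add: degree_mult_eq)
    thus ?thesis using \<open>degree R \<le> 2 * Suc k\<close> by simp
  qed auto
  moreover have "poly T 0 = 0"
  proof -
    have "poly R 0 = 0" using Suc.prems by (simp add: R_def)
    thus ?thesis by (simp add: T u_def v_def)
  qed
  ultimately obtain b b' where b: "is_partial_fraction k T b b'"
    using Suc.IH by blast
  have "is_partial_fraction (Suc k) Q (b(Suc k := a)) (b'(Suc k := a'))"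
    unfolding is_partial_fraction_def z_def[symmetric] w_def[symmetric]
  proof (intro allI impI)
    fix x :: complex assume x: "1 - x + x ^ 2 \<noteq> 0"
    have fac: "1 - x + x ^ 2 = poly u x * poly v x"
      unfolding root_of_unity_6_factor by (simp add: u_def v_def z_def w_def algebra_simps)
    have nz: "poly u x \<noteq> 0" "poly v x \<noteq> 0" using x fac by auto
    have "Q = u * v * T + smult a ([:0, z:] * v ^ Suc k) + smult a' ([:0, w:] * u ^ Suc k)"
      using T by (simp add: R_def algebra_simps)
    hence "poly Q x = poly (u * v * T + smult a ([:0, z:] * v ^ Suc k) + smult a' ([:0,
        w:] * u ^ Suc k)) x"
      by (rule arg_cong)
    also have "\<dots> = poly u x * poly v x * poly T x + a * (z * x * poly v x ^ Suc k)
                     + a' * (w * x * poly u x ^ Suc k)"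
      by (simp add: mult_ac)
    finally have Q: "poly Q x = \<dots>" .
    have "poly Q x / (1 - x + x ^ 2) ^ Suc k =
            poly T x / (1 - x + x ^ 2) ^ k + a * (z * x / poly u x ^ Suc k) +
                a' * (w * x / poly v x ^ Suc k)"
    proof -
      have "(U * V * t + a * (z * x * (V * V')) + a' * (w * x * (U * U'))) / (U * V * (U' * V')) =
            t / (U' * V') + a * (z * x / (U * U')) + a' * (w * x / (V * V'))"
        if "U \<noteq> 0" "V \<noteq> 0" "U' \<noteq> 0" "V' \<noteq> 0" for U V U' V' t
        using that by (simp add: divide_simps) (simp add: algebra_simps)
      from this[of "poly u x" "poly v x" "poly u x ^ k" "poly v x ^ k"] nz show ?thesis
        unfolding Q fac power_mult_distrib power_Suc by simp
    qed
    also have "poly T x / (1 - x + x ^ 2) ^ k =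
          (\<Sum>r=1..k. b r * (z * x / (1 - z * x) ^ r)) + (\<Sum>r=1..k. b' r * (w * x / (1 - w * x) ^ r))"
      using b x unfolding is_partial_fraction_def z_def w_def by blast
    also have "poly u x = 1 - z * x" by (simp add: u_def)
    also have "poly v x = 1 - w * x" by (simp add: v_def)
    finally show "poly Q x / (1 - x + x ^ 2) ^ Suc k =
       (\<Sum>r=1..Suc k. (b(Suc k := a)) r * (z * x / (1 - z * x) ^ r)) +
       (\<Sum>r=1..Suc k. (b'(Suc k := a')) r * (w * x / (1 - w * x) ^ r))"
      by simp
  qed
  thus ?case by blast
qed

lemma is_partial_fraction_unique:
  assumes "is_partial_fraction k Q b b'" "is_partial_fraction k Q c c'" "r \<in> {1..k}"
  shows "b r = c r" "b' r = c' r"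
proof -
  let ?z = "root_of_unity 6"
  have eq: "(\<Sum>r=1..k. (b r - c r) * (poly [:0, 1:] (?z * x) / (1 - ?z * x) ^ r)) +
        (\<Sum>r=1..k. (b' r - c' r) * (poly [:0, 1:] (inverse ?z * x) / (1 - inverse ?z * x) ^ r)) = 0"
    if "?z * x \<noteq> 1" "inverse ?z * x \<noteq> 1" for x
  proof -
    have "1 - x + x ^ 2 \<noteq> 0"
      unfolding root_of_unity_6_factor using that by auto
    hence "poly Q x / (1 - x + x ^ 2) ^ k = (\<Sum>r=1..k. b r * (?z * x / (1 - ?z * x) ^ r)) +
          (\<Sum>r=1..k. b' r * (inverse ?z * x / (1 - inverse ?z * x) ^ r))"
      and "poly Q x / (1 - x + x ^ 2) ^ k = (\<Sum>r=1..k. c r * (?z * x / (1 - ?z * x) ^ r)) +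
          (\<Sum>r=1..k. c' r * (inverse ?z * x / (1 - inverse ?z * x) ^ r))"
      using assms(1,2) unfolding is_partial_fraction_def by blast+
    hence "(\<Sum>r=1..k. b r * (?z * x / (1 - ?z * x) ^ r)) +
          (\<Sum>r=1..k. b' r * (inverse ?z * x / (1 - inverse ?z * x) ^ r)) =
          (\<Sum>r=1..k. c r * (?z * x / (1 - ?z * x) ^ r)) +
          (\<Sum>r=1..k. c' r * (inverse ?z * x / (1 - inverse ?z * x) ^ r))"
      by simp
    thus ?thesis
      unfolding left_diff_distrib sum_subtractf by (simp add: algebra_simps)
  qed
  have "b r - c r = 0"
    by (rule pole_sum_independent[where p = "\<lambda>_. [:0, 1:]" and c = "\<lambda>r. b r - c r"
          and c' = "\<lambda>r. b' r - c' r" and k = k and C = 0 and \<alpha> = ?z and \<beta> = "inverse ?z"])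
       (use root_of_unity_6_props assms(3) eq in auto)
  moreover have "b' r - c' r = 0"
    by (rule pole_sum_independent[where p = "\<lambda>_. [:0, 1:]" and c = "\<lambda>r. b' r - c' r"
          and c' = "\<lambda>r. b r - c r" and k = k and C = 0 and \<alpha> = "inverse ?z" and \<beta> = ?z])
       (use root_of_unity_6_props assms(3) eq in \<open>auto simp: add.commute\<close>)
  ultimately show "b r = c r" "b' r = c' r" by auto
qed

text \<open>Resolves the definite description behind \<open>b_coeff\<close>. Truncating both
  families to 0 outside 1..k turns the uniqueness for indices in 1..k into uniqueness as
  functions.\<close>

lemma is_partial_fraction_b_coeff:
  assumes "degree Q \<le> 2 * k" "poly Q 0 = 0"
  obtains b' where "is_partial_fraction k Q (b_coeff k Q) b'"
proof -
  define P where "P p \<longleftrightarrow> is_partial_fraction k Q (fst p) (snd p) \<and>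
        (\<forall>r. r \<notin> {1..k} \<longrightarrow> fst p r = 0 \<and> snd p r = 0)" for p :: "(nat \<Rightarrow> complex) \<times> (nat \<Rightarrow> complex)"
  obtain b b' where b: "is_partial_fraction k Q b b'"
    using is_partial_fraction_exists[OF assms] by blast
  have "is_partial_fraction k Q (\<lambda>r. if r \<in> {1..k} then b r else 0) (\<lambda>r. if r \<in> {1..k} then b' r else 0)"
    using b by (simp add: is_partial_fraction_def)
  hence ex: "P (\<lambda>r. if r \<in> {1..k} then b r else 0, \<lambda>r. if r \<in> {1..k} then b' r else 0)"
    by (simp add: P_def)
  have "p = q" if "P p" "P q" for p q
  proof -
    have "fst p r = fst q r \<and> snd p r = snd q r" for r
    proof (cases "r \<in> {1..k}")
      case True
      thus ?thesis
        using is_partial_fraction_unique[of k Q "fst p" "snd p" "fst q" "snd q" r] that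
        unfolding P_def by blast
    next
      case False
      thus ?thesis using that unfolding P_def by metis
    qed
    thus ?thesis by (simp add: prod_eq_iff fun_eq_iff)
  qed
  with ex have "\<exists>!p. P p" by blast
  hence "P (partial_fraction k Q)"
    unfolding partial_fraction_def P_def by (rule theI')
  with that show ?thesis by (auto simp: P_def b_coeff_def)
qed

text \<open>The origin of \<open>d_coeff\<close>: Stirling expansion of each pole, followed by an
  exchange of the sums over l <= r.\<close>

lemma pole_sum_eq_neg_polylog_sum:
  assumes "y \<noteq> 1"
  shows "(\<Sum>r=1..k. b r * (y / (1 - y) ^ r)) =
         (\<Sum>l=1..k. (\<Sum>r=l..k. b r / fact (r - 1) * of_nat (stirling (r - 1) (l -
             1))) * neg_polylog (l - 1) y)"
proof -
  let ?t = "\<lambda>r l. b r / fact (r - 1) * of_nat (stirling (r - 1) (l - 1)) * neg_polylog (l - 1) y"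
  have "(\<Sum>r=1..k. b r * (y / (1 - y) ^ r)) = (\<Sum>r=1..k. \<Sum>l | l \<in> {1..k} \<and> l \<le> r. ?t r l)"
  proof (intro sum.cong refl)
    fix r assume r: "r \<in> {1..k}"
    then obtain r' where r': "r = Suc r'" by (cases r) auto
    have "b r * (y / (1 - y) ^ r) = (\<Sum>l\<le>r'. ?t r (Suc l))"
      unfolding r' pole_eq_sum_neg_polylog[OF assms] sum_distrib_left
      by (simp add: mult.assoc)
    also have "\<dots> = (\<Sum>l | l \<in> {1..k} \<and> l \<le> r. ?t r l)"
      by (rule sum.reindex_bij_witness[of _ "\<lambda>l. l - 1" Suc]) (use r r' in auto)
    finally show "b r * (y / (1 - y) ^ r) = \<dots>" .
  qed
  also have "\<dots> = (\<Sum>l=1..k. \<Sum>r | r \<in> {1..k} \<and> l \<le> r. ?t r l)"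
    by (rule sum.swap_restrict) auto
  also have "\<dots> = (\<Sum>l=1..k. (\<Sum>r=l..k. b r / fact (r - 1) * of_nat (stirling (r - 1) (l -
      1))) * neg_polylog (l - 1) y)"
    unfolding sum_distrib_right by (intro sum.cong refl) auto
  finally show ?thesis .
qed

text \<open>Inversion x -> 1/x exchanges the two families of poles, because
  \<open>z * (1 / x)\<close> is the inverse of \<open>w * x\<close>, and
  \<open>neg_polylog_inverse\<close> contributes the sign (-1)^l. Independence of the poles then
  forces \<open>d' l = (-1) ^ l * d l\<close>.\<close>

lemma symmetric_fraction_eq_neg_polylog_sum:
  assumes deg: "degree Q \<le> 2 * k" and Q0: "poly Q 0 = 0"
    and sym: "\<And>x. x \<noteq> 0 \<Longrightarrow> poly Q x = x ^ (2 * k) * poly Q (1 / x)"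
    and x: "1 - x + x ^ 2 \<noteq> 0"
  shows "poly Q x / (1 - x + x ^ 2) ^ k =
           (\<Sum>l=1..k. d_coeff k Q l *
             (neg_polylog (l - 1) (root_of_unity 6 * x) +
              (-1) ^ l * neg_polylog (l - 1) (inverse (root_of_unity 6) * x)))"
proof -
  define z where "z = root_of_unity 6"
  define w where "w = inverse z"
  have zw: "z * w = 1" "z \<noteq> w" "z \<noteq> 0" "w \<noteq> 0"
    using root_of_unity_6_props(1,7) by (auto simp: z_def w_def)
  have fac: "1 - x + x ^ 2 \<noteq> 0 \<longleftrightarrow> z * x \<noteq> 1 \<and> w * x \<noteq> 1" for x
    unfolding root_of_unity_6_factor z_def w_def by auto
  obtain b' where b': "is_partial_fraction k Q (b_coeff k Q) b'"
    using is_partial_fraction_b_coeff[OF deg Q0] .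
  define d where "d = d_coeff k Q"
  define d' where "d' l = (\<Sum>r=l..k. b' r / fact (r - 1) * of_nat (stirling (r - 1) (l - 1)))" for l
  let ?R = "\<lambda>x. poly Q x / (1 - x + x ^ 2) ^ k"
  have R: "?R x = (\<Sum>l=1..k. d l * neg_polylog (l - 1) (z * x)) + (\<Sum>l=1..k. d' l * neg_polylog (l -
      1) (w * x))"
    if "z * x \<noteq> 1" "w * x \<noteq> 1" for x
  proof -
    have "?R x = (\<Sum>r=1..k. b_coeff k Q r * (z * x / (1 - z * x) ^ r)) +
                 (\<Sum>r=1..k. b' r * (w * x / (1 - w * x) ^ r))"
      using b' fac[of x] that unfolding is_partial_fraction_def z_def w_def by blast
    thus ?thesis
      unfolding d_def d'_def d_coeff_def
      unfolding pole_sum_eq_neg_polylog_sum[OF that(1)] pole_sum_eq_neg_polylog_sum[OF that(2)] .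
  qed
  have R_inv: "?R (1 / x) = ?R x" if "x \<noteq> 0" for x
  proof -
    have "1 - 1 / x + (1 / x) ^ 2 = (1 - x + x ^ 2) / x ^ 2"
      using that by (simp add: field_simps power2_eq_square)
    thus ?thesis
      using sym[OF that] that by (simp add: power_divide power_mult)
  qed
  \<comment> \<open>The constants left by the inversion formula, which occur only at order 0, that
    is l = 1.\<close>
  define C where "C = (\<Sum>l=1..k. d l * (if l = 1 then 1 else 0)) + (\<Sum>l=1..k. d' l * (if l =
      1 then 1 else 0))"
  \<comment> \<open>Comparing the expansions of the invariant function at \<open>x\<close> and \<open>1 / x\<close>.\<close>
  have eq: "(\<Sum>l=1..k. (d l - (-1) ^ l * d' l) * (poly (eulerian_poly (l - 1)) (z * x) / (1 -
      z * x) ^ l)) +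
        (\<Sum>l=1..k. (d' l - (-1) ^ l * d l) * (poly (eulerian_poly (l - 1)) (w * x) / (1 -
            w * x) ^ l)) = - C"
    if x: "x \<noteq> 0" "z * x \<noteq> 1" "w * x \<noteq> 1" for x
  proof -
    have zx: "z * (1 / x) = inverse (w * x)" "w * (1 / x) = inverse (z * x)"
      using zw by (simp_all add: w_def field_simps)
    have "z * (1 / x) \<noteq> 1" "w * (1 / x) \<noteq> 1"
      unfolding zx using x by (metis inverse_inverse_eq inverse_1)+
    hence "?R x = (\<Sum>l=1..k. d l * neg_polylog (l - 1) (z * (1 / x))) +
                  (\<Sum>l=1..k. d' l * neg_polylog (l - 1) (w * (1 / x)))"
      using R[of "1 / x"] R_inv[OF x(1)] by simp
    also have "\<dots> = (\<Sum>l=1..k. d l * ((-1) ^ l * neg_polylog (l - 1) (w * x) - (if l = 1 then 1 else 0))) +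
                  (\<Sum>l=1..k. d' l * ((-1) ^ l * neg_polylog (l - 1) (z * x) - (if l = 1 then 1 else 0)))"
      unfolding zx
      by (intro arg_cong2[where f = "(+)"] sum.cong refl; subst neg_polylog_inverse)
         (use x zw in auto)
    also have "\<dots> = (\<Sum>l=1..k. (-1) ^ l * d l * neg_polylog (l - 1) (w * x)) +
                  (\<Sum>l=1..k. (-1) ^ l * d' l * neg_polylog (l - 1) (z * x)) - C"
      unfolding C_def right_diff_distrib sum_subtractf by (simp only: mult_ac diff_diff_eq2 add_diff_eq) 
        (simp add: algebra_simps)
    finally have "(\<Sum>l=1..k. (d l - (-1) ^ l * d' l) * neg_polylog (l - 1) (z * x)) +
        (\<Sum>l=1..k. (d' l - (-1) ^ l * d l) * neg_polylog (l - 1) (w * x)) = - C"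
      unfolding R[OF x(2,3)] by (simp add: left_diff_distrib sum_subtractf algebra_simps)
    also have "(\<Sum>l=1..k. (d l - (-1) ^ l * d' l) * neg_polylog (l - 1) (z * x)) =
      (\<Sum>l=1..k. (d l - (-1) ^ l * d' l) * (poly (eulerian_poly (l - 1)) (z * x) / (1 - z * x) ^ l))"
      unfolding neg_polylog_def by (intro sum.cong refl) auto
    also have "(\<Sum>l=1..k. (d' l - (-1) ^ l * d l) * neg_polylog (l - 1) (w * x)) =
      (\<Sum>l=1..k. (d' l - (-1) ^ l * d l) * (poly (eulerian_poly (l - 1)) (w * x) / (1 - w * x) ^ l))"
      unfolding neg_polylog_def by (intro sum.cong refl) auto
    finally show ?thesis .
  qed
  have d': "d' l = (-1) ^ l * d l" if "l \<in> {1..k}" for l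
  proof -
    have "d' l - (-1) ^ l * d l = 0"
      by (rule pole_sum_independent[where p = "\<lambda>l. eulerian_poly (l - 1)" and k = k and C = "-C"
          and c = "\<lambda>l. d' l - (-1) ^ l * d l" and c' = "\<lambda>l. d l - (-1) ^ l * d' l"
          and \<alpha> = w and \<beta> = z]) (use zw that eq in \<open>auto simp: add.commute\<close>)
    thus ?thesis by simp
  qed
  have "?R x = (\<Sum>l=1..k. d l * neg_polylog (l - 1) (z * x)) + (\<Sum>l=1..k. d' l * neg_polylog (l -
      1) (w * x))"
    using R fac x by blast
  also have "(\<Sum>l=1..k. d' l * neg_polylog (l - 1) (w * x)) =
             (\<Sum>l=1..k. d l * ((-1) ^ l * neg_polylog (l - 1) (w * x)))"
    by (intro sum.cong refl) (simp add: d')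
  finally show ?thesis
    by (simp add: d_def z_def w_def distrib_left sum.distrib)
qed


section \<open>Analytic continuation of polylogarithms and Dirichlet series\<close>

text \<open>Repeated summation by parts replaces \<open>m\<^sup>-\<^sup>s\<close> in \<open>\<Sum> y\<^sup>m m\<^sup>-\<^sup>s\<close> by its \<open>K\<close>-th forward difference, which is
  \<open>O(m\<^bsup>-s-K\<^esup>)\<close>, so that the series converges for \<open>Re s > 1 - K\<close>; for \<open>s = -n\<close> and \<open>K > n\<close> it vanishes.\<close>

fun powr_forward_diff :: "nat \<Rightarrow> complex \<Rightarrow> complex \<Rightarrow> complex" where
  "powr_forward_diff 0 s x = x powr (-s)"
| "powr_forward_diff (Suc K) s x = powr_forward_diff K s (x + 1) - powr_forward_diff K s x"

lemma has_field_derivative_powr_forward_diff: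
  "Re x > 0 \<Longrightarrow> (powr_forward_diff K s has_field_derivative - s * powr_forward_diff K (s + 1) x) (at x)"
proof (induction K arbitrary: x)
  case 0
  have [simp]: "powr_forward_diff 0 s = (\<lambda>x. x powr (-s))" by auto
  have "x \<notin> \<real>\<^sub>\<le>\<^sub>0" using 0 by (auto simp: complex_nonpos_Reals_iff)
  hence "((\<lambda>x. x powr (-s)) has_field_derivative (- s * x powr (-s - 1))) (at x)"
    by (rule has_field_derivative_powr)
  thus ?case by simp
next
  case (Suc K)
  have [simp]: "powr_forward_diff (Suc K) s = (\<lambda>x. powr_forward_diff K s (x + 1) -
      powr_forward_diff K s x)" by auto
  have "((\<lambda>x. powr_forward_diff K s (x + 1)) has_field_derivative -
      s * powr_forward_diff K (s + 1) (x + 1)) (at x)"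
    using Suc.IH[of "x + 1"] Suc.prems DERIV_shift[of "powr_forward_diff K s" _ x 1] by simp
  thus ?case
    using Suc by (auto intro!: derivative_eq_intros simp: algebra_simps)
qed

text \<open>Mean value inequality on [x, x + 1]: differentiating in the base variable replaces s by
  s + 1 with a factor -s, and s times \<open>pochhammer (s + 1) K\<close> is
  \<open>pochhammer s (Suc K)\<close>. The condition on \<open>Re s\<close> makes the bound
  decreasing, so its value at the left end serves the whole segment.\<close>

lemma norm_powr_forward_diff_le:
  assumes "x > 0" "Re s + real K \<ge> 0"
  shows "norm (powr_forward_diff K s (of_real x)) \<le> norm (pochhammer s K) * x powr (- (Re s + real K))"
  using assms
proof (induction K arbitrary: s x)
  case 0
  thus ?case by (simp add: norm_powr_real_powr)
next
  case (Suc K)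
  define S where "S = closed_segment (complex_of_real x) (of_real x + 1)"
  have S: "\<exists>t\<ge>x. z = of_real t" if z: "z \<in> S" for z
  proof -
    obtain u where "u \<ge> 0" "z = of_real x + of_real u"
      using z unfolding S_def closed_segment_def by (auto simp: algebra_simps scaleR_conv_of_real)
    thus ?thesis by (intro exI[of _ "x + u"]) auto
  qed
  define B where "B = norm (pochhammer s (Suc K)) * x powr (- (Re s + real (Suc K)))"
  have "norm (powr_forward_diff K s (of_real x + 1) - powr_forward_diff K s (of_real x)) \<le>
        B * norm ((of_real x + 1) - complex_of_real x)"
  proof (rule field_differentiable_bound[where S = S])
    fix z assume "z \<in> S"
    then obtain t where t: "t \<ge> x" "z = of_real t" using S by blast
    show "(powr_forward_diff K s has_field_derivative - s * powr_forward_diff K (s + 1) z) (at z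
        within S)"
      by (rule has_field_derivative_at_within, rule has_field_derivative_powr_forward_diff)
         (use t Suc.prems in auto)
    have "norm (powr_forward_diff K (s + 1) z) \<le> norm (pochhammer (s + 1) K) * t powr (- (Re (s + 1)
        + real K))"
      unfolding t using Suc.prems t by (intro Suc.IH) auto
    also have "\<dots> \<le> norm (pochhammer (s + 1) K) * x powr (- (Re (s + 1) + real K))"
      using Suc.prems t by (intro mult_left_mono powr_mono2') auto
    finally have "norm (powr_forward_diff K (s + 1) z) \<le> \<dots>" .
    from mult_left_mono[OF this norm_ge_zero[of s]] show "norm (- s * powr_forward_diff K (s + 1) z) \<le> B"
      by (simp add: B_def pochhammer_rec norm_mult mult_ac add_ac)
  qed (auto simp: S_def)
  thus ?case by (simp add: B_def)
qed

lemma powr_forward_diff_holomorphic: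
  assumes "x > 0"
  shows "(\<lambda>s. powr_forward_diff K s (of_real x)) holomorphic_on A"
  using assms
proof (induction K arbitrary: x)
  case (Suc K)
  from Suc.IH[of x] Suc.IH[of "x + 1"] Suc.prems show ?case
    by (auto intro!: holomorphic_intros)
qed (auto intro!: holomorphic_intros)

text \<open>Differences of order K kill polynomials of degree below K. Here the general bound
  already says so, as the Pochhammer symbol of -n vanishes for K > n.\<close>

lemma powr_forward_diff_nonpos_Int_eq_0:
  assumes "x > 0" "n < K"
  shows "powr_forward_diff K (- of_nat n) (of_real x) = 0"
proof -
  have "pochhammer (- of_nat n :: complex) K = 0"
    using assms by (simp add: pochhammer_of_nat_eq_0_iff)
  thus ?thesis
    using norm_powr_forward_diff_le[of x "- of_nat n" K] assms by simp
qed

lemma powr_forward_diff_series_holomorphic: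
  assumes y: "norm y \<le> 1"
  obtains F where "F holomorphic_on {s. Re s + real K > 1}"
    and "\<And>s. Re s + real K > 1 \<Longrightarrow> (\<lambda>m. y ^ Suc m * powr_forward_diff K s (of_nat (Suc m))) sums F s"
proof -
  define S where "S = {s. Re s + real K > 1}"
  have "open S"
    unfolding S_def by (intro open_Collect_less continuous_intros)
  obtain F where F: "\<forall>s\<in>S. (\<lambda>m. y ^ Suc m * powr_forward_diff K s (of_nat (Suc m))) sums F s \<and>
      F field_differentiable (at s)"
  proof (rule series_differentiable_comparison_complex[OF \<open>open S\<close>])
    show "(\<lambda>s. y ^ Suc m * powr_forward_diff K s (of_nat (Suc m))) field_differentiable (at s)" for m s
    proof -
      have "(\<lambda>s. powr_forward_diff K s (of_real (real (Suc m)))) holomorphic_on UNIV"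
        by (rule powr_forward_diff_holomorphic) auto
      hence "(\<lambda>s. y ^ Suc m * powr_forward_diff K s (of_nat (Suc m))) holomorphic_on UNIV"
        by (auto intro!: holomorphic_intros)
      thus ?thesis by (simp add: holomorphic_on_open field_differentiable_def)
    qed
  next
    fix s0 assume s0: "s0 \<in> S"
    \<comment> \<open>Half the distance of \<open>s0\<close> from the boundary line: on the ball of
      this radius the decay exponent stays at least 1 + d.\<close>
    define d where "d = (Re s0 + real K - 1) / 2"
    have d: "d > 0" using s0 by (simp add: d_def S_def)
    have "compact ((\<lambda>s. pochhammer s K :: complex) ` cball s0 d)"
      by (intro compact_continuous_image) (auto simp: pochhammer_prod intro!: continuous_intros)
    then obtain B where B: "B > 0" "\<And>s. s \<in> cball s0 d \<Longrightarrow> norm (pochhammer s K) \<le> B"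
      by (auto dest!: compact_imp_bounded simp: bounded_pos)
    define h where "h m = complex_of_real (B * real (Suc m) powr (- (1 + d)))" for m
    have "summable (\<lambda>m. real (Suc m) powr (- (1 + d)))"
      using d summable_real_powr_iff[of "-(1+d)"] by (subst summable_Suc_iff) auto
    hence "summable h"
      unfolding h_def by (intro summable_of_real summable_mult)
    moreover have "range h \<subseteq> \<real>\<^sub>\<ge>\<^sub>0"
      using B by (auto simp: h_def simp del: of_real_mult)
    moreover have "norm (y ^ Suc m * powr_forward_diff K s (of_nat (Suc m))) \<le> norm (h m)"
        if s: "s \<in> ball s0 d" for m s
    proof -
      have "\<bar>Re s0 - Re s\<bar> < d"
        using s abs_Re_le_cmod[of "s0 - s"] by (simp add: dist_norm)
      hence Re: "Re s + real K \<ge> 1 + d" by (simp add: d_def abs_if field_simps split: if_splits)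
      have "norm (y ^ Suc m * powr_forward_diff K s (of_nat (Suc m))) \<le>
          1 * norm (powr_forward_diff K s (of_real (real (Suc m))))"
        unfolding norm_mult norm_power of_real_of_nat_eq
        by (intro mult_right_mono power_le_one) (use y in auto)
      also have "\<dots> \<le> norm (pochhammer s K) * real (Suc m) powr (- (Re s + real K))"
        using Re d unfolding mult_1 by (intro norm_powr_forward_diff_le) auto
      also have "\<dots> \<le> B * real (Suc m) powr (- (1 + d))"
        using Re s B(1) by (intro mult_mono B powr_mono) auto
      also have "\<dots> = norm (h m)" using B by (simp add: h_def norm_mult)
      finally show ?thesis .
    qed
    ultimately show "\<exists>d h. 0 < d \<and> summable h \<and> range h \<subseteq> \<real>\<^sub>\<ge>\<^sub>0 \<and>
      (\<forall>\<^sub>F m in sequentially. \<forall>s\<in>ball s0 d \<inter> S. cmod (y ^ Suc m * powr_forward_diff K s (of_nat (Suc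
          m))) \<le> cmod (h m))"
      using d by (intro exI[of _ d] exI[of _ h]) auto
  qed auto
  show ?thesis
  proof
    show "F holomorphic_on {s. Re s + real K > 1}"
      using F \<open>open S\<close> unfolding S_def[symmetric]
      by (auto simp: holomorphic_on_open field_differentiable_def)
  qed (use F in \<open>auto simp: S_def\<close>)
qed

text \<open>One summation by parts: shifting the index divides by y, and the subtracted term is the
  boundary contribution at m = 1.\<close>

lemma sums_powr_forward_diff_Suc:
  assumes "(\<lambda>m. y ^ Suc m * powr_forward_diff K s (of_nat (Suc m))) sums A" "y \<noteq> 0"
  shows "(\<lambda>m. y ^ Suc m * powr_forward_diff (Suc K) s (of_nat (Suc m))) sums ((1 - y) / y * A -
      powr_forward_diff K s 1)"
proof -
  have "(\<lambda>m. y ^ Suc (Suc m) * powr_forward_diff K s (of_nat (Suc (Suc m)))) sums (A -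
      y * powr_forward_diff K s 1)"
    using assms(1) by (subst sums_Suc_iff) simp
  from sums_diff[OF sums_divide[OF this, of y] assms(1)] show ?thesis
    using assms(2) by (simp add: algebra_simps diff_divide_distrib)
qed

lemma sums_powr_forward_diff_eq:
  assumes "(\<lambda>m. y ^ Suc m * powr_forward_diff 0 s (of_nat (Suc m))) sums A" "y \<noteq> 0" "y \<noteq> 1"
    and "(\<lambda>m. y ^ Suc m * powr_forward_diff K s (of_nat (Suc m))) sums A'"
  shows "A = (\<Sum>j<K. (y / (1 - y)) ^ Suc j * powr_forward_diff j s 1) + (y / (1 - y)) ^ K * A'"
  using assms(4)
proof (induction K arbitrary: A')
  case 0
  thus ?case using sums_unique2[OF assms(1)] by simp
next
  case (Suc K)
  have "\<exists>A''. (\<lambda>m. y ^ Suc m * powr_forward_diff K s (of_nat (Suc m))) sums A''" for K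
    by (induction K) (use assms(1,2) sums_powr_forward_diff_Suc in blast)+
  then obtain A'' where A'': "(\<lambda>m. y ^ Suc m * powr_forward_diff K s (of_nat (Suc m))) sums A''" by blast
  have "A' = (1 - y) / y * A'' - powr_forward_diff K s 1"
    using sums_unique2[OF Suc.prems sums_powr_forward_diff_Suc[OF A'' assms(2)]] .
  hence "y / (1 - y) * A' = A'' - y / (1 - y) * powr_forward_diff K s 1"
    using assms by (simp add: field_simps)
  hence "(y / (1 - y)) ^ Suc K * A' = (y / (1 - y)) ^ K * (A'' - y / (1 - y) * powr_forward_diff K s 1)"
    by (simp only: power_Suc2 mult.assoc)
  thus ?case
    using Suc.IH[OF A''] by (simp add: algebra_simps)
qed

text \<open>For 0 < |y| < 1 this is the (n + 1)-fold summation by parts of the power series, whose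
  remainder vanishes. On the unit circle the series is no longer available, but both sides are
  continuous away from 1, so the identity follows by a radial limit.\<close>

lemma neg_polylog_eq_powr_forward_diff_sum:
  assumes "norm y = 1" "y \<noteq> 1"
  shows "neg_polylog n y = (\<Sum>j\<le>n. (y / (1 - y)) ^ Suc j * powr_forward_diff j (- of_nat n) 1)"
proof -
  let ?g = "\<lambda>y. \<Sum>j\<le>n. (y / (1 - y)) ^ Suc j * powr_forward_diff j (- of_nat n) 1"
  have inside: "neg_polylog n y = ?g y" if "norm y < 1" "y \<noteq> 0" for y
  proof -
    have "(\<lambda>m. y ^ Suc m * powr_forward_diff 0 (- of_nat n) (of_nat (Suc m))) sums neg_polylog n y"
      using neg_polylog_sums[OF that(1), of n] by (simp add: mult_ac del: of_nat_Suc)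
    moreover have "powr_forward_diff (Suc n) (- of_nat n) (of_nat (Suc m)) = 0" for m
      using powr_forward_diff_nonpos_Int_eq_0[of "real (Suc m)" n "Suc n"] by simp
    hence "(\<lambda>m. y ^ Suc m * powr_forward_diff (Suc n) (- of_nat n) (of_nat (Suc m))) sums 0"
      by (simp only: mult_zero_right sums_0)
    moreover have "y \<noteq> 1" using that by auto
    ultimately have "neg_polylog n y = (\<Sum>j<Suc n. (y / (1 -
        y)) ^ Suc j * powr_forward_diff j (- of_nat n) 1) +
        (y / (1 - y)) ^ Suc n * 0"
      using that(2) by (intro sums_powr_forward_diff_eq)
    thus ?thesis by (simp only: lessThan_Suc_atMost mult_zero_right add_0_right)
  qed
  have lim: "((\<lambda>t. f (of_real t * y)) \<longlongrightarrow> f y) (at_left 1)" if "isCont f y" for f :: "complex \<Rightarrow> complex"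
  proof -
    have "((\<lambda>t. of_real t * y) \<longlongrightarrow> of_real 1 * y) (at_left (1::real))"
      by (intro tendsto_intros)
    thus ?thesis using isCont_tendsto_compose[OF that, of "\<lambda>t. of_real t * y" "at_left 1"] by simp
  qed
  have "isCont ?g y"
    using assms by (intro continuous_intros) auto
  hence "((\<lambda>t. ?g (of_real t * y)) \<longlongrightarrow> ?g y) (at_left 1)" by (rule lim)
  moreover have "eventually (\<lambda>t. t \<in> {0<..<1}) (at_left (1::real))"
    by (rule eventually_at_left_real) simp
  hence "eventually (\<lambda>t. ?g (of_real t * y) = neg_polylog n (of_real t * y)) (at_left 1)"
  proof eventually_elim
    case (elim t)
    hence "norm (of_real t * y) < 1" "of_real t * y \<noteq> 0"
      using assms by (auto simp: norm_mult)
    from inside[OF this] show ?case by (rule sym)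
  qed
  ultimately have "((\<lambda>t. neg_polylog n (of_real t * y)) \<longlongrightarrow> ?g y) (at_left 1)"
    by (rule Lim_transform_eventually)
  with lim[OF continuous_neg_polylog[OF assms(2)]] show ?thesis
    by (intro tendsto_unique[of "at_left (1::real)"]) auto
qed

lemma polylog_continuation:
  assumes y: "norm y = 1" "y \<noteq> 1"
  obtains \<Lambda> where "\<Lambda> holomorphic_on UNIV"
    and "\<forall>s. Re s > 1 \<longrightarrow> (\<lambda>m. y ^ Suc m * of_nat (Suc m) powr (- s)) sums \<Lambda> s"
    and "\<forall>n. \<Lambda> (- of_nat n) = neg_polylog n y"
proof -
  define t where "t = y / (1 - y)"
  have y0: "y \<noteq> 0" using y by auto
  have "\<exists>F. \<forall>K. F K holomorphic_on {s. Re s + real K > 1} \<and>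
     (\<forall>s. Re s + real K > 1 \<longrightarrow> (\<lambda>m. y ^ Suc m * powr_forward_diff K s (of_nat (Suc m))) sums F K s)"
    by (intro choice allI, rule powr_forward_diff_series_holomorphic[of y]) (use y in auto)
  then obtain F where F: "\<And>K. F K holomorphic_on {s. Re s + real K > 1}"
     "\<And>K s. Re s + real K > 1 \<Longrightarrow> (\<lambda>m. y ^ Suc m * powr_forward_diff K s (of_nat (Suc m))) sums F K s"
    by blast
  \<comment> \<open>The result of K summations by parts. Where \<open>F K\<close> converges, one
    more changes nothing, so the \<open>G K\<close> on growing half-planes glue to an entire
    function.\<close>
  define G where "G K s = (\<Sum>j<K. t ^ Suc j * powr_forward_diff j s 1) + t ^ K * F K s" for K s
  have G_Suc: "G (Suc K) s = G K s" if "Re s + real K > 1" for K s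
  proof -
    have "F (Suc K) s = (1 - y) / y * F K s - powr_forward_diff K s 1"
      using sums_powr_forward_diff_Suc[OF F(2)[OF that] y0] F(2)[of s "Suc K"] that by (simp add:
          sums_unique2)
    hence "t * F (Suc K) s = F K s - t * powr_forward_diff K s 1"
      using y y0 by (simp add: t_def field_simps)
    hence "t ^ Suc K * F (Suc K) s = t ^ K * (F K s - t * powr_forward_diff K s 1)"
      by (simp only: power_Suc2 mult.assoc)
    thus ?thesis by (simp add: G_def algebra_simps)
  qed
  have G_mono: "G K' s = G K s" if "Re s + real K > 1" "K \<le> K'" for K K' s
    using that(2,1) by (induction K' rule: dec_induct) (auto simp: G_Suc)
  define N where "N s = nat \<lceil>2 - Re s\<rceil>" for s
  have N: "Re s + real (N s) > 1" for s unfolding N_def by linarith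
  define \<Lambda> where "\<Lambda> s = G (N s) s" for s
  have \<Lambda>: "\<Lambda> s = G K s" if "Re s + real K > 1" for s K
    using G_mono[OF that, of "max K (N s)"] G_mono[OF N[of s], of "max K (N s)"]
    by (simp add: \<Lambda>_def)
  have hol: "\<Lambda> holomorphic_on {s. Re s + real K > 1}" for K
  proof -
    have "(\<lambda>s. powr_forward_diff j s 1) holomorphic_on A" for j A
      using powr_forward_diff_holomorphic[of 1 j A] by simp
    hence "G K holomorphic_on {s. Re s + real K > 1}"
      unfolding G_def by (intro holomorphic_intros F)
    thus ?thesis
      by (rule holomorphic_transform) (use \<Lambda> in auto)
  qed
  show ?thesis
  proof (rule that)
    have "\<Lambda> holomorphic_on (\<Union>K. {s. Re s + real K > 1})"
      by (rule holomorphic_on_UN_open) (auto intro!: hol open_Collect_less continuous_intros)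
    also have "(\<Union>K. {s. Re s + real K > 1}) = UNIV"
      using N by auto
    finally show "\<Lambda> holomorphic_on UNIV" .
    show "\<forall>s. Re s > 1 \<longrightarrow> (\<lambda>m. y ^ Suc m * of_nat (Suc m) powr (- s)) sums \<Lambda> s"
    proof (intro allI impI)
      fix s :: complex assume "Re s > 1"
      thus "(\<lambda>m. y ^ Suc m * of_nat (Suc m) powr (- s)) sums \<Lambda> s"
        using \<Lambda>[of s 0] F(2)[of s 0] by (simp add: G_def)
    qed
    show "\<forall>n. \<Lambda> (- of_nat n) = neg_polylog n y"
    proof
      fix n
      \<comment> \<open>The order n + 2 is the least K for which -n lies in the half-plane
        \<open>Re s + real K > 1\<close>. The extra boundary term j = n + 1 vanishes as
        well.\<close>
      have "powr_forward_diff (n + 2) (- of_nat n) (of_nat (Suc m)) = 0" for m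
        using powr_forward_diff_nonpos_Int_eq_0[of "real (Suc m)" n "n + 2"] by simp
      hence "(\<lambda>m. y ^ Suc m * powr_forward_diff (n + 2) (- of_nat n) (of_nat (Suc m))) sums 0"
        by (simp only: mult_zero_right sums_0)
      hence "F (n + 2) (- of_nat n) = 0"
        using F(2)[of "- of_nat n" "n + 2"] by (simp add: sums_unique2)
      hence "\<Lambda> (- of_nat n) = (\<Sum>j<n+2. t ^ Suc j * powr_forward_diff j (- of_nat n) 1)"
        using \<Lambda>[of "- of_nat n" "n + 2"] by (simp add: G_def)
      also have "\<dots> = (\<Sum>j\<le>n. t ^ Suc j * powr_forward_diff j (- of_nat n) 1)"
        using powr_forward_diff_nonpos_Int_eq_0[of 1 n "Suc n"] by (simp add: lessThan_Suc_atMost)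
      also have "\<dots> = neg_polylog n y"
        using neg_polylog_eq_powr_forward_diff_sum[OF y] by (simp add: t_def)
      finally show "\<Lambda> (- of_nat n) = neg_polylog n y" .
    qed
  qed
qed

section \<open>Evaluating the definite description of L-functions\<close>

text \<open>After removal of singularities the identity theorem makes the difference vanish
  everywhere, so f and g agree near, though perhaps not at, each point. Niceness then fixes the
  value itself: it is the limit, or 0 at a pole.\<close>

lemma nicely_meromorphic_on_unique:
  assumes f: "f nicely_meromorphic_on UNIV" and g: "g nicely_meromorphic_on UNIV"
    and eq: "\<And>s. s \<in> U \<Longrightarrow> f s = g s" and U: "open U" "s0 \<in> U"
  shows "f = g"
proof
  fix s
  have fm: "f meromorphic_on UNIV" and gm: "g meromorphic_on UNIV"
    using f g by (auto simp: nicely_meromorphic_on_def)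
  let ?h = "\<lambda>s. f s - g s"
  have hm: "?h meromorphic_on UNIV" by (intro meromorphic_intros fm gm)
  have rs: "eventually (\<lambda>w. remove_sings ?h w = ?h w) (at w)" for w
    by (rule eventually_remove_sings_eq_at)
       (use hm in \<open>auto intro!: meromorphic_on_isolated_singularity meromorphic_on_subset[OF hm]\<close>)
  have "eventually (\<lambda>w. w \<in> U) (at s0)"
    using U by (intro eventually_at_in_open') auto
  with rs have "eventually (\<lambda>w. remove_sings ?h w = 0) (at s0)"
    by eventually_elim (use eq in auto)
  hence "frequently (\<lambda>w. remove_sings ?h w = 0) (at s0)"
    by (rule eventually_frequently[rotated]) auto
  hence "remove_sings ?h w = 0" for w
    using frequently_eq_meromorphic_imp_constant[of "remove_sings ?h" 0 s0 UNIV w]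
      remove_sings_nicely_meromorphic[OF hm] by auto
  with rs[of s] have ev: "eventually (\<lambda>w. f w = g w) (at s)"
    by (auto elim!: eventually_mono)
  have pole: "is_pole f s \<longleftrightarrow> is_pole g s"
    by (intro is_pole_cong ev refl)
  have lim: "(f \<longlongrightarrow> c) (at s) \<longleftrightarrow> (g \<longlongrightarrow> c) (at s)" for c
    by (intro tendsto_cong ev)
  show "f s = g s"
  proof (cases "is_pole f s")
    case True
    have "f s = 0" "g s = 0"
      using True pole f g not_tendsto_and_filterlim_at_infinity[of "at s" f "f s"]
        not_tendsto_and_filterlim_at_infinity[of "at s" g "g s"]
      unfolding nicely_meromorphic_on_def is_pole_def by auto
    thus ?thesis by simp
  next
    case False
    with pole f g have "(f \<longlongrightarrow> f s) (at s)" "(g \<longlongrightarrow> g s) (at s)"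
      unfolding nicely_meromorphic_on_def by auto
    with lim show ?thesis
      using tendsto_unique[of "at s"] by (metis trivial_limit_at)
  qed
qed

text \<open>Zeros of \<open>g\<close> outside \<open>Re s > 1\<close> need not be located:
  \<open>remove_sings\<close> turns the quotient into a nicely meromorphic function whatever happens
  there, and the quotient is only evaluated where \<open>g\<close> is nonzero.\<close>

lemma dirichlet_L_eq_quotient:
  assumes \<Lambda>: "\<Lambda> holomorphic_on UNIV" and g: "g holomorphic_on UNIV"
    and sums: "\<And>s. Re s > 1 \<Longrightarrow> g s \<noteq> 0"
      "\<And>s. Re s > 1 \<Longrightarrow> (\<lambda>n. chi (int (Suc n)) / of_nat (Suc n) powr s) sums (\<Lambda> s / g s)"
    and s: "g s \<noteq> 0"
  shows "dirichlet_L chi s = \<Lambda> s / g s"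
proof -
  define P where "P f \<longleftrightarrow> f nicely_meromorphic_on UNIV \<and>
        (\<forall>s. Re s > 1 \<longrightarrow> (\<lambda>n. chi (int (Suc n)) / of_nat (Suc n) powr s) sums f s)" for f
  define f where "f = remove_sings (\<lambda>s. \<Lambda> s / g s)"
  have an: "\<Lambda> analytic_on {s}" "g analytic_on {s}" for s
    using \<Lambda> g by (auto intro: holomorphic_on_imp_analytic_at)
  have f_eq: "f s = \<Lambda> s / g s" if "g s \<noteq> 0" for s
    unfolding f_def by (intro remove_sings_at_analytic analytic_intros an) (use that in auto)
  have "(\<lambda>s. \<Lambda> s / g s) meromorphic_on UNIV"
    using \<Lambda> g by (intro meromorphic_intros analytic_on_imp_meromorphic_on)
      (auto simp: analytic_on_open)
  hence "P f"
    unfolding P_def f_def[symmetric]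
    using sums f_eq by (auto simp: f_def intro!: remove_sings_nicely_meromorphic)
  moreover have "f1 = f2" if "P f1" "P f2" for f1 f2
  proof (rule nicely_meromorphic_on_unique[where U = "{s. Re s > 1}" and ?s0.0 = 2])
    show "open {s. Re s > 1}" by (intro open_Collect_less continuous_intros)
    show "f1 s = f2 s" if "s \<in> {s. Re s > 1}" for s
      using that \<open>P f1\<close> \<open>P f2\<close> sums_unique2 unfolding P_def by blast
  qed (use that in \<open>auto simp: P_def\<close>)
  ultimately have "dirichlet_L chi = f"
    unfolding dirichlet_L_def P_def[symmetric] by (intro the_equality) auto
  thus ?thesis using f_eq[OF s] by simp
qed


section \<open>Lambert series and special values\<close>

lemma has_sum_dilate:
  fixes a f :: "nat \<Rightarrow> 'a :: {comm_semiring_1, topological_space}"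
  assumes "M > 0" "((\<lambda>m. a m * f (M * m)) has_sum S) {0<..}"
  shows "((\<lambda>m. (if M dvd m then a (m div M) else 0) * f m) has_sum S) {0<..}"
proof -
  let ?g = "\<lambda>m. (if M dvd m then a (m div M) else 0) * f m"
  have "((?g \<circ> (*) M) has_sum S) {0<..}"
    using assms by (simp add: o_def)
  hence "(?g has_sum S) ((*) M ` {0<..})"
    by (subst has_sum_reindex) (use assms(1) in \<open>auto simp: inj_on_def\<close>)
  also have "(?g has_sum S) ((*) M ` {0<..}) \<longleftrightarrow> (?g has_sum S) {0<..}"
    by (rule has_sum_cong_neutral) (use assms(1) in \<open>auto elim!: dvdE\<close>)
  finally show ?thesis .
qed

lemma has_sum_diff:
  fixes f g :: "'a \<Rightarrow> complex"
  shows "(f has_sum S) A \<Longrightarrow> (g has_sum T) A \<Longrightarrow> ((\<lambda>x. f x - g x) has_sum (S - T)) A"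
  using has_sum_add[of f A S "\<lambda>x. - g x" "- T"] has_sum_uminusI[of g A T] by simp

lemma norm_chi32_le_1: "norm (chi32 m) \<le> 1"
  by (simp add: chi32_def)

text \<open>The sum is the Ramanujan sum c_6(m), which equals the sum over d | gcd(m, 6) of mu(6/d)
  d; hence the weights 6, -3, -2, 1. The difference is an odd function of m mod 6, and these are
  spanned by chi(m) and chi(m/2). Both identities are checked on the six residues.\<close>

lemma root_of_unity_6_power_sum:
  "root_of_unity 6 ^ m + inverse (root_of_unity 6) ^ m =
     (if 6 dvd m then 6 else 0) - (if 3 dvd m then 3 else 0) - (if 2 dvd m then 2 else 0) + 1"
  and root_of_unity_6_power_diff:
  "root_of_unity 6 ^ m - inverse (root_of_unity 6) ^ m =
     \<i> * of_real (sqrt 3) * (chi32 (int m) + (if 2 dvd m then 2 * chi32 (int (m div 2)) else 0))"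
proof -
  define z w where "z = root_of_unity 6" and "w = inverse (root_of_unity 6)"
  have w: "w = 1 - z"
    by (simp add: z_def w_def root_of_unity_6_props)
  have z6: "z ^ 6 = 1" "w ^ 6 = 1"
    using root_of_unity_6_props(5) by (simp_all only: z_def w_def power_inverse inverse_1)
  have z2: "z ^ 2 = z - 1" "w ^ 2 = w - 1"
  proof -
    show "z ^ 2 = z - 1" by (simp add: z_def root_of_unity_6_props)
    thus "w ^ 2 = w - 1" by (simp add: w power2_eq_square algebra_simps)
  qed
  have pows: "x ^ 3 = -1" "x ^ 4 = -x" "x ^ 5 = 1 - x" if "x ^ 2 = x - 1" for x :: complex
  proof -
    have "x ^ 3 = x ^ 2 * x" by (simp add: eval_nat_numeral)
    also have "\<dots> = x ^ 2 - x" unfolding that by (simp add: power2_eq_square[symmetric]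
        left_diff_distrib that)
    finally show 3: "x ^ 3 = -1" using that by simp
    have "x ^ 4 = x * x ^ 3" "x ^ 5 = x ^ 3 * x ^ 2" by (simp_all add: eval_nat_numeral)
    thus "x ^ 4 = -x" "x ^ 5 = 1 - x" using 3 that by simp_all
  qed
  have c: "\<i> * of_real (sqrt 3) = z - w"
    by (simp only: z_def w_def root_of_unity_6_props(8))
  obtain q r where m: "m = 6 * q + r" "r < 6"
    using mult_div_mod_eq[of 6 m] mod_less_divisor[of 6 m] by (metis zero_less_numeral)
  have red: "z ^ m = z ^ r" "w ^ m = w ^ r"
    by (simp_all add: m power_add power_mult z6)
  have dvd: "6 dvd m \<longleftrightarrow> r = 0" "3 dvd m \<longleftrightarrow> r = 0 \<or> r = 3" "2 dvd m \<longleftrightarrow> r = 0 \<or> r = 2 \<or> r = 4"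
    using m by presburger+
  have mod: "int m mod 3 = int r mod 3" "r = 0 \<Longrightarrow> int (m div 2) mod 3 = 0"
     "r = 2 \<Longrightarrow> int (m div 2) mod 3 = 1" "r = 4 \<Longrightarrow> int (m div 2) mod 3 = 2"
    using m by presburger+
  consider "r = 0" | "r = 1" | "r = 2" | "r = 3" | "r = 4" | "r = 5" using m(2) by linarith
  hence "z ^ m + w ^ m = (if 6 dvd m then 6 else 0) - (if 3 dvd m then 3 else 0) -
      (if 2 dvd m then 2 else 0) + 1 \<and>
     z ^ m - w ^ m = (z - w) * (chi32 (int m) + (if 2 dvd m then 2 * chi32 (int (m div 2)) else 0))"
  proof cases
    case 1
    thus ?thesis unfolding red dvd chi32_def mod(1) using mod(2) by simp
  next
    case 2
    thus ?thesis unfolding red dvd chi32_def mod(1) by (simp add: w)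
  next
    case 3
    thus ?thesis unfolding red dvd chi32_def mod(1) using mod(3) z2 by (simp add: w)
  next
    case 4
    thus ?thesis unfolding red dvd chi32_def mod(1) using pows(1)[OF z2(1)] pows(1)[OF z2(2)] by simp
  next
    case 5
    thus ?thesis unfolding red dvd chi32_def mod(1)
      using mod(4) pows(2)[OF z2(1)] pows(2)[OF z2(2)] by (simp add: w)
  next
    case 6
    thus ?thesis unfolding red dvd chi32_def mod(1)
      using pows(3)[OF z2(1)] pows(3)[OF z2(2)] by (simp add: w)
  qed
  thus "root_of_unity 6 ^ m + inverse (root_of_unity 6) ^ m =
     (if 6 dvd m then 6 else 0) - (if 3 dvd m then 3 else 0) - (if 2 dvd m then 2 else 0) + 1"
    and "root_of_unity 6 ^ m - inverse (root_of_unity 6) ^ m =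
     \<i> * of_real (sqrt 3) * (chi32 (int m) + (if 2 dvd m then 2 * chi32 (int (m div 2)) else 0))"
    unfolding c by (simp_all only: z_def w_def)
qed

text \<open>Kept general in \<open>f\<close> for two uses: \<open>f m\<close> a power m^(-s) gives
  the special values, and m^(l-1) x^m gives the power series behind the Lambert series. The same
  holds for the odd companion below.\<close>

lemma has_sum_root_of_unity_6_even:
  assumes "(f has_sum S1) {0<..}" "((\<lambda>m. f (2 * m)) has_sum S2) {0<..}"
    and "((\<lambda>m. f (3 * m)) has_sum S3) {0<..}" "((\<lambda>m. f (6 * m)) has_sum S6) {0<..}"
  shows "((\<lambda>m. (root_of_unity 6 ^ m + inverse (root_of_unity 6) ^ m) * f m) has_sum
           (6 * S6 - 3 * S3 - 2 * S2 + S1)) {0<..}"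
proof -
  have dil: "((\<lambda>m. (if M dvd m then of_nat M else 0) * f m) has_sum (of_nat M * S)) {0<..}"
    if "M > 0" "((\<lambda>m. f (M * m)) has_sum S) {0<..}" for M S
    using has_sum_dilate[of M "\<lambda>_. of_nat M" f, OF that(1) has_sum_cmult_right[OF that(2)]] .
  have "((\<lambda>m. (if 6 dvd m then 6 else 0) * f m - (if 3 dvd m then 3 else 0) * f m
          - (if 2 dvd m then 2 else 0) * f m + f m) has_sum
           (6 * S6 - 3 * S3 - 2 * S2 + S1)) {0<..}"
    using dil[of 6 S6] dil[of 3 S3] dil[of 2 S2] assms
    by (intro has_sum_add has_sum_diff) (simp_all only: of_nat_numeral zero_less_numeral)
  thus ?thesis
    unfolding root_of_unity_6_power_sum by (simp only: algebra_simps) simp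
qed

lemma has_sum_root_of_unity_6_odd:
  assumes "((\<lambda>m. chi32 (int m) * f m) has_sum S1) {0<..}"
    and "((\<lambda>m. chi32 (int m) * f (2 * m)) has_sum S2) {0<..}"
  shows "((\<lambda>m. (root_of_unity 6 ^ m - inverse (root_of_unity 6) ^ m) * f m) has_sum
           (\<i> * of_real (sqrt 3) * (S1 + 2 * S2))) {0<..}"
proof -
  have "((\<lambda>m. 2 * chi32 (int m) * f (2 * m)) has_sum (2 * S2)) {0<..}"
    using has_sum_cmult_right[OF assms(2), of 2] by (simp add: mult_ac)
  hence "((\<lambda>m. (if 2 dvd m then 2 * chi32 (int (m div 2)) else 0) * f m) has_sum (2 * S2)) {0<..}"
    using has_sum_dilate[of 2 "\<lambda>m. 2 * chi32 (int m)" f] by simp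
  from has_sum_cmult_right[OF has_sum_add[OF assms(1) this], of "\<i> * of_real (sqrt 3)"] show ?thesis
    unfolding root_of_unity_6_power_diff mult.assoc distrib_right .
qed

lemma norm_inverse_root_of_unity_6: "norm (inverse (root_of_unity 6)) = 1"
  by (simp add: norm_inverse root_of_unity_6_props(2))

lemma inverse_root_of_unity_6_neq_1: "inverse (root_of_unity 6) \<noteq> 1"
  using root_of_unity_6_props(6) inverse_eq_1_iff by blast

lemma nat_powr_mult:
  "of_nat (M * m) powr s = of_nat M powr s * (of_nat m powr s :: complex)"
  by (simp add: powr_times_real)

lemma has_sum_nat_powr:
  assumes "Re s > 1" "\<And>m. norm (a m) \<le> 1"
  obtains S where "((\<lambda>m. a m * of_nat m powr (-s)) has_sum (S :: complex)) {0<..}"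
proof -
  have "summable (\<lambda>m. real m powr (- Re s))"
    using assms(1) by (simp add: summable_real_powr_iff)
  hence "summable (\<lambda>m. real (Suc m) powr (- Re s))"
    by (subst summable_Suc_iff)
  hence "summable (\<lambda>m. norm (a (Suc m) * of_nat (Suc m) powr (-s)))"
  proof (rule summable_comparison_test')
    fix m
    show "norm (norm (a (Suc m) * of_nat (Suc m) powr (-s))) \<le> real (Suc m) powr (- Re s)"
      using mult_right_mono[OF assms(2)[of "Suc m"], of "real (Suc m) powr (- Re s)"]
      by (simp add: norm_mult norm_powr_real_powr del: of_nat_Suc)
  qed
  hence "((\<lambda>m. a (Suc m) * of_nat (Suc m) powr (-s)) has_sum
           (\<Sum>m. a (Suc m) * of_nat (Suc m) powr (-s))) UNIV"
    by (intro norm_summable_imp_has_sum) (auto dest: summable_norm_cancel)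
  thus ?thesis
    using that has_sum_Suc_iff[of "\<lambda>m. a m * of_nat m powr (-s)"] by blast
qed

lemma norm_nat_mult_powr_less_1:
  assumes "Re s > 1" "M \<ge> 2"
  shows "norm (of_nat M * of_nat M powr (- s) :: complex) < 1"
proof -
  have "norm (of_nat M * of_nat M powr (- s) :: complex) = real M powr (1 - Re s)"
    using assms powr_add[of "real M" 1 "- Re s"] by (simp add: norm_mult norm_powr_real_powr)
  also have "\<dots> < real M powr 0"
    using assms by (intro powr_less_mono) auto
  finally show ?thesis using assms by simp
qed

lemma nat_mult_powr_nat:
  assumes "M > 0" "l \<ge> 1"
  shows "of_nat M * of_nat M powr (- (1 - of_nat l)) = (of_nat M ^ l :: complex)"
proof -
  have "- (1 - of_nat l) = (of_nat (l - 1) :: complex)" using assms by (simp add: of_nat_diff)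
  thus ?thesis using assms by (cases l) simp_all
qed

section \<open>Special values at 1 - l\<close>

text \<open>For \<open>Re s > 1\<close> the Ramanujan sum gives \<Lambda>1(s) + \<Lambda>2(s) = g(s)
  zeta(s). Factoring g as (1 - 2^(1-s)) (1 - 3^(1-s)) shows that it is nonzero on that half-plane
  and at 1 - l, where it equals (2^l - 1) (3^l - 1).\<close>

lemma riemann_zeta_at_one_minus:
  assumes "l \<ge> 1"
  shows "(6 ^ l - 3 ^ l - 2 ^ l + 1) * riemann_zeta (1 - of_nat l) =
           neg_polylog (l - 1) (root_of_unity 6) + neg_polylog (l - 1) (inverse (root_of_unity 6))"
proof -
  obtain \<Lambda>1 where \<Lambda>1: "\<Lambda>1 holomorphic_on UNIV"
    "\<forall>s. Re s > 1 \<longrightarrow> (\<lambda>m. root_of_unity 6 ^ Suc m * of_nat (Suc m) powr (- s)) sums \<Lambda>1 s"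
    "\<forall>n. \<Lambda>1 (- of_nat n) = neg_polylog n (root_of_unity 6)"
    by (rule polylog_continuation[OF root_of_unity_6_props(2,6)])
  obtain \<Lambda>2 where \<Lambda>2: "\<Lambda>2 holomorphic_on UNIV"
    "\<forall>s. Re s > 1 \<longrightarrow> (\<lambda>m. inverse (root_of_unity 6) ^ Suc m * of_nat (Suc m) powr (- s)) sums \<Lambda>2 s"
    "\<forall>n. \<Lambda>2 (- of_nat n) = neg_polylog n (inverse (root_of_unity 6))"
    by (rule polylog_continuation[OF norm_inverse_root_of_unity_6 inverse_root_of_unity_6_neq_1])
  define p where "p M s = (of_nat M * of_nat M powr (- s) :: complex)" for M s
  define g where "g s = p 6 s - p 3 s - p 2 s + 1" for s
  have g_factor: "g s = (1 - p 2 s) * (1 - p 3 s)" for s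
    using nat_powr_mult[of 2 3 "-s"] by (simp add: g_def p_def algebra_simps)
  have g_l_nz: "g (1 - of_nat l) \<noteq> 0"
  proof -
    have "(2 :: nat) ^ l \<noteq> 1" "(3 :: nat) ^ l \<noteq> 1" using assms by auto
    hence "(of_nat (2 ^ l) :: complex) \<noteq> of_nat 1" "(of_nat (3 ^ l) :: complex) \<noteq> of_nat 1"
      unfolding of_nat_eq_iff .
    hence "(2 ^ l :: complex) \<noteq> 1" "(3 ^ l :: complex) \<noteq> 1" by simp_all
    thus ?thesis unfolding g_factor p_def by (subst (1 2) nat_mult_powr_nat) (use assms in auto)
  qed
  have "dirichlet_L (\<lambda>_. 1) (1 - of_nat l) = (\<Lambda>1 (1 - of_nat l) + \<Lambda>2 (1 - of_nat l)) / g (1 - of_nat l)"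
  proof (rule dirichlet_L_eq_quotient)
    show "(\<lambda>s. \<Lambda>1 s + \<Lambda>2 s) holomorphic_on UNIV" by (intro holomorphic_intros \<Lambda>1 \<Lambda>2)
    show "g holomorphic_on UNIV" unfolding g_def p_def by (intro holomorphic_intros)
    show "g (1 - of_nat l) \<noteq> 0" by (rule g_l_nz)
    fix s :: complex assume s: "Re s > 1"
    have "norm (p 2 s) < 1" "norm (p 3 s) < 1"
      unfolding p_def by (rule norm_nat_mult_powr_less_1[OF s], simp)+
    hence "p 2 s \<noteq> 1" "p 3 s \<noteq> 1" by auto
    thus g0: "g s \<noteq> 0" by (simp add: g_factor)
    let ?f = "\<lambda>m. of_nat m powr (-s) :: complex"
    obtain Z where Z: "(?f has_sum Z) {0<..}"
      using has_sum_nat_powr[OF s, of "\<lambda>_. 1"] by auto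
    have ZM: "((\<lambda>m. ?f (M * m)) has_sum (of_nat M powr (-s) * Z)) {0<..}" for M
      unfolding nat_powr_mult by (intro has_sum_cmult_right Z)
    have "((\<lambda>m. (root_of_unity 6 ^ m + inverse (root_of_unity 6) ^ m) * ?f m) has_sum (g s * Z)) {0<..}"
      using has_sum_root_of_unity_6_even[OF Z ZM ZM ZM] by (simp add: g_def p_def algebra_simps)
    hence "(\<lambda>m. (root_of_unity 6 ^ Suc m + inverse (root_of_unity 6) ^ Suc m) * ?f (Suc m)) sums
        (g s * Z)"
      by (subst (asm) has_sum_Suc_iff[symmetric]) (rule has_sum_imp_sums)
    moreover have "(\<lambda>m. (root_of_unity 6 ^ Suc m + inverse (root_of_unity 6) ^ Suc m) * ?f (Suc m))
        sums (\<Lambda>1 s + \<Lambda>2 s)"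
      unfolding distrib_right by (intro sums_add \<Lambda>1(2)[rule_format] \<Lambda>2(2)[rule_format] s)
    ultimately have "\<Lambda>1 s + \<Lambda>2 s = g s * Z" by (rule sums_unique2[symmetric])
    moreover have "(\<lambda>m. ?f (Suc m)) sums Z"
      using Z by (subst (asm) has_sum_Suc_iff[symmetric]) (rule has_sum_imp_sums)
    ultimately show "(\<lambda>n. 1 / of_nat (Suc n) powr s) sums ((\<Lambda>1 s + \<Lambda>2 s) / g s)"
      using g0 by (simp add: powr_minus inverse_eq_divide)
  qed
  moreover have "g (1 - of_nat l) = 6 ^ l - 3 ^ l - 2 ^ l + 1"
    unfolding g_def p_def by (subst (1 2 3) nat_mult_powr_nat) (use assms in auto)
  moreover have "1 - of_nat l = (- of_nat (l - 1) :: complex)" using assms by (simp add: of_nat_diff)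
  ultimately show ?thesis
    using g_l_nz unfolding riemann_zeta_def by (simp add: \<Lambda>1(3) \<Lambda>2(3))
qed

text \<open>Same argument with the difference of the two entire functions and g(s) = i sqrt(3) (1 +
  2^(1-s)). It is nonzero for \<open>Re s > 1\<close> because |2^(1-s)| < 1 there, and at 1 - l
  because 2^l + 1 > 0.\<close>

lemma dirichlet_L_chi32_at_one_minus:
  assumes "l \<ge> 1"
  shows "\<i> * of_real (sqrt 3) * (2 ^ l + 1) * dirichlet_L chi32 (1 - of_nat l) =
           neg_polylog (l - 1) (root_of_unity 6) - neg_polylog (l - 1) (inverse (root_of_unity 6))"
proof -
  obtain \<Lambda>1 where \<Lambda>1: "\<Lambda>1 holomorphic_on UNIV"
    "\<forall>s. Re s > 1 \<longrightarrow> (\<lambda>m. root_of_unity 6 ^ Suc m * of_nat (Suc m) powr (- s)) sums \<Lambda>1 s"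
    "\<forall>n. \<Lambda>1 (- of_nat n) = neg_polylog n (root_of_unity 6)"
    by (rule polylog_continuation[OF root_of_unity_6_props(2,6)])
  obtain \<Lambda>2 where \<Lambda>2: "\<Lambda>2 holomorphic_on UNIV"
    "\<forall>s. Re s > 1 \<longrightarrow> (\<lambda>m. inverse (root_of_unity 6) ^ Suc m * of_nat (Suc m) powr (- s)) sums \<Lambda>2 s"
    "\<forall>n. \<Lambda>2 (- of_nat n) = neg_polylog n (inverse (root_of_unity 6))"
    by (rule polylog_continuation[OF norm_inverse_root_of_unity_6 inverse_root_of_unity_6_neq_1])
  define g where "g s = \<i> * of_real (sqrt 3) * (1 + of_nat 2 * of_nat 2 powr (- s))" for s :: complex
  have g_l: "g (1 - of_nat l) = \<i> * of_real (sqrt 3) * (2 ^ l + 1)"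
    unfolding g_def by (subst nat_mult_powr_nat) (use assms in auto)
  have g_l_nz: "g (1 - of_nat l) \<noteq> 0"
  proof -
    have "(of_nat (2 ^ l + 1) :: complex) \<noteq> of_nat 0"
      unfolding of_nat_eq_iff by simp
    thus ?thesis unfolding g_l by (simp add: add.commute)
  qed
  have "dirichlet_L chi32 (1 - of_nat l) = (\<Lambda>1 (1 - of_nat l) - \<Lambda>2 (1 - of_nat l)) / g (1 - of_nat l)"
  proof (rule dirichlet_L_eq_quotient)
    show "(\<lambda>s. \<Lambda>1 s - \<Lambda>2 s) holomorphic_on UNIV" by (intro holomorphic_intros \<Lambda>1 \<Lambda>2)
    show "g holomorphic_on UNIV" unfolding g_def by (intro holomorphic_intros)
    show "g (1 - of_nat l) \<noteq> 0" by (rule g_l_nz)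
    fix s :: complex assume s: "Re s > 1"
    have "1 + of_nat 2 * of_nat 2 powr (- s) \<noteq> (0 :: complex)"
    proof
      assume "1 + of_nat 2 * of_nat 2 powr (- s) = (0 :: complex)"
      hence "of_nat 2 * of_nat 2 powr (- s) = (-1 :: complex)" by (simp add: add_eq_0_iff)
      thus False using norm_nat_mult_powr_less_1[OF s, of 2] by simp
    qed
    thus g0: "g s \<noteq> 0" by (simp add: g_def)
    let ?f = "\<lambda>m. of_nat m powr (-s) :: complex"
    obtain Z where Z: "((\<lambda>m. chi32 (int m) * ?f m) has_sum Z) {0<..}"
      using has_sum_nat_powr[OF s, of "\<lambda>m. chi32 (int m)", OF norm_chi32_le_1] by blast
    have Z2: "((\<lambda>m. chi32 (int m) * ?f (2 * m)) has_sum (of_nat 2 powr (-s) * Z)) {0<..}"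
      using has_sum_cmult_right[OF Z, of "of_nat 2 powr (-s)"] unfolding nat_powr_mult by (simp
          only: mult_ac)
    have "((\<lambda>m. (root_of_unity 6 ^ m - inverse (root_of_unity 6) ^ m) * ?f m) has_sum (g s * Z)) {0<..}"
      using has_sum_root_of_unity_6_odd[OF Z Z2] by (simp add: g_def algebra_simps)
    hence "(\<lambda>m. (root_of_unity 6 ^ Suc m - inverse (root_of_unity 6) ^ Suc m) * ?f (Suc m)) sums
        (g s * Z)"
      by (subst (asm) has_sum_Suc_iff[symmetric]) (rule has_sum_imp_sums)
    moreover have "(\<lambda>m. (root_of_unity 6 ^ Suc m - inverse (root_of_unity 6) ^ Suc m) * ?f (Suc m))
        sums (\<Lambda>1 s - \<Lambda>2 s)"
      unfolding left_diff_distrib by (intro sums_diff \<Lambda>1(2)[rule_format] \<Lambda>2(2)[rule_format] s)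
    ultimately have "\<Lambda>1 s - \<Lambda>2 s = g s * Z" by (rule sums_unique2[symmetric])
    moreover have "(\<lambda>m. chi32 (int (Suc m)) * ?f (Suc m)) sums Z"
      using Z by (subst (asm) has_sum_Suc_iff[symmetric]) (rule has_sum_imp_sums)
    ultimately have "(\<lambda>m. chi32 (int (Suc m)) * ?f (Suc m)) sums ((\<Lambda>1 s - \<Lambda>2 s) / g s)"
      using g0 by (simp del: of_nat_Suc)
    thus "(\<lambda>n. chi32 (int (Suc n)) / of_nat (Suc n) powr s) sums ((\<Lambda>1 s - \<Lambda>2 s) / g s)"
      by (simp only: powr_minus divide_inverse)
  qed
  moreover have "1 - of_nat l = (- of_nat (l - 1) :: complex)" using assms by (simp add: of_nat_diff)
  ultimately show ?thesis
    using g_l g_l_nz by (simp add: \<Lambda>1(3) \<Lambda>2(3))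
qed

section \<open>Lambert series and their Eisenstein series\<close>

lemma summable_neg_polylog_powers:
  fixes c y :: complex
  assumes "norm y < 1"
  shows "summable (\<lambda>j. norm (neg_polylog n (c * y ^ Suc j)))"
proof -
  obtain C where C: "C > 0" "\<And>y. norm y \<le> 1 / 2 \<Longrightarrow> norm (neg_polylog n y) \<le> C * norm y"
    by (rule neg_polylog_bound[of n]) blast
  have "(\<lambda>j. c * y ^ Suc j) \<longlonglongrightarrow> c * 0"
    by (intro tendsto_mult tendsto_const LIMSEQ_Suc LIMSEQ_power_zero assms)
  hence "eventually (\<lambda>j. norm (c * y ^ Suc j) < 1 / 2) sequentially"
    using order_tendstoD(2)[OF tendsto_norm, of _ _ _ "1 / 2"] by fastforce
  hence "eventually (\<lambda>j. norm (norm (neg_polylog n (c * y ^ Suc j))) \<le>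
      C * (norm c * norm y ^ Suc j)) sequentially"
  proof eventually_elim
    case (elim j)
    thus ?case using C(2)[of "c * y ^ Suc j"] by (simp add: norm_mult norm_power)
  qed
  moreover have "summable (\<lambda>j. C * (norm c * norm y ^ Suc j))"
    using assms by (intro summable_mult) (auto simp: summable_Suc_iff summable_geometric)
  ultimately show ?thesis by (rule summable_comparison_test_ev)
qed

text \<open>Double series over (j, m), summed once along rows and once along the hyperbolas j m =
  N.\<close>

lemma lambert_series:
  fixes y :: complex
  assumes y: "norm y < 1" and a: "\<And>m. norm (a m) \<le> 1"
    and S: "\<And>x. norm x < 1 \<Longrightarrow> ((\<lambda>m. a m * of_nat m ^ n * x ^ m) has_sum S x) {0<..}"
  shows "((\<lambda>j. S (y ^ j)) has_sum (\<Sum>N. (\<Sum>d | d dvd Suc N. a d * of_nat (d ^ n)) * y ^ Suc N)) {0<..}"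
proof -
  define F where "F = (\<lambda>(j, m). a m * of_nat m ^ n * (y ^ j) ^ m)"
  \<comment> \<open>Majorant: the case a = 1 at the real point \<open>norm y\<close>, whose row sums
    are polylogarithms. Its terms are nonnegative reals written as complex numbers, so a row sum of
    norms is the norm of the row sum.\<close>
  define F0 where "F0 = (\<lambda>(j, m). of_nat m ^ n * of_real (norm y ^ j) ^ m :: complex)"
  have yj: "norm (y ^ j) < 1" if "j > 0" for j
    using y that by (simp add: norm_power power_Suc_less_one power_less_one_iff)
  have F0: "((\<lambda>m. F0 (j, m)) has_sum neg_polylog n (of_real (norm y ^ j))) {0<..}" if "j > 0" for j
    unfolding F0_def using yj[OF that] by (auto intro!: neg_polylog_has_sum simp: norm_power)
  have norm_F0: "((\<lambda>m. norm (F0 (j, m))) has_sum norm (neg_polylog n (of_real (norm y ^ j)))) {0<..}"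
    if "j > 0" for j
  proof -
    have *: "F0 (j, m) = of_real (norm (F0 (j, m)))" for m
      by (simp add: F0_def norm_mult norm_power)
    have re: "((\<lambda>m. norm (F0 (j, m))) has_sum Re (neg_polylog n (of_real (norm y ^ j)))) {0<..}"
      using has_sum_Re[OF F0[OF that]] by (subst (asm) *) simp
    have "((\<lambda>m. F0 (j, m)) has_sum of_real (Re (neg_polylog n (of_real (norm y ^ j))))) {0<..}"
      using has_sum_of_real[OF re] by (subst *)
    with F0[OF that] have "neg_polylog n (of_real (norm y ^ j)) =
        of_real (Re (neg_polylog n (of_real (norm y ^ j))))"
      by (rule has_sum_unique)
    moreover have "Re (neg_polylog n (of_real (norm y ^ j))) \<ge> 0"
      using re by (rule has_sum_nonneg) auto
    ultimately have "norm (neg_polylog n (of_real (norm y ^ j))) =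
        Re (neg_polylog n (of_real (norm y ^ j)))"
      by (metis abs_of_nonneg norm_of_real)
    with re show ?thesis by simp
  qed
  have "(\<lambda>x. norm (F0 x)) summable_on {0<..} \<times> {0<..}"
    unfolding Infinite_Sum.abs_summable_on_Sigma_iff
  proof (intro conjI ballI)
    show "(\<lambda>m. norm (F0 (j, m))) summable_on {0<..}" if "j \<in> {0<..}" for j
      using norm_F0[of j] that by (auto simp: summable_on_def)
    have "summable (\<lambda>j. norm (neg_polylog n (of_real (norm y ^ Suc j))))"
      using summable_neg_polylog_powers[of "of_real (norm y)" n 1] y by simp
    hence "((\<lambda>j. norm (neg_polylog n (of_real (norm y ^ Suc j)))) has_sum
              (\<Sum>j. norm (neg_polylog n (of_real (norm y ^ Suc j))))) UNIV"
      by (intro norm_summable_imp_has_sum) auto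
    hence "(\<lambda>j. norm (neg_polylog n (of_real (norm y ^ j)))) summable_on {0<..}"
      unfolding has_sum_Suc_iff[of "\<lambda>j. norm (neg_polylog n (of_real (norm y ^ j)))"]
      by (auto simp: summable_on_def)
    also have "?this \<longleftrightarrow> (\<lambda>j. norm (\<Sum>\<^sub>\<infinity>m\<in>{0<..}. norm (F0 (j, m)))) summable_on {0<..}"
      by (intro summable_on_cong) (simp add: infsumI[OF norm_F0])
    finally show "(\<lambda>j. norm (\<Sum>\<^sub>\<infinity>m\<in>{0<..}. norm (F0 (j, m)))) summable_on {0<..}" .
  qed
  hence "(\<lambda>x. norm (F x)) summable_on {0<..} \<times> {0<..}"
  proof (rule Infinite_Sum.abs_summable_on_comparison_test)
    fix x assume "x \<in> ({0<..} \<times> {0<..} :: (nat \<times> nat) set)"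
    show "norm (F x) \<le> norm (F0 x)"
    proof (cases x)
      case (Pair j m)
      have "norm (a m) * (norm (of_nat m ^ n * (y ^ j) ^ m)) \<le> 1 * norm (of_nat m ^ n * (y ^ j) ^ m)"
        by (intro mult_right_mono a) auto
      thus ?thesis unfolding Pair F_def F0_def by (simp add: norm_mult norm_power mult.assoc)
    qed
  qed
  hence "F summable_on {0<..} \<times> {0<..}" by (rule abs_summable_summable)
  then obtain X where X: "(F has_sum X) ({0<..} \<times> {0<..})" by (auto simp: summable_on_def)
  have 1: "((\<lambda>j. S (y ^ j)) has_sum X) {0<..}"
    using X by (rule has_sum_SigmaD) (use S yj in \<open>auto simp: F_def\<close>)
  define H where "H = (\<lambda>(N, d). a d * of_nat (d ^ n) * y ^ N)"
  \<comment> \<open>The pair (j, m) becomes (N, d) = (j m, m): a number with one of its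
    divisors.\<close>
  have "(F has_sum X) ({0<..} \<times> {0<..}) \<longleftrightarrow> (H has_sum X) (Sigma {0<..} (\<lambda>N. {d. d dvd N}))"
    by (rule has_sum_reindex_bij_witness[where i = "\<lambda>(N, d). (N div d, d)" and j = "\<lambda>(j, m). (j * m,
        m)"])
       (auto simp: F_def H_def power_mult dvd_imp_le elim!: dvdE)
  with X have "(H has_sum X) (Sigma {0<..} (\<lambda>N. {d. d dvd N}))" by simp
  hence "((\<lambda>N. \<Sum>d | d dvd N. H (N, d)) has_sum X) {0<..}"
    by (rule has_sum_SigmaD) (auto intro!: has_sum_finite)
  hence "(\<lambda>N. \<Sum>d | d dvd Suc N. H (Suc N, d)) sums X"
    by (subst (asm) has_sum_Suc_iff[symmetric]) (rule has_sum_imp_sums)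
  hence "(\<Sum>N. (\<Sum>d | d dvd Suc N. a d * of_nat (d ^ n)) * y ^ Suc N) = X"
    by (simp add: H_def sum_distrib_right sums_iff)
  with 1 show ?thesis by simp
qed

lemma norm_nome_less_1: "\<tau> \<in> upper_half_plane \<Longrightarrow> norm (nome \<tau>) < 1"
  by (simp add: nome_def upper_half_plane_def)

lemma nome_mult: "nome (of_nat M * \<tau>) = nome \<tau> ^ M"
  unfolding nome_def by (subst exp_of_nat_mult[symmetric]) (simp add: mult_ac)

lemma eisenstein_G_has_sum:
  assumes "\<tau> \<in> upper_half_plane" "M > 0"
  shows "((\<lambda>j. neg_polylog (l - 1) ((nome \<tau> ^ M) ^ j)) has_sum
           (eisenstein_G l (of_nat M * \<tau>) - riemann_zeta (1 - of_nat l) / 2)) {0<..}"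
proof -
  have "norm (nome \<tau> ^ M) < 1"
    using norm_nome_less_1[OF assms(1)] assms(2) by (simp add: norm_power power_less_one_iff)
  from lambert_series[OF this, of "\<lambda>_. 1" "l - 1" "neg_polylog (l - 1)"] show ?thesis
    by (simp add: eisenstein_G_def nome_mult neg_polylog_has_sum)
qed

lemma chi32_power_series:
  obtains S where "\<And>x. norm x < 1 \<Longrightarrow> ((\<lambda>m. chi32 (int m) * of_nat m ^ n * x ^ m) has_sum S x) {0<..}"
proof -
  have "(\<lambda>m. chi32 (int m) * of_nat m ^ n * x ^ m) summable_on {0<..}" if "norm x < 1" for x
  proof -
    have "(\<lambda>m. norm (of_nat m ^ n * x ^ m)) summable_on {0<..}"
      using neg_polylog_has_sum[OF that, of n]
      unfolding summable_on_iff_abs_summable_on_complex[symmetric] by (auto simp: summable_on_def)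
    hence "(\<lambda>m. norm (chi32 (int m) * of_nat m ^ n * x ^ m)) summable_on {0<..}"
      by (rule Infinite_Sum.abs_summable_on_comparison_test) (auto simp: chi32_def norm_mult)
    thus ?thesis by (rule abs_summable_summable)
  qed
  hence "\<exists>S. norm x < 1 \<longrightarrow> ((\<lambda>m. chi32 (int m) * of_nat m ^ n * x ^ m) has_sum S) {0<..}" for x
    by (auto simp: summable_on_def)
  with that show ?thesis by metis
qed

lemma sums_even_eisenstein:
  assumes \<tau>: "\<tau> \<in> upper_half_plane" and l: "l \<ge> 1"
  shows "(\<lambda>n. neg_polylog (l - 1) (root_of_unity 6 * nome \<tau> ^ Suc n) +
              neg_polylog (l - 1) (inverse (root_of_unity 6) * nome \<tau> ^ Suc n)) sums
          (6 ^ l * eisenstein_G l (6 * \<tau>) - 3 ^ l * eisenstein_G l (3 * \<tau>)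
            - 2 ^ l * eisenstein_G l (2 * \<tau>) + eisenstein_G l \<tau>
            - (neg_polylog (l - 1) (root_of_unity 6) + neg_polylog (l -
                1) (inverse (root_of_unity 6))) / 2)"
proof -
  define q where "q = nome \<tau>"
  define P where "P = neg_polylog (l - 1)"
  let ?z = "root_of_unity 6" and ?w = "inverse (root_of_unity 6)"
  have q: "norm q < 1" using \<tau> by (simp add: q_def norm_nome_less_1)
  \<comment> \<open>The factor M^l of the theorem: M is the weight in the Ramanujan sum, M^(l-1)
    comes from (M m)^(l-1).\<close>
  have M: "of_nat M * of_nat M ^ (l - 1) = (of_nat M ^ l :: complex)" for M :: nat
    using l by (cases l) simp_all
  have P_eq: "P (?z * x) + P (?w * x) = 6 ^ l * P (x ^ 6) - 3 ^ l * P (x ^ 3) - 2 ^ l * P (x ^ 2) + P x"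
    if x: "norm x < 1" for x
  proof -
    let ?f = "\<lambda>m. of_nat m ^ (l - 1) * x ^ m"
    have dil: "((\<lambda>m. ?f (M * m)) has_sum (of_nat M ^ (l - 1) * P (x ^ M))) {0<..}" if "M > 0" for M
    proof -
      have "norm (x ^ M) < 1" using x that by (simp add: norm_power power_less_one_iff)
      from has_sum_cmult_right[OF neg_polylog_has_sum[OF this, of "l - 1"], of "of_nat M ^ (l - 1)"]
      show ?thesis unfolding P_def power_mult of_nat_mult power_mult_distrib by (simp only: mult_ac)
    qed
    have "(?f has_sum P x) {0<..}" using neg_polylog_has_sum[OF x] by (simp add: P_def)
    from has_sum_root_of_unity_6_even[OF this dil dil dil]
    have "((\<lambda>m. (?z ^ m + ?w ^ m) * ?f m) has_sum
        (6 ^ l * P (x ^ 6) - 3 ^ l * P (x ^ 3) - 2 ^ l * P (x ^ 2) + P x)) {0<..}"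
      using M[of 6] M[of 3] M[of 2] by (simp add: mult.assoc[symmetric])
    moreover have "((\<lambda>m. of_nat m ^ (l - 1) * (?z * x) ^ m + of_nat m ^ (l - 1) * (?w * x) ^ m)
        has_sum (P (?z * x) + P (?w * x))) {0<..}"
      unfolding P_def
      by (intro has_sum_add neg_polylog_has_sum) (use x in \<open>auto simp: norm_mult norm_inverse
          root_of_unity_6_props(2)\<close>)
    hence "((\<lambda>m. (?z ^ m + ?w ^ m) * ?f m) has_sum (P (?z * x) + P (?w * x))) {0<..}"
      by (simp add: power_mult_distrib algebra_simps)
    ultimately show ?thesis using has_sum_unique by blast
  qed
  define c where "c = riemann_zeta (1 - of_nat l) / 2"
  have G: "((\<lambda>j. P ((q ^ j) ^ M)) has_sum (eisenstein_G l (of_nat M * \<tau>) - c)) {0<..}" if "M > 0" for M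
    using eisenstein_G_has_sum[OF \<tau> that, of l] by (simp add: c_def P_def q_def mult.commute flip:
        power_mult)
  have "((\<lambda>j. 6 ^ l * P ((q ^ j) ^ 6) - 3 ^ l * P ((q ^ j) ^ 3) - 2 ^ l * P ((q ^ j) ^ 2) +
      P ((q ^ j) ^ 1)) has_sum
          (6 ^ l * (eisenstein_G l (of_nat 6 * \<tau>) - c) - 3 ^ l * (eisenstein_G l (of_nat 3 * \<tau>) - c)
            - 2 ^ l * (eisenstein_G l (of_nat 2 * \<tau>) - c) + (eisenstein_G l (of_nat 1 * \<tau>) - c))) {0<..}"
    by (intro has_sum_add has_sum_diff has_sum_cmult_right G) auto
  also have "?this \<longleftrightarrow> ((\<lambda>j. P (?z * q ^ j) + P (?w * q ^ j)) has_sum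
          (6 ^ l * (eisenstein_G l (of_nat 6 * \<tau>) - c) - 3 ^ l * (eisenstein_G l (of_nat 3 * \<tau>) - c)
            - 2 ^ l * (eisenstein_G l (of_nat 2 * \<tau>) - c) + (eisenstein_G l (of_nat 1 * \<tau>) - c))) {0<..}"
  proof (rule has_sum_cong)
    fix j :: nat assume "j \<in> {0<..}"
    hence "norm (q ^ j) < 1" using q by (simp add: norm_power power_less_one_iff)
    from P_eq[OF this] show "6 ^ l * P ((q ^ j) ^ 6) - 3 ^ l * P ((q ^ j) ^ 3) -
        2 ^ l * P ((q ^ j) ^ 2) + P ((q ^ j) ^ 1)
        = P (?z * q ^ j) + P (?w * q ^ j)" by simp
  qed
  also have "6 ^ l * (eisenstein_G l (of_nat 6 * \<tau>) - c) - 3 ^ l * (eisenstein_G l (of_nat 3 * \<tau>) - c)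
            - 2 ^ l * (eisenstein_G l (of_nat 2 * \<tau>) - c) + (eisenstein_G l (of_nat 1 * \<tau>) - c) =
      6 ^ l * eisenstein_G l (6 * \<tau>) - 3 ^ l * eisenstein_G l (3 * \<tau>)
            - 2 ^ l * eisenstein_G l (2 * \<tau>) + eisenstein_G l \<tau> - (6 ^ l - 3 ^ l - 2 ^ l + 1) * c"
    by (simp add: algebra_simps)
  \<comment> \<open>The four constant terms together are half the value of the summand at x = 1;
    this is the source of -Q(1)/2.\<close>
  also have "(6 ^ l - 3 ^ l - 2 ^ l + 1) * c = (P ?z + P ?w) / 2"
    using riemann_zeta_at_one_minus[OF l] by (simp add: c_def P_def)
  finally show ?thesis
    by (subst (asm) has_sum_Suc_iff[symmetric]) (auto simp: P_def q_def dest: has_sum_imp_sums)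
qed

text \<open>Parallel to the sum case, with the power series S of chi(m) m^(l-1) in place of the
  polylogarithm. No closed form of S is used, only its expansion.\<close>

lemma sums_odd_eisenstein:
  assumes \<tau>: "\<tau> \<in> upper_half_plane" and l: "l \<ge> 1"
  shows "(\<lambda>n. neg_polylog (l - 1) (root_of_unity 6 * nome \<tau> ^ Suc n) -
              neg_polylog (l - 1) (inverse (root_of_unity 6) * nome \<tau> ^ Suc n)) sums
          (\<i> * of_real (sqrt 3) * (2 ^ l * eisenstein_G_char l chi32 (2 * \<tau>) +
              eisenstein_G_char l chi32 \<tau>)
            - (neg_polylog (l - 1) (root_of_unity 6) - neg_polylog (l -
                1) (inverse (root_of_unity 6))) / 2)"
proof -
  define q where "q = nome \<tau>"
  define P where "P = neg_polylog (l - 1)"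
  let ?z = "root_of_unity 6" and ?w = "inverse (root_of_unity 6)" and ?c = "\<i> * complex_of_real (sqrt 3)"
  have q: "norm q < 1" using \<tau> by (simp add: q_def norm_nome_less_1)
  obtain S where S: "\<And>x. norm x < 1 \<Longrightarrow> ((\<lambda>m. chi32 (int m) * of_nat m ^ (l - 1) * x ^ m) has_sum
      S x) {0<..}"
    by (rule chi32_power_series[of "l - 1"]) blast
  have P_eq: "P (?z * x) - P (?w * x) = ?c * (2 ^ l * S (x ^ 2) + S x)"
    if x: "norm x < 1" for x
  proof -
    let ?f = "\<lambda>m. of_nat m ^ (l - 1) * x ^ m"
    have 1: "((\<lambda>m. chi32 (int m) * ?f m) has_sum S x) {0<..}"
      using S[OF x] by (simp add: mult_ac)
    have "norm (x ^ 2) < 1" using x by (simp add: norm_power power_less_one_iff)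
    from has_sum_cmult_right[OF S[OF this], of "2 ^ (l - 1)"]
    have "((\<lambda>m. chi32 (int m) * ?f (2 * m)) has_sum (2 ^ (l - 1) * S (x ^ 2))) {0<..}"
      unfolding of_nat_mult of_nat_numeral power_mult power_mult_distrib by (simp only: mult_ac)
    from has_sum_root_of_unity_6_odd[OF 1 this]
    have "((\<lambda>m. (?z ^ m - ?w ^ m) * ?f m) has_sum (?c * (S x + 2 * 2 ^ (l - 1) * S (x ^ 2)))) {0<..}"
      by (simp add: mult.assoc)
    also have "?c * (S x + 2 * 2 ^ (l - 1) * S (x ^ 2)) = ?c * (2 ^ l * S (x ^ 2) + S x)"
      using l by (cases l) (simp_all add: add.commute)
    finally have "((\<lambda>m. (?z ^ m - ?w ^ m) * ?f m) has_sum (?c * (2 ^ l * S (x ^ 2) + S x))) {0<..}" .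
    moreover have "((\<lambda>m. of_nat m ^ (l - 1) * (?z * x) ^ m - of_nat m ^ (l - 1) * (?w * x) ^ m)
        has_sum (P (?z * x) - P (?w * x))) {0<..}"
      unfolding P_def
      by (intro has_sum_diff neg_polylog_has_sum) (use x in \<open>auto simp: norm_mult norm_inverse
          root_of_unity_6_props(2)\<close>)
    hence "((\<lambda>m. (?z ^ m - ?w ^ m) * ?f m) has_sum (P (?z * x) - P (?w * x))) {0<..}"
      by (simp add: power_mult_distrib algebra_simps)
    ultimately show ?thesis using has_sum_unique by blast
  qed
  define c where "c = dirichlet_L chi32 (1 - of_nat l) / 2"
  have G: "((\<lambda>j. S ((q ^ j) ^ M)) has_sum (eisenstein_G_char l chi32 (of_nat M * \<tau>) - c)) {0<..}"
      if "M > 0" for M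
  proof -
    have "norm (q ^ M) < 1" using q that by (simp add: norm_power power_less_one_iff)
    from lambert_series[OF this norm_chi32_le_1 S]
    have "((\<lambda>j. S ((q ^ M) ^ j)) has_sum
      (\<Sum>N. (\<Sum>d | d dvd Suc N. chi32 (int d) * of_nat (d ^ (l - 1))) * (q ^ M) ^ Suc N)) {0<..}"
      by blast
    also have "(\<Sum>N. (\<Sum>d | d dvd Suc N. chi32 (int d) * of_nat (d ^ (l - 1))) * (q ^ M) ^ Suc N) =
               eisenstein_G_char l chi32 (of_nat M * \<tau>) - c"
      by (simp add: eisenstein_G_char_def c_def nome_mult q_def)
    finally show ?thesis by (simp only: mult.commute flip: power_mult)
  qed
  have "((\<lambda>j. ?c * (2 ^ l * S ((q ^ j) ^ 2) + S ((q ^ j) ^ 1))) has_sum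
          (?c * (2 ^ l * (eisenstein_G_char l chi32 (of_nat 2 * \<tau>) - c) +
              (eisenstein_G_char l chi32 (of_nat 1 * \<tau>) - c)))) {0<..}"
    by (intro has_sum_add has_sum_cmult_right G) auto
  also have "?this \<longleftrightarrow> ((\<lambda>j. P (?z * q ^ j) - P (?w * q ^ j)) has_sum
          (?c * (2 ^ l * (eisenstein_G_char l chi32 (of_nat 2 * \<tau>) - c) +
              (eisenstein_G_char l chi32 (of_nat 1 * \<tau>) - c)))) {0<..}"
  proof (rule has_sum_cong)
    fix j :: nat assume "j \<in> {0<..}"
    hence "norm (q ^ j) < 1" using q by (simp add: norm_power power_less_one_iff)
    from P_eq[OF this] show "?c * (2 ^ l * S ((q ^ j) ^ 2) + S ((q ^ j) ^ 1)) = P (?z * q ^ j) -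
        P (?w * q ^ j)" by simp
  qed
  also have "?c * (2 ^ l * (eisenstein_G_char l chi32 (of_nat 2 * \<tau>) - c) +
      (eisenstein_G_char l chi32 (of_nat 1 * \<tau>) - c)) =
      ?c * (2 ^ l * eisenstein_G_char l chi32 (2 * \<tau>) + eisenstein_G_char l chi32 \<tau>) -
          ?c * (2 ^ l + 1) * c"
    by (simp add: algebra_simps)
  also have "?c * (2 ^ l + 1) * c = (P ?z - P ?w) / 2"
    using dirichlet_L_chi32_at_one_minus[OF l] by (simp add: c_def P_def)
  finally show ?thesis
    by (subst (asm) has_sum_Suc_iff[symmetric]) (auto simp: P_def q_def dest: has_sum_imp_sums)
qed


section \<open>The logarithmic derivative of the theta function\<close>

lemma nome_add: "nome (x + y) = nome x * nome y"
  by (simp add: nome_def ring_distribs exp_add)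

lemma nome_nonzero [simp]: "nome z \<noteq> 0"
  by (simp add: nome_def)

lemma nome_uminus: "nome (-z) = inverse (nome z)"
  by (simp add: nome_def exp_minus)

lemma nome_of_int [simp]: "nome (of_int n) = 1"
  unfolding nome_def using exp_integer_2pi[of "of_int n"] by (simp add: mult_ac)

lemma nome_eq_1_iff: "nome z = 1 \<longleftrightarrow> z \<in> \<int>"
proof
  assume "nome z = 1"
  then obtain n :: int where "- 2 * pi * Im z = 0" "2 * pi * Re z = of_int (2 * n) * pi"
    unfolding nome_def exp_eq_1 by auto
  hence "z = of_int n" by (simp add: complex_eq_iff)
  thus "z \<in> \<int>" by simp
qed (auto elim!: Ints_cases)

lemma norm_nome: "norm (nome z) = exp (- 2 * pi * Im z)"
  by (simp add: nome_def)

lemma has_field_derivative_nome: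
  "(f has_field_derivative f') (at s) \<Longrightarrow>
     ((\<lambda>s. nome (f s)) has_field_derivative 2 * of_real pi * \<i> * f' * nome (f s)) (at s)"
  unfolding nome_def by (auto intro!: derivative_eq_intros)

definition lattice :: "complex \<Rightarrow> complex set" where
  "lattice \<tau> = {of_int m * \<tau> + of_int n | m n. True}"

definition nome_series :: "nat \<Rightarrow> complex \<Rightarrow> complex \<Rightarrow> complex" where
  "nome_series l z \<tau> = (\<Sum>j. neg_polylog l (nome (z + of_nat (Suc j) * \<tau>)))"

text \<open>For \<open>l = 0\<close> this is \<open>-1 / (2\<pi>i)\<close> times the logarithmic derivative in \<open>z\<close> of the theta function
  \<open>(w\<^bsup>1/2\<^esup> - w\<^bsup>-1/2\<^esup>) \<Prod> (1 - w q\<^sup>n) (1 - w\<^sup>-\<^sup>1 q\<^sup>n)\<close>, where \<open>w = nome z\<close> and \<open>q = nome \<tau>\<close>; raising \<open>l\<close> by 1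
  applies \<open>w d/dw\<close>.\<close>

definition kronecker_eis :: "nat \<Rightarrow> complex \<Rightarrow> complex \<Rightarrow> complex" where
  "kronecker_eis l z \<tau> = neg_polylog l (nome z) + (if l = 0 then 1 / 2 else 0) +
     nome_series l z \<tau> - (-1) ^ l * nome_series l (-z) \<tau>"

lemma summable_nome_series:
  assumes "Im \<tau> > 0"
  shows "summable (\<lambda>j. norm (neg_polylog l (nome (z + of_nat (Suc j) * \<tau>))))"
proof -
  have "norm (nome \<tau>) < 1" using assms by (simp add: norm_nome)
  from summable_neg_polylog_powers[OF this, of l "nome z"] show ?thesis
    by (simp only: nome_add nome_mult)
qed

lemma nome_series_sums:
  "Im \<tau> > 0 \<Longrightarrow> (\<lambda>j. neg_polylog l (nome (z + of_nat (Suc j) * \<tau>))) sums nome_series l z \<tau>"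
  unfolding nome_series_def using summable_nome_series[of \<tau> l z]
  by (blast intro: summable_sums summable_norm_cancel)

text \<open>Both arguments may vary, so that one statement yields the z-derivatives (constant
  \<open>b\<close>) and holomorphy in tau (constant \<open>a\<close>). Local geometric bounds on the
  terms themselves suffice for differentiating termwise.\<close>

lemma nome_series_derivative:
  assumes S: "open S" and a: "\<And>s. s \<in> S \<Longrightarrow> (a has_field_derivative a' s) (at s)"
    and b: "\<And>s. s \<in> S \<Longrightarrow> (b has_field_derivative b' s) (at s)"
    and Im: "\<And>s. s \<in> S \<Longrightarrow> Im (b s) > 0"
    and not_int: "\<And>s j. s \<in> S \<Longrightarrow> a s + of_nat (Suc j) * b s \<notin> \<int>"
    and s: "s \<in> S"
  shows "((\<lambda>s. nome_series l (a s) (b s)) has_field_derivative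
     (\<Sum>j. neg_polylog (Suc l) (nome (a s + of_nat (Suc j) * b s)) *
        (2 * of_real pi * \<i> * (a' s + of_nat (Suc j) * b' s)))) (at s)"
proof -
  let ?\<phi> = "\<lambda>j s. nome (a s + of_nat (Suc j) * b s)"
  obtain C where C: "C > 0" "\<And>y. norm y \<le> 1 / 2 \<Longrightarrow> norm (neg_polylog l y) \<le> C * norm y"
    by (rule neg_polylog_bound[of l]) blast
  have cont: "continuous_on S a" "continuous_on S b"
    using a b by (meson DERIV_isCont continuous_at_imp_continuous_on)+
  have "\<exists>g g'. \<forall>s\<in>S. (\<lambda>j. neg_polylog l (?\<phi> j s)) sums g s \<and>
     (\<lambda>j. neg_polylog (Suc l) (?\<phi> j s) * (2 * of_real pi * \<i> * (a' s + of_nat (Suc j) * b' s))) sums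
         g' s \<and>
     (g has_field_derivative g' s) (at s)"
  proof (rule series_and_derivative_comparison_complex[OF S])
    fix j s assume s: "s \<in> S"
    have "((\<lambda>s. neg_polylog l (?\<phi> j s)) has_field_derivative
       neg_polylog (Suc l) (?\<phi> j s) *
        ((2 * of_real pi * \<i> * (a' s + of_nat (Suc j) * b' s) * ?\<phi> j s) / ?\<phi> j s)) (at s)"
      by (intro has_field_derivative_neg_polylog_compose has_field_derivative_nome DERIV_add
          DERIV_cmult a b s)
         (use not_int[OF s] in \<open>auto simp: nome_eq_1_iff\<close>)
    thus "((\<lambda>s. neg_polylog l (?\<phi> j s)) has_field_derivative
       neg_polylog (Suc l) (?\<phi> j s) * (2 * of_real pi * \<i> * (a' s + of_nat (Suc j) * b' s))) (at s)"
      by simp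
  next
    fix s0 assume "s0 \<in> S"
    then obtain d where d: "d > 0" "cball s0 d \<subseteq> S"
      using S open_contains_cball by blast
    have cont_nome: "continuous_on (cball s0 d) (\<lambda>s. nome (f s))" if "continuous_on S f" for f
      unfolding nome_def using continuous_on_subset[OF that d(2)] by (intro continuous_intros)
    have "continuous_on (cball s0 d) (\<lambda>s. norm (nome (b s)))"
      by (intro continuous_on_norm cont_nome cont)
    then obtain s1 where s1: "s1 \<in> cball s0 d" "\<forall>s\<in>cball s0 d. norm (nome (b s)) \<le> norm (nome (b s1))"
      using continuous_attains_sup[of "cball s0 d" "\<lambda>s. norm (nome (b s))"] d(1) by auto
    \<comment> \<open>The maximum of the norm of q on a closed disc; attained, hence still below
      1.\<close>
    define \<rho> where "\<rho> = norm (nome (b s1))"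
    have \<rho>: "0 \<le> \<rho>" "\<rho> < 1"
      using Im[of s1] s1(1) d(2) by (auto simp: \<rho>_def norm_nome)
    have "compact ((\<lambda>s. nome (a s)) ` cball s0 d)"
      by (intro compact_continuous_image cont_nome cont) auto
    then obtain A where A: "A > 0" "\<And>s. s \<in> cball s0 d \<Longrightarrow> norm (nome (a s)) \<le> A"
      by (auto dest!: compact_imp_bounded simp: bounded_pos)
    define h where "h j = complex_of_real (C * (A * \<rho> ^ Suc j))" for j
    have "(\<lambda>j. A * \<rho> ^ Suc j) \<longlonglongrightarrow> A * 0"
      using \<rho> by (intro tendsto_mult tendsto_const LIMSEQ_Suc LIMSEQ_power_zero) auto
    hence "eventually (\<lambda>j. A * \<rho> ^ Suc j < 1 / 2) sequentially"
      by (rule order_tendstoD) simp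
    hence "eventually (\<lambda>j. \<forall>s\<in>ball s0 d \<inter> S. norm (neg_polylog l (?\<phi> j s)) \<le> norm (h j)) sequentially"
    proof eventually_elim
      case (elim j)
      show ?case
      proof
        fix s assume "s \<in> ball s0 d \<inter> S"
        hence s: "s \<in> cball s0 d" by auto
        have "norm (?\<phi> j s) = norm (nome (a s)) * norm (nome (b s)) ^ Suc j"
          by (simp only: nome_add nome_mult norm_mult norm_power)
        also have "\<dots> \<le> A * \<rho> ^ Suc j"
          using A s s1(2) by (intro mult_mono power_mono) (auto simp: \<rho>_def)
        finally have le: "norm (?\<phi> j s) \<le> A * \<rho> ^ Suc j" .
        with elim have "norm (neg_polylog l (?\<phi> j s)) \<le> C * norm (?\<phi> j s)"
          by (intro C(2)) linarith
        also have "\<dots> \<le> C * (A * \<rho> ^ Suc j)"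
          using le C(1) by (intro mult_left_mono) auto
        also have "\<dots> = norm (h j)"
          using C(1) A(1) \<rho>(1) by (simp add: h_def norm_mult norm_power)
        finally show "norm (neg_polylog l (?\<phi> j s)) \<le> norm (h j)" .
      qed
    qed
    moreover have "summable h"
      unfolding h_def using \<rho>
      by (intro summable_of_real summable_mult) (auto simp: summable_Suc_iff summable_geometric)
    moreover have "range h \<subseteq> \<real>\<^sub>\<ge>\<^sub>0"
      using A C \<rho> by (auto simp: h_def simp del: of_real_mult of_real_power)
    ultimately show "\<exists>d h. 0 < d \<and> summable h \<and> range h \<subseteq> \<real>\<^sub>\<ge>\<^sub>0 \<and>
        (\<forall>\<^sub>F j in sequentially. \<forall>s\<in>ball s0 d \<inter> S. cmod (neg_polylog l (?\<phi> j s)) \<le> cmod (h j))"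
      using d(1) by blast
  qed
  then obtain g g' where g: "\<And>s. s \<in> S \<Longrightarrow> (\<lambda>j. neg_polylog l (?\<phi> j s)) sums g s"
    "\<And>s. s \<in> S \<Longrightarrow> (\<lambda>j. neg_polylog (Suc l) (?\<phi> j s) *
        (2 * of_real pi * \<i> * (a' s + of_nat (Suc j) * b' s))) sums g' s"
    "\<And>s. s \<in> S \<Longrightarrow> (g has_field_derivative g' s) (at s)"
    by blast
  have "((\<lambda>s. nome_series l (a s) (b s)) has_field_derivative g' s) (at s)"
  proof (rule has_field_derivative_transform_within_open[OF g(3)[OF s] S s])
    show "g s = nome_series l (a s) (b s)" if "s \<in> S" for s
      using g(1)[OF that] by (simp add: nome_series_def sums_iff)
  qed
  also have "g' s = (\<Sum>j. neg_polylog (Suc l) (?\<phi> j s) *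
        (2 * of_real pi * \<i> * (a' s + of_nat (Suc j) * b' s)))"
    using g(2)[OF s] by (simp add: sums_iff)
  finally show ?thesis .
qed

lemma has_field_derivative_nome_series:
  assumes S: "open S" and Im: "Im \<tau> > 0"
    and a: "\<And>s. s \<in> S \<Longrightarrow> (a has_field_derivative c) (at s)"
    and not_int: "\<And>s j. s \<in> S \<Longrightarrow> a s + of_nat (Suc j) * \<tau> \<notin> \<int>"
    and s: "s \<in> S"
  shows "((\<lambda>s. nome_series l (a s) \<tau>) has_field_derivative
           2 * of_real pi * \<i> * c * nome_series (Suc l) (a s) \<tau>) (at s)"
proof -
  have "((\<lambda>s. nome_series l (a s) \<tau>) has_field_derivative
     (\<Sum>j. neg_polylog (Suc l) (nome (a s + of_nat (Suc j) * \<tau>)) *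
        (2 * of_real pi * \<i> * (c + of_nat (Suc j) * 0)))) (at s)"
    by (rule nome_series_derivative[OF S, where a' = "\<lambda>_. c" and b = "\<lambda>_. \<tau>" and b' = "\<lambda>_. 0"])
       (use assms in auto)
  moreover have "(\<lambda>j. neg_polylog (Suc l) (nome (a s + of_nat (Suc j) * \<tau>)) *
        (2 * of_real pi * \<i> * (c + of_nat (Suc j) * 0))) sums
        (nome_series (Suc l) (a s) \<tau> * (2 * of_real pi * \<i> * c))"
    using sums_mult2[OF nome_series_sums[OF Im, of "Suc l" "a s"]] by simp
  ultimately show ?thesis
    by (simp add: sums_iff mult.commute)
qed

section \<open>The lattice, quasi-periods and the pole at 0\<close>

lemma lattice_coords:
  assumes "Im \<tau> > 0"
  obtains s t :: real where "z = of_real s * \<tau> + of_real t"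
proof
  show "z = of_real (Im z / Im \<tau>) * \<tau> + of_real (Re z - Im z / Im \<tau> * Re \<tau>)"
    using assms by (simp add: complex_eq_iff)
qed

lemma lattice_add_iff:
  assumes "w \<in> lattice \<tau>"
  shows "z + w \<in> lattice \<tau> \<longleftrightarrow> z \<in> lattice \<tau>"
proof -
  have add: "x + y \<in> lattice \<tau>" if "x \<in> lattice \<tau>" "y \<in> lattice \<tau>" for x y
  proof -
    obtain m n m' n' where "x = of_int m * \<tau> + of_int n" "y = of_int m' * \<tau> + of_int n'"
      using \<open>x \<in> lattice \<tau>\<close> \<open>y \<in> lattice \<tau>\<close> by (auto simp: lattice_def)
    hence "x + y = of_int (m + m') * \<tau> + of_int (n + n')" by (simp add: algebra_simps)
    thus ?thesis unfolding lattice_def by blast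
  qed
  have "- w \<in> lattice \<tau>"
  proof -
    obtain m n where "w = of_int m * \<tau> + of_int n" using assms by (auto simp: lattice_def)
    hence "- w = of_int (-m) * \<tau> + of_int (-n)" by simp
    thus ?thesis unfolding lattice_def by blast
  qed
  with add[of z w] add[of "z + w" "-w"] assms show ?thesis by auto
qed

lemma lattice_uminus_iff: "- z \<in> lattice \<tau> \<longleftrightarrow> z \<in> lattice \<tau>"
proof -
  have "- x \<in> lattice \<tau>" if "x \<in> lattice \<tau>" for x
  proof -
    obtain m n where "x = of_int m * \<tau> + of_int n" using \<open>x \<in> lattice \<tau>\<close> by (auto simp: lattice_def)
    hence "- x = of_int (-m) * \<tau> + of_int (-n)" by simp
    thus ?thesis unfolding lattice_def by blast
  qed
  from this[of z] this[of "-z"] show ?thesis by auto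
qed

lemma zero_in_lattice [simp]: "0 \<in> lattice \<tau>"
  unfolding lattice_def by (auto intro!: exI[of _ 0])

lemma lattice_discrete:
  assumes "Im \<tau> > 0" "w \<in> lattice \<tau>" "norm w < min (Im \<tau>) 1"
  shows "w = 0"
proof -
  obtain m n where w: "w = of_int m * \<tau> + of_int n" using assms by (auto simp: lattice_def)
  have "\<bar>of_int m\<bar> * Im \<tau> = \<bar>Im w\<bar>"
    using assms(1) by (simp add: w abs_mult)
  also have "\<dots> < 1 * Im \<tau>"
    using abs_Im_le_cmod[of w] assms(3) by simp
  finally have "m = 0" using assms(1) by (subst (asm) mult_less_cancel_right_pos) auto
  with assms(3) show ?thesis by (auto simp: w)
qed

lemma closed_lattice: "Im \<tau> > 0 \<Longrightarrow> closed (lattice \<tau>)"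
proof (rule discrete_imp_closed[of "min (Im \<tau>) 1"]; safe?)
  fix x y assume "Im \<tau> > 0" "x \<in> lattice \<tau>" "y \<in> lattice \<tau>" "dist y x < min (Im \<tau>) 1"
  thus "y = x"
    using lattice_discrete[of \<tau> "y - x"] lattice_add_iff[of x \<tau> "y - x"] by (simp add: dist_norm)
qed auto

lemma notin_lattice_imp_notin_Ints:
  assumes "z \<notin> lattice \<tau>"
  shows "z + of_int m * \<tau> \<notin> \<int>"
proof
  assume "z + of_int m * \<tau> \<in> \<int>"
  then obtain n where "z + of_int m * \<tau> = of_int n" by (auto elim: Ints_cases)
  hence "z = of_int (-m) * \<tau> + of_int n" by (simp add: algebra_simps)
  with assms show False unfolding lattice_def by blast
qed

lemma has_field_derivative_kronecker_eis:
  assumes \<tau>: "Im \<tau> > 0" and z: "z \<notin> lattice \<tau>"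
  shows "((\<lambda>z. kronecker_eis l z \<tau>) has_field_derivative
            2 * of_real pi * \<i> * kronecker_eis (Suc l) z \<tau>) (at z)"
proof -
  let ?S = "- lattice \<tau>"
  have S: "open ?S" using closed_lattice[OF \<tau>] by auto
  have 0: "z \<notin> \<int>" using notin_lattice_imp_notin_Ints[OF z, of 0] by simp
  have 1: "((\<lambda>z. neg_polylog l (nome z)) has_field_derivative
       neg_polylog (Suc l) (nome z) * ((2 * of_real pi * \<i> * 1 * nome z) / nome z)) (at z)"
    by (intro has_field_derivative_neg_polylog_compose has_field_derivative_nome DERIV_ident)
       (use 0 in \<open>auto simp: nome_eq_1_iff\<close>)
  have 2: "((\<lambda>z. nome_series l z \<tau>) has_field_derivative
           2 * of_real pi * \<i> * 1 * nome_series (Suc l) z \<tau>) (at z)"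
    by (rule has_field_derivative_nome_series[OF S \<tau>])
       (use z notin_lattice_imp_notin_Ints[of _ \<tau> "int (Suc j)" for j] in auto)
  have 3: "((\<lambda>z. nome_series l (-z) \<tau>) has_field_derivative
           2 * of_real pi * \<i> * (-1) * nome_series (Suc l) (-z) \<tau>) (at z)"
    by (rule has_field_derivative_nome_series[OF S \<tau>])
       (use z notin_lattice_imp_notin_Ints[of "-x" \<tau> "int (Suc j)" for x j] in
         \<open>auto simp: lattice_uminus_iff intro!: derivative_eq_intros\<close>)
  have "((\<lambda>z. neg_polylog l (nome z) + (if l = 0 then 1 / 2 else 0) +
     nome_series l z \<tau> - (-1) ^ l * nome_series l (-z) \<tau>) has_field_derivative
       neg_polylog (Suc l) (nome z) * ((2 * of_real pi * \<i> * 1 * nome z) / nome z) + 0 +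
       2 * of_real pi * \<i> * 1 * nome_series (Suc l) z \<tau> -
       (-1) ^ l * (2 * of_real pi * \<i> * (-1) * nome_series (Suc l) (-z) \<tau>)) (at z)"
    by (intro DERIV_add DERIV_diff DERIV_cmult DERIV_const 1 2 3)
  thus ?thesis
    unfolding kronecker_eis_def by (simp add: algebra_simps)
qed

lemma nome_series_add_tau:
  assumes "Im \<tau> > 0"
  shows "nome_series l (z + \<tau>) \<tau> = nome_series l z \<tau> - neg_polylog l (nome (z + \<tau>))"
proof -
  have "(\<lambda>j. neg_polylog l (nome (z + of_nat (Suc (Suc j)) * \<tau>))) sums
          (nome_series l z \<tau> - neg_polylog l (nome (z + \<tau>)))"
    using nome_series_sums[OF assms, of l z] by (subst sums_Suc_iff) simp
  also have "(\<lambda>j. neg_polylog l (nome (z + of_nat (Suc (Suc j)) * \<tau>))) =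
             (\<lambda>j. neg_polylog l (nome (z + \<tau> + of_nat (Suc j) * \<tau>)))"
    by (simp add: algebra_simps)
  finally show ?thesis
    using nome_series_sums[OF assms, of l "z + \<tau>"] sums_unique2 by blast
qed

lemma neg_polylog_nome_uminus:
  "z \<notin> \<int> \<Longrightarrow> neg_polylog l (nome (-z)) = (-1) ^ Suc l * neg_polylog l (nome z) - (if l = 0 then 1 else 0)"
  unfolding nome_uminus by (rule neg_polylog_inverse) (auto simp: nome_eq_1_iff)

text \<open>The shift moves one term from one half of the series to the other. The inversion formula
  identifies the two terms up to its constant 1 at order 0, which becomes the quasi-period.\<close>

lemma kronecker_eis_add_tau:
  assumes "Im \<tau> > 0" "z \<notin> lattice \<tau>"
  shows "kronecker_eis l (z + \<tau>) \<tau> = kronecker_eis l z \<tau> + (if l = 0 then 1 else 0)"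
proof -
  have "nome_series l (- z) \<tau> = nome_series l (- (z + \<tau>)) \<tau> - neg_polylog l (nome (- z))"
    using nome_series_add_tau[OF assms(1), of l "- (z + \<tau>)"] by simp
  hence "(-1) ^ l * nome_series l (- z) \<tau> =
         (-1) ^ l * nome_series l (- (z + \<tau>)) \<tau> - (-1) ^ l * neg_polylog l (nome (- z))"
    by (simp only: right_diff_distrib)
  moreover have "z \<notin> \<int>" using notin_lattice_imp_notin_Ints[OF assms(2), of 0] by simp
  hence "(-1) ^ l * neg_polylog l (nome (- z)) = - neg_polylog l (nome z) - (if l = 0 then 1 else 0)"
    by (simp add: neg_polylog_nome_uminus right_diff_distrib flip: mult.assoc power_add)
  ultimately show ?thesis
    unfolding kronecker_eis_def nome_series_add_tau[OF assms(1)] by simp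
qed

lemma kronecker_eis_add_of_int: "kronecker_eis l (z + of_int n) \<tau> = kronecker_eis l z \<tau>"
proof -
  have "nome (z + of_int n) = nome z" for z by (simp add: nome_add)
  moreover have "nome_series l (z + of_int n) \<tau> = nome_series l z \<tau>" for z n
    unfolding nome_series_def by (simp add: nome_add)
  from this[of z n] this[of "-z" "-n"]
  have "nome_series l (z + of_int n) \<tau> = nome_series l z \<tau>"
    "nome_series l (- (z + of_int n)) \<tau> = nome_series l (-z) \<tau>" by simp_all
  ultimately show ?thesis by (simp add: kronecker_eis_def)
qed

lemma kronecker_eis_add_lattice:
  assumes \<tau>: "Im \<tau> > 0" and z: "z \<notin> lattice \<tau>"
  shows "kronecker_eis l (z + (of_int m * \<tau> + of_int n)) \<tau> =
           kronecker_eis l z \<tau> + (if l = 0 then of_int m else 0)"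
proof -
  have lat: "z + of_int m * \<tau> \<notin> lattice \<tau>" for m
    using lattice_add_iff[of "of_int m * \<tau> + of_int 0" \<tau> z] z unfolding lattice_def by fastforce
  have "kronecker_eis l (z + of_int m * \<tau>) \<tau> = kronecker_eis l z \<tau> + (if l = 0 then of_int m else 0)"
  proof (induction m rule: int_induct[where k = 0])
    case (step1 i)
    thus ?case using kronecker_eis_add_tau[OF \<tau> lat[of i], of l] by (simp add: algebra_simps)
  next
    case (step2 i)
    thus ?case using kronecker_eis_add_tau[OF \<tau> lat[of "i - 1"],
        of l] by (simp add: algebra_simps split: if_splits)
  qed auto
  thus ?thesis
    using kronecker_eis_add_of_int[of l "z + of_int m * \<tau>" n \<tau>] by (simp add: add.assoc)
qed

text \<open>At l = 0 the added 1/2 is half of the inversion constant; this choice makes the function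
  exactly odd.\<close>

lemma kronecker_eis_uminus:
  assumes "z \<notin> \<int>"
  shows "kronecker_eis l (-z) \<tau> = (-1) ^ Suc l * kronecker_eis l z \<tau>"
  unfolding kronecker_eis_def neg_polylog_nome_uminus[OF assms]
  by (simp add: algebra_simps flip: mult.assoc power_add)

text \<open>In the strip |Im z| < Im tau neither series meets a pole, so near 0 only w / (1 - w)
  with w = nome z is singular, and nome z - 1 behaves like 2 pi i z.\<close>

lemma kronecker_eis_residue:
  assumes \<tau>: "Im \<tau> > 0"
  shows "((\<lambda>z. z * kronecker_eis 0 z \<tau>) \<longlongrightarrow> - 1 / (2 * of_real pi * \<i>)) (at 0)"
proof -
  let ?c = "2 * of_real pi * \<i> :: complex"
  define S where "S = {z. \<bar>Im z\<bar> < Im \<tau>}"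
  have S: "open S" unfolding S_def by (intro open_Collect_less continuous_intros)
  have not_int: "z + of_nat (Suc j) * \<tau> \<notin> \<int>" if "z \<in> S" for z j
  proof -
    have "Im \<tau> \<le> of_nat (Suc j) * Im \<tau>" using \<tau> by simp
    moreover have "Im (z + of_nat (Suc j) * \<tau>) = Im z + of_nat (Suc j) * Im \<tau>" by simp
    ultimately have "Im (z + of_nat (Suc j) * \<tau>) > 0" using that unfolding S_def by fastforce
    thus ?thesis by (auto simp: complex_is_Int_iff simp del: of_nat_Suc)
  qed
  have d1: "((\<lambda>z. nome_series 0 z \<tau>) has_field_derivative ?c * 1 * nome_series (Suc 0) 0 \<tau>) (at 0)"
    by (rule has_field_derivative_nome_series[OF S \<tau>, where a =
        "\<lambda>z. z"]) (use not_int \<tau> in \<open>auto simp: S_def\<close>)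
  have d2: "((\<lambda>z. nome_series 0 (-z) \<tau>) has_field_derivative
      ?c * (-1) * nome_series (Suc 0) (-0) \<tau>) (at 0)"
    by (rule has_field_derivative_nome_series[OF S \<tau>, where a = "\<lambda>z. -z"])
       (use not_int[of "-x" for x] \<tau> in \<open>auto simp: S_def intro!: derivative_eq_intros\<close>)
  let ?h = "\<lambda>z. 1 / 2 + nome_series 0 z \<tau> - nome_series 0 (-z) \<tau>"
  have "isCont ?h 0"
    using DERIV_isCont[OF d1] DERIV_isCont[OF d2] by (intro continuous_intros)
  hence h: "(?h \<longlongrightarrow> ?h 0) (at 0)" by (simp add: isCont_def)
  have "((\<lambda>z. nome z) has_field_derivative ?c * 1 * nome 0) (at 0)"
    by (intro has_field_derivative_nome DERIV_ident)
  hence "((\<lambda>z. (nome z - 1) / z) \<longlongrightarrow> ?c) (at 0)"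
    by (simp add: has_field_derivative_iff nome_def)
  moreover have "isCont nome 0" unfolding nome_def[abs_def] by (intro continuous_intros)
  hence "(nome \<longlongrightarrow> 1) (at 0)" by (simp add: isCont_def nome_def)
  ultimately have "((\<lambda>z. - nome z / ((nome z - 1) / z) + z * ?h z) \<longlongrightarrow> - 1 / ?c + 0 * ?h 0) (at 0)"
    by (intro tendsto_add tendsto_divide tendsto_minus tendsto_mult[OF _ h] tendsto_ident_at) auto
  also have "(\<lambda>z. - nome z / ((nome z - 1) / z) + z * ?h z) = (\<lambda>z. z * kronecker_eis 0 z \<tau>)"
  proof
    fix z
    have "- nome z / ((nome z - 1) / z) = z * neg_polylog 0 (nome z)"
      by (cases "nome z = 1") (auto simp: neg_polylog_order_0 divide_simps, auto simp: algebra_simps)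
    thus "- nome z / ((nome z - 1) / z) + z * ?h z = z * kronecker_eis 0 z \<tau>"
      by (simp add: kronecker_eis_def algebra_simps)
  qed
  finally show ?thesis by simp
qed

text \<open>The limit condition makes the singularity at 0 removable, and periodicity carries the
  extension to every lattice point. The resulting entire function takes all its values on the
  compact fundamental parallelogram \<open>Q\<close>, so it is constant.\<close>

lemma lattice_Liouville:
  assumes \<tau>: "Im \<tau> > 0" and hol: "f holomorphic_on - lattice \<tau>"
    and per: "\<And>z w. z \<notin> lattice \<tau> \<Longrightarrow> w \<in> lattice \<tau> \<Longrightarrow> f (z + w) = f z"
    and lim: "((\<lambda>z. z * f z) \<longlongrightarrow> 0) (at 0)"
  obtains C where "\<And>z. z \<notin> lattice \<tau> \<Longrightarrow> f z = C"
proof -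
  define r where "r = min (Im \<tau>) 1"
  have r: "r > 0" using \<tau> by (simp add: r_def)
  have lat0: "z \<notin> lattice \<tau>" if "z \<in> ball 0 r - {0}" for z
    using lattice_discrete[OF \<tau>, of z] that by (auto simp: r_def)
  have "f holomorphic_on ball 0 r - {0}"
    by (rule holomorphic_on_subset[OF hol]) (use lat0 in auto)
  moreover have "((\<lambda>z. (z - 0) * f z) \<longlongrightarrow> 0) (at 0)" using lim by simp
  ultimately obtain g where g: "g holomorphic_on ball 0 r" "\<And>z. z \<in> ball 0 r - {0} \<Longrightarrow> g z = f z"
    using holomorphic_on_extend_lim[of f "ball 0 r" 0] r by auto
  define D where "D z = (if z \<in> lattice \<tau> then g 0 else f z)" for z
  have D_per: "D (z + w) = D z" if "w \<in> lattice \<tau>" for z w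
    using lattice_add_iff[OF that, of z] per[of z w] that by (auto simp: D_def)
  have D0: "D z = g z" if "z \<in> ball 0 r" for z
    using g(2)[of z] lat0[of z] that by (cases "z = 0") (auto simp: D_def)
  have "D field_differentiable (at z)" for z
  proof (cases "z \<in> lattice \<tau>")
    case False
    have "open (- lattice \<tau>)" using closed_lattice[OF \<tau>] by auto
    moreover from this hol False obtain f' where "(f has_field_derivative f') (at z)"
      by (auto simp: holomorphic_on_open)
    ultimately have "(D has_field_derivative f') (at z)" using False
      by (intro has_field_derivative_transform_within_open[of f f' z "- lattice \<tau>" D]) (auto simp: D_def)
    thus ?thesis by (auto simp: field_differentiable_def)
  next
    case True
    have "g field_differentiable (at 0)"
      using g(1) r by (auto simp: holomorphic_on_open field_differentiable_def)
    then obtain g' where "(g has_field_derivative g') (at (z + (- z)))"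
      by (auto simp: field_differentiable_def)
    hence "((\<lambda>x. g (x + (- z))) has_field_derivative g') (at z)"
      by (simp only: DERIV_shift)
    hence "(D has_field_derivative g') (at z)"
    proof (rule has_field_derivative_transform_within_open[where S = "ball z r"])
      fix x assume "x \<in> ball z r"
      hence "D (x + - z) = g (x + - z)" by (intro D0) (simp add: dist_norm norm_minus_commute)
      moreover have "D (x + - z) = D x" using D_per[of "-z" x] True by (simp add: lattice_uminus_iff)
      ultimately show "g (x + - z) = D x" by simp
    qed (use r in auto)
    thus ?thesis by (auto simp: field_differentiable_def)
  qed
  hence D: "D holomorphic_on UNIV" by (simp add: holomorphic_on_open field_differentiable_def)
  define Q where "Q = (\<lambda>(s, t). of_real s * \<tau> + of_real t) ` (cbox (0::real, 0::real) (1, 1))"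
  have "compact Q" unfolding Q_def
    by (intro compact_continuous_image) (auto simp: case_prod_unfold intro!: continuous_intros)
  moreover have "continuous_on Q D"
    using D holomorphic_on_imp_continuous_on continuous_on_subset by blast
  ultimately have "bounded (D ` Q)" by (intro compact_imp_bounded compact_continuous_image)
  moreover have "range D \<subseteq> D ` Q"
  proof safe
    fix z
    obtain s t where st: "z = of_real s * \<tau> + of_real t" using lattice_coords[OF \<tau>] .
    define w where "w = of_int (- \<lfloor>s\<rfloor>) * \<tau> + of_int (- \<lfloor>t\<rfloor>)"
    have w: "w \<in> lattice \<tau>" unfolding lattice_def w_def by blast
    have "z + w = of_real (frac s) * \<tau> + of_real (frac t)"
      by (simp add: st w_def frac_def algebra_simps)
    hence "z + w \<in> Q" unfolding Q_def
      by (intro image_eqI[of _ _ "(frac s, frac t)"])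
         (auto simp: cbox_Pair_eq frac_ge_0 less_imp_le[OF frac_lt_1])
    with D_per[OF w, of z] show "D z \<in> D ` Q" by (metis imageI)
  qed
  ultimately have "bounded (range D)" using bounded_subset by blast
  with D obtain C where "\<And>z. D z = C" using Liouville_theorem[of D] unfolding constant_on_def by blast
  hence "f z = C" if "z \<notin> lattice \<tau>" for z using that by (metis D_def)
  with that show ?thesis by blast
qed


section \<open>Modularity at the sixth torsion points\<close>

lemma moebius_action_upper_half_plane:
  assumes det: "a * d - b * c = 1" and \<tau>: "Im \<tau> > 0"
  shows "of_int c * \<tau> + of_int d \<noteq> 0" and "Im (moebius_action a b c d \<tau>) > 0"
proof -
  show J: "of_int c * \<tau> + of_int d \<noteq> 0"
  proof
    assume 0: "of_int c * \<tau> + of_int d = 0"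
    hence "Im (of_int c * \<tau> + of_int d) = 0" by simp
    hence "c = 0" using \<tau> by simp
    with 0 det show False by simp
  qed
  have "Im ((of_int a * \<tau> + of_int b) * cnj (of_int c * \<tau> + of_int d)) =
        of_int (a * d - b * c) * Im \<tau>"
    by (simp add: algebra_simps)
  thus "Im (moebius_action a b c d \<tau>) > 0"
    using \<tau> det unfolding moebius_action_def Im_complex_div_gt_0 by simp
qed

text \<open>Dividing by c tau + d changes lattice coordinates by an integer matrix, since the
  determinant is 1. The new coefficient d m - c n is the one that enters the quasi-period.\<close>

lemma lattice_moebius_action:
  assumes det: "a * d - b * c = 1" and \<tau>: "Im \<tau> > 0"
  shows "(of_int m * \<tau> + of_int n) / (of_int c * \<tau> + of_int d) =
     of_int (d * m - c * n) * moebius_action a b c d \<tau> + of_int (a * n - b * m)"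
proof -
  let ?J = "of_int c * \<tau> + of_int d"
  have J: "?J \<noteq> 0" using moebius_action_upper_half_plane[OF det \<tau>] by simp
  have "of_int (d * m - c * n) * (of_int a * \<tau> + of_int b) + of_int (a * n - b * m) * ?J =
        of_int (a * d - b * c) * (of_int m * \<tau> + of_int n)"
    by (simp add: algebra_simps)
  hence eq: "of_int m * \<tau> + of_int n =
     of_int (d * m - c * n) * (of_int a * \<tau> + of_int b) + of_int (a * n - b * m) * ?J"
    by (simp only: det of_int_1 mult_1)
  have "(p * x + r * J) / J = p * (x / J) + r" if "J \<noteq> 0" for p x r J :: complex
    using that by (simp add: field_simps)
  from this[OF J] show ?thesis
    unfolding moebius_action_def by (subst eq)
qed

lemma notin_lattice_moebius_action:
  assumes det: "a * d - b * c = 1" and \<tau>: "Im \<tau> > 0" and z: "z \<notin> lattice \<tau>"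
  shows "z / (of_int c * \<tau> + of_int d) \<notin> lattice (moebius_action a b c d \<tau>)"
proof
  let ?J = "of_int c * \<tau> + of_int d"
  have J: "?J \<noteq> 0" using moebius_action_upper_half_plane[OF det \<tau>] by simp
  assume "z / ?J \<in> lattice (moebius_action a b c d \<tau>)"
  then obtain m n where "z / ?J = of_int m * moebius_action a b c d \<tau> + of_int n"
    by (auto simp: lattice_def)
  hence "z = of_int m * (of_int a * \<tau> + of_int b) + of_int n * ?J"
    using J by (simp add: moebius_action_def field_simps)
  also have "\<dots> = of_int (m * a + n * c) * \<tau> + of_int (m * b + n * d)"
    by (simp add: algebra_simps)
  finally show False using z unfolding lattice_def by blast
qed

text \<open>The difference of both sides is elliptic, odd, and has no pole at the lattice points.\<close>

lemma kronecker_eis_0_transform: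
  fixes a b c d :: int
  assumes det: "a * d - b * c = 1" and \<tau>: "Im \<tau> > 0" and z: "z \<notin> lattice \<tau>"
  defines "J \<equiv> of_int c * \<tau> + of_int d"
  shows "kronecker_eis 0 (z / J) (moebius_action a b c d \<tau>) = J * kronecker_eis 0 z \<tau> - of_int c * z"
proof -
  define \<tau>' where "\<tau>' = moebius_action a b c d \<tau>"
  have J: "J \<noteq> 0" and \<tau>': "Im \<tau>' > 0"
    using moebius_action_upper_half_plane[OF det \<tau>] by (auto simp: J_def \<tau>'_def)
  have lat: "z / J \<notin> lattice \<tau>'" if "z \<notin> lattice \<tau>" for z
    using notin_lattice_moebius_action[OF det \<tau> that] by (simp add: J_def \<tau>'_def)
  define D where "D z = kronecker_eis 0 (z / J) \<tau>' - (J * kronecker_eis 0 z \<tau> - of_int c * z)" for z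
  have "D holomorphic_on - lattice \<tau>"
  proof -
    have "open (- lattice \<tau>)" using closed_lattice[OF \<tau>] by auto
    moreover have "\<exists>D'. (D has_field_derivative D') (at z)" if "z \<in> - lattice \<tau>" for z
    proof -
      have "((\<lambda>z. z / J) has_field_derivative 1 / J) (at z)"
        by (intro DERIV_cdivide DERIV_ident)
      from DERIV_chain2[OF has_field_derivative_kronecker_eis[OF \<tau>' lat] this, of 0]
        has_field_derivative_kronecker_eis[OF \<tau>, of z 0] that
      show ?thesis unfolding D_def[abs_def]
        by (auto intro!: exI derivative_eq_intros)
    qed
    ultimately show ?thesis by (simp add: holomorphic_on_open)
  qed
  moreover have "D (z + w) = D z" if z: "z \<notin> lattice \<tau>" and w: "w \<in> lattice \<tau>" for z w
  proof -
    obtain m n where mn: "w = of_int m * \<tau> + of_int n" using w by (auto simp: lattice_def)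
    have "(z + w) / J = z / J + (of_int (d * m - c * n) * \<tau>' + of_int (a * n - b * m))"
      using lattice_moebius_action[OF det \<tau>, of m n] by (simp add: mn J_def \<tau>'_def add_divide_distrib)
    hence "kronecker_eis 0 ((z + w) / J) \<tau>' = kronecker_eis 0 (z / J) \<tau>' + of_int (d * m - c * n)"
      by (simp only: kronecker_eis_add_lattice[OF \<tau>' lat[OF z]] simp_thms if_True)
    moreover have "kronecker_eis 0 (z + w) \<tau> = kronecker_eis 0 z \<tau> + of_int m"
      unfolding mn using kronecker_eis_add_lattice[OF \<tau> z, of 0] by simp
    \<comment> \<open>The term -c z balances the quasi-periods: J m - c (m tau + n) = d m - c
      n.\<close>
    ultimately show ?thesis
      by (simp add: D_def mn J_def algebra_simps)
  qed
  moreover have "((\<lambda>z. z * D z) \<longlongrightarrow> 0) (at 0)"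
  proof -
    let ?r = "- 1 / (2 * of_real pi * \<i>) :: complex"
    have "((\<lambda>z. z / J) \<longlongrightarrow> 0 / J) (at 0)" by (intro tendsto_intros) (use J in auto)
    hence "filterlim (\<lambda>z. z / J) (at 0) (at 0)"
      using J by (auto simp: filterlim_at eventually_at_filter)
    hence "((\<lambda>z. z / J * kronecker_eis 0 (z / J) \<tau>') \<longlongrightarrow> ?r) (at 0)"
      by (rule filterlim_compose[OF kronecker_eis_residue[OF \<tau>']])
    hence "((\<lambda>z. J * (z / J * kronecker_eis 0 (z / J) \<tau>') - (J * (z * kronecker_eis 0 z \<tau>) -
        of_int c * (z * z)))
        \<longlongrightarrow> J * ?r - (J * ?r - of_int c * (0 * 0))) (at 0)"
      by (intro tendsto_intros kronecker_eis_residue[OF \<tau>])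
    moreover have "J * (z / J * kronecker_eis 0 (z / J) \<tau>') - (J * (z * kronecker_eis 0 z \<tau>) -
        of_int c * (z * z)) =
      z * D z" for z using J by (simp add: D_def algebra_simps)
    ultimately show ?thesis by simp
  qed
  ultimately obtain C where C: "\<And>z. z \<notin> lattice \<tau> \<Longrightarrow> D z = C"
    using lattice_Liouville[OF \<tau>, of D] by blast
  have notin_Ints: "z \<notin> \<int>" if "z \<notin> lattice \<sigma>" for z \<sigma>
    using notin_lattice_imp_notin_Ints[OF that, of 0] by simp
  \<comment> \<open>Liouville leaves an unknown constant; oddness forces it to be 0.\<close>
  have "D (-z) = - D z"
    unfolding D_def minus_divide_left[symmetric]
    using kronecker_eis_uminus[OF notin_Ints[OF z], of 0 \<tau>]
      kronecker_eis_uminus[OF notin_Ints[OF lat[OF z]], of 0 \<tau>'] by simp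
  hence "D z = 0" using C[of z] C[of "-z"] z by (simp add: lattice_uminus_iff)
  thus ?thesis by (simp add: D_def \<tau>'_def)
qed

text \<open>The successive \<open>z\<close>-derivatives of \<open>c z\<close>, normalised by the factor \<open>J / (2\<pi>i)\<close> per derivative.\<close>

definition eis_defect :: "nat \<Rightarrow> complex \<Rightarrow> complex \<Rightarrow> complex \<Rightarrow> complex" where
  "eis_defect l c J z =
     (if l = 0 then c * z else if l = 1 then c * J / (2 * of_real pi * \<i>) else 0)"

text \<open>Each z-derivative brings a factor 1/J on the left, which raises the weight by one. Of
  the defect c z only the first derivative c remains, the anomaly of weight 2; from the second
  derivative on the law is exact.\<close>

lemma kronecker_eis_transform:
  fixes a b c d :: int
  assumes det: "a * d - b * c = 1" and \<tau>: "Im \<tau> > 0" and z: "z \<notin> lattice \<tau>"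
  defines "J \<equiv> of_int c * \<tau> + of_int d"
  shows "kronecker_eis l (z / J) (moebius_action a b c d \<tau>) =
           J ^ Suc l * kronecker_eis l z \<tau> - eis_defect l (of_int c) J z"
  using z
proof (induction l arbitrary: z)
  case 0
  thus ?case using kronecker_eis_0_transform[OF det \<tau>, of z] by (simp add: J_def eis_defect_def)
next
  case (Suc l)
  define \<tau>' where "\<tau>' = moebius_action a b c d \<tau>"
  let ?c = "2 * of_real pi * \<i> :: complex"
  have J: "J \<noteq> 0" and \<tau>': "Im \<tau>' > 0"
    using moebius_action_upper_half_plane[OF det \<tau>] by (auto simp: J_def \<tau>'_def)
  have lat: "z / J \<notin> lattice \<tau>'"
    using notin_lattice_moebius_action[OF det \<tau> Suc.prems] by (simp add: J_def \<tau>'_def)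
  have "open (- lattice \<tau>)" using closed_lattice[OF \<tau>] by auto
  have "((\<lambda>z. z / J) has_field_derivative 1 / J) (at z)"
    by (intro DERIV_cdivide DERIV_ident)
  from DERIV_chain2[OF has_field_derivative_kronecker_eis[OF \<tau>' lat] this, of l]
  have "((\<lambda>z. kronecker_eis l (z / J) \<tau>') has_field_derivative
          ?c * kronecker_eis (Suc l) (z / J) \<tau>' * (1 / J)) (at z)" .
  moreover have "((\<lambda>z. kronecker_eis l (z / J) \<tau>') has_field_derivative
          J ^ Suc l * (?c * kronecker_eis (Suc l) z \<tau>) -
              ?c / J * eis_defect (Suc l) (of_int c) J z) (at z)"
  proof (rule has_field_derivative_transform_within_open[OF _ \<open>open (- lattice \<tau>)\<close>])
    have "((\<lambda>z. eis_defect l (of_int c) J z) has_field_derivative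
            ?c / J * eis_defect (Suc l) (of_int c) J z) (at z)"
      using J by (cases l) (auto simp: eis_defect_def intro!: derivative_eq_intros)
    thus "((\<lambda>z. J ^ Suc l * kronecker_eis l z \<tau> - eis_defect l (of_int c) J z) has_field_derivative
          J ^ Suc l * (?c * kronecker_eis (Suc l) z \<tau>) -
              ?c / J * eis_defect (Suc l) (of_int c) J z) (at z)"
      by (intro DERIV_diff DERIV_cmult has_field_derivative_kronecker_eis \<tau> Suc.prems)
  qed (use Suc in \<open>auto simp: \<tau>'_def\<close>)
  ultimately have "?c * kronecker_eis (Suc l) (z / J) \<tau>' * (1 / J) =
     J ^ Suc l * (?c * kronecker_eis (Suc l) z \<tau>) - ?c / J * eis_defect (Suc l) (of_int c) J z"
    by (rule DERIV_unique)
  hence "?c * kronecker_eis (Suc l) (z / J) \<tau>' =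
     ?c * (J ^ Suc (Suc l) * kronecker_eis (Suc l) z \<tau> - eis_defect (Suc l) (of_int c) J z)"
    using J by (simp add: field_simps)
  thus ?case by (simp add: \<tau>'_def)
qed

section \<open>Six-torsion points and the character\<close>

lemma torsion_6_notin_lattice:
  assumes "Im \<tau> > 0" "\<not> (6 dvd c \<and> 6 dvd d)"
  shows "(of_int c * \<tau> + of_int d) / 6 \<notin> lattice \<tau>"
proof
  assume "(of_int c * \<tau> + of_int d) / 6 \<in> lattice \<tau>"
  then obtain m n where "(of_int c * \<tau> + of_int d) / 6 = of_int m * \<tau> + of_int n"
    by (auto simp: lattice_def)
  hence eq: "of_int c * \<tau> + of_int d = of_int (6 * m) * \<tau> + of_int (6 * n)"
    by (simp add: field_simps)
  hence "Im (of_int c * \<tau> + of_int d) = Im (of_int (6 * m) * \<tau> + of_int (6 * n))" by simp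
  hence "c = 6 * m" using assms(1) by simp
  with eq have "of_int d = (of_int (6 * n) :: complex)" by simp
  hence "d = 6 * n" by (simp only: of_int_eq_iff)
  with \<open>c = 6 * m\<close> assms(2) show False by simp
qed

lemma det_1_not_both_dvd:
  assumes "a * d - b * c = (1 :: int)"
  shows "\<not> (6 dvd c \<and> 6 dvd d)"
proof
  assume "6 dvd c \<and> 6 dvd d"
  hence "6 dvd a * d - b * c" by simp
  with assms show False by simp
qed

lemma det_1_mod_6:
  assumes "a * d - b * c = (1 :: int)" "6 dvd c"
  shows "d mod 6 = 1 \<or> d mod 6 = 5"
proof -
  obtain c' where c: "c = 6 * c'" using assms(2) by (elim dvdE)
  have "\<not> 2 dvd d" "\<not> 3 dvd d"
  proof -
    show "\<not> 2 dvd d"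
    proof
      assume "2 dvd d"
      hence "2 dvd a * d - b * c" by (simp add: c)
      thus False using assms(1) by simp
    qed
    show "\<not> 3 dvd d"
    proof
      assume "3 dvd d"
      moreover have "3 dvd c" unfolding c by presburger
      ultimately have "3 dvd a * d - b * c" by simp
      thus False using assms(1) by simp
    qed
  qed
  thus ?thesis by presburger
qed

text \<open>The principal character modulo 6 for even \<open>l\<close>, and for odd \<open>l\<close>
  the one induced by \<open>chi32\<close>.\<close>

definition torsion_char :: "nat \<Rightarrow> int \<Rightarrow> complex" where
  "torsion_char l d = (if d mod 6 = 1 then 1 else if d mod 6 = 5 then (-1) ^ l else 0)"

lemma dirichlet_character_torsion_char: "dirichlet_character 6 (torsion_char l)"
proof -
  have mult: "torsion_char l (m * n) = torsion_char l m * torsion_char l n" for m n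
  proof -
    have "x mod 6 = 0 \<or> x mod 6 = 1 \<or> x mod 6 = 2 \<or> x mod 6 = 3 \<or> x mod 6 = 4 \<or> x mod 6 = 5" for x :: int
      by presburger
    note cases = this[of m] this[of n]
    define r s where "r = m mod 6" and "s = n mod 6"
    have "(m * n) mod 6 = (r * s) mod 6" by (simp add: r_def s_def mod_mult_eq)
    moreover have "torsion_char l m = (if r = 1 then 1 else if r = 5 then (-1) ^ l else 0)"
      "torsion_char l n = (if s = 1 then 1 else if s = 5 then (-1) ^ l else 0)"
      by (simp_all add: torsion_char_def r_def s_def)
    moreover have "(-1) ^ l * (-1) ^ l = (1 :: complex)" by (simp flip: power_add)
    ultimately show ?thesis
      using cases unfolding r_def[symmetric] s_def[symmetric] torsion_char_def[of l "m * n"]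
      by (elim disjE) simp_all
  qed
  have cop: "coprime m 6 \<longleftrightarrow> m mod 6 = 1 \<or> m mod 6 = 5" for m :: int
  proof -
    define r where "r = m mod 6"
    have "r = 0 \<or> r = 1 \<or> r = 2 \<or> r = 3 \<or> r = 4 \<or> r = 5"
      unfolding r_def by presburger
    moreover have "coprime m 6 \<longleftrightarrow> gcd 6 r = 1"
      unfolding r_def by (metis coprime_iff_gcd_eq_1 gcd_red_int)
    moreover have "\<not> coprime 6 (3 :: int)" "\<not> coprime 6 (4 :: int)"
      by (rule not_coprimeI[of 3], simp_all, rule not_coprimeI[of 2], simp_all)
    ultimately show ?thesis unfolding r_def[symmetric] by (auto simp: gcd_non_0_int)
  qed
  show ?thesis
    unfolding dirichlet_character_def using mult cop by (auto simp: torsion_char_def)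
qed

lemma kronecker_eis_torsion_6:
  assumes "d mod 6 = 1 \<or> d mod 6 = 5"
  shows "kronecker_eis l (of_int d / 6) \<tau> = torsion_char (Suc l) d * kronecker_eis l (1 / 6) \<tau>"
proof -
  have Z: "(1 / 6 :: complex) \<notin> \<int>"
  proof
    assume "(1 / 6 :: complex) \<in> \<int>"
    then obtain n where "(1 / 6 :: complex) = of_int n" by (elim Ints_cases)
    hence "(of_int (6 * n) :: complex) = of_int 1" by (simp add: field_simps)
    hence "6 * n = 1" by (simp only: of_int_eq_iff)
    thus False by presburger
  qed
  show ?thesis
    using assms
  proof
    assume d: "d mod 6 = 1"
    define e where "e = d div 6"
    have "d = 6 * e + 1" using d unfolding e_def by presburger
    hence "of_int d / 6 = 1 / 6 + (of_int e :: complex)" by (simp add: add_divide_distrib)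
    thus ?thesis using d by (simp only: kronecker_eis_add_of_int) (simp add: torsion_char_def)
  next
    assume d: "d mod 6 = 5"
    define e where "e = d div 6 + 1"
    have "d = 6 * e - 1" using d unfolding e_def by presburger
    hence "of_int d / 6 = - (1 / 6) + (of_int e :: complex)" by (simp add: diff_divide_distrib)
    thus ?thesis using d kronecker_eis_uminus[OF Z, of l \<tau>]
      by (simp only: kronecker_eis_add_of_int) (simp add: torsion_char_def)
  qed
qed

text \<open>Write 1/6 as (J/6)/J. With c = 6 c', the point J/6 is d/6 + c' tau, a lattice translate
  of +-1/6. In weight 1 the quasi-period c' J cancels the defect c J/6 exactly; in weight 2 the
  defect stays and becomes the depth-1 component.\<close>

lemma kronecker_eis_torsion_Gamma0:
  fixes a b c d :: int
  assumes det: "a * d - b * c = 1" and c: "6 dvd c" and \<tau>: "Im \<tau> > 0"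
  defines "J \<equiv> of_int c * \<tau> + of_int d"
  shows "kronecker_eis l (1 / 6) (moebius_action a b c d \<tau>) =
     torsion_char (Suc l) d * J ^ Suc l * (kronecker_eis l (1 / 6) \<tau> -
        (if l = 1 then of_int c / J / (2 * of_real pi * \<i>) else 0))"
proof -
  have J: "J \<noteq> 0"
    using moebius_action_upper_half_plane[OF det \<tau>] by (auto simp: J_def)
  obtain c' where c': "c = 6 * c'" using c by (elim dvdE)
  have d: "d mod 6 = 1 \<or> d mod 6 = 5" using det_1_mod_6[OF det c] .
  have d6: "of_int d / 6 \<notin> lattice \<tau>"
    using torsion_6_notin_lattice[OF \<tau>, of 0 d] d by fastforce
  have J6: "J / 6 \<notin> lattice \<tau>"
    unfolding J_def by (rule torsion_6_notin_lattice[OF \<tau> det_1_not_both_dvd[OF det]])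
  have "kronecker_eis l (J / 6) \<tau> = kronecker_eis l (of_int d / 6 + (of_int c' * \<tau> + of_int 0)) \<tau>"
    by (rule arg_cong[where f = "\<lambda>z. kronecker_eis l z \<tau>"]) (simp add: J_def c' field_simps)
  also have "\<dots> = kronecker_eis l (of_int d / 6) \<tau> + (if l = 0 then of_int c' else 0)"
    by (rule kronecker_eis_add_lattice[OF \<tau> d6])
  also have "\<dots> = torsion_char (Suc l) d * kronecker_eis l (1 / 6) \<tau> + (if l = 0 then of_int c' else 0)"
    by (simp only: kronecker_eis_torsion_6[OF d])
  finally have "kronecker_eis l ((J / 6) / J) (moebius_action a b c d \<tau>) =
     J ^ Suc l * (torsion_char (Suc l) d * kronecker_eis l (1 / 6) \<tau> + (if l = 0 then of_int c' else 0))
       - eis_defect l (of_int c) J (J / 6)"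
    using kronecker_eis_transform[OF det \<tau> J6[unfolded J_def], of l] by (simp add: J_def)
  moreover have "(J / 6) / J = 1 / 6" using J by simp
  moreover have "torsion_char (Suc l) d = 1" if "l = 1"
    using d that by (auto simp: torsion_char_def)
  ultimately show ?thesis
    using J by (cases "l = 0"; cases "l = 1") (auto simp: eis_defect_def c' power2_eq_square
        algebra_simps)
qed

section \<open>Growth at the cusps\<close>

text \<open>exp(- pi/3) bounds \<open>norm (nome z)\<close> for Im z >= 1/6, the least positive
  height of a six-torsion point when Im tau >= 1. The value 1/2 is the radius in
  \<open>neg_polylog_bound\<close>.\<close>

lemma exp_minus_pi_third_le: "exp (- (pi / 3)) \<le> 1 / 2"
proof -
  have "exp (pi / 3) \<ge> 2" using exp_ge_add_one_self[of "pi / 3"] pi_gt3 by linarith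
  thus ?thesis by (simp add: exp_minus field_simps)
qed

lemma nome_series_bound:
  obtains C where "\<And>z \<tau>. (\<And>j. Im (z + of_nat (Suc j) * \<tau>) \<ge> of_nat (Suc j) / 6) \<Longrightarrow>
      norm (nome_series l z \<tau>) \<le> C"
proof -
  obtain C where C: "C > 0" "\<And>y. norm y \<le> 1 / 2 \<Longrightarrow> norm (neg_polylog l y) \<le> C * norm y"
    by (rule neg_polylog_bound[of l]) blast
  have "norm (nome_series l z \<tau>) \<le> (\<Sum>j. C * (1 / 2) ^ Suc j)"
    if Im: "\<And>j. Im (z + of_nat (Suc j) * \<tau>) \<ge> of_nat (Suc j) / 6" for z \<tau>
  proof -
    have le: "norm (neg_polylog l (nome (z + of_nat (Suc j) * \<tau>))) \<le> C * (1 / 2) ^ Suc j" for j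
    proof -
      have "norm (nome (z + of_nat (Suc j) * \<tau>)) \<le> exp (- (real (Suc j) * (pi / 3)))"
        unfolding norm_nome exp_le_cancel_iff using mult_left_mono[OF Im[of j], of "2 * pi"] by simp
      also have "\<dots> = exp (- (pi / 3)) ^ Suc j"
        by (simp only: exp_of_nat_mult flip: mult_minus_right)
      also have "\<dots> \<le> (1 / 2) ^ Suc j"
        by (intro power_mono exp_minus_pi_third_le) auto
      finally have n: "norm (nome (z + of_nat (Suc j) * \<tau>)) \<le> (1 / 2) ^ Suc j" .
      also have "(1 / 2 :: real) ^ Suc j \<le> 1 / 2" by (simp add: power_le_one)
      finally have "norm (neg_polylog l (nome (z + of_nat (Suc j) * \<tau>))) \<le>
          C * norm (nome (z + of_nat (Suc j) * \<tau>))"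
        by (rule C(2))
      also have "\<dots> \<le> C * (1 / 2) ^ Suc j" using n C(1) by (intro mult_left_mono) auto
      finally show ?thesis .
    qed
    have s: "summable (\<lambda>j. C * (1 / 2 :: real) ^ Suc j)"
      by (intro summable_mult) (auto simp: summable_Suc_iff summable_geometric)
    have s': "summable (\<lambda>j. norm (neg_polylog l (nome (z + of_nat (Suc j) * \<tau>))))"
      by (rule summable_comparison_test'[OF s, of 0]) (use le in auto)
    have "norm (nome_series l z \<tau>) \<le> (\<Sum>j. norm (neg_polylog l (nome (z + of_nat (Suc j) * \<tau>))))"
      unfolding nome_series_def by (rule summable_norm[OF s'])
    also have "\<dots> \<le> (\<Sum>j. C * (1 / 2) ^ Suc j)"
      by (rule suminf_le[OF le s' s])
    finally show ?thesis .
  qed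
  with that show ?thesis by blast
qed

text \<open>Reducing c modulo 6 costs at most the constant quasi-period c div 6 and places Im z
  between 0 and 5/6 Im tau. Then z and -z both satisfy the height condition of
  \<open>nome_series_bound\<close>, the extreme case being 1 - 5/6 = 1/6.\<close>

lemma kronecker_eis_torsion_bounded:
  fixes c d :: int
  assumes cd: "\<not> (6 dvd c \<and> 6 dvd d)"
  obtains B where "\<And>\<tau>. Im \<tau> \<ge> 1 \<Longrightarrow> norm (kronecker_eis l ((of_int c * \<tau> + of_int d) / 6) \<tau>) \<le> B"
proof -
  define c0 c1 where "c0 = c div 6" and "c1 = c mod 6"
  have c: "c = 6 * c0 + c1" and c1: "0 \<le> c1" "c1 \<le> 5"
    by (auto simp: c0_def c1_def)
  obtain C where C: "C > 0" "\<And>y. norm y \<le> 1 / 2 \<Longrightarrow> norm (neg_polylog l y) \<le> C * norm y"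
    by (rule neg_polylog_bound[of l]) blast
  obtain C' where C': "\<And>z \<tau>. (\<And>j. Im (z + of_nat (Suc j) * \<tau>) \<ge> of_nat (Suc j) / 6) \<Longrightarrow>
      norm (nome_series l z \<tau>) \<le> C'"
    by (rule nome_series_bound[of l]) blast
  define B where "B = norm (neg_polylog l (nome (of_int d / 6))) + C + 1 / 2 + C' + C' + \<bar>of_int c0\<bar>"
  have "norm (kronecker_eis l ((of_int c * \<tau> + of_int d) / 6) \<tau>) \<le> B" if \<tau>: "Im \<tau> \<ge> 1" for \<tau>
  proof -
    define z where "z = (of_int c1 * \<tau> + of_int d) / 6"
    have "z \<notin> lattice \<tau>"
      unfolding z_def using \<tau> cd by (intro torsion_6_notin_lattice) (auto simp: c)
    hence "kronecker_eis l (z + (of_int c0 * \<tau> + of_int 0)) \<tau> =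
             kronecker_eis l z \<tau> + (if l = 0 then of_int c0 else 0)"
      using \<tau> by (intro kronecker_eis_add_lattice) auto
    moreover have "z + (of_int c0 * \<tau> + of_int 0) = (of_int c * \<tau> + of_int d) / 6"
      by (simp add: z_def c field_simps)
    ultimately have "kronecker_eis l ((of_int c * \<tau> + of_int d) / 6) \<tau> =
        kronecker_eis l z \<tau> + (if l = 0 then of_int c0 else 0)" by (simp only:)
    hence eq: "kronecker_eis l ((of_int c * \<tau> + of_int d) / 6) \<tau> =
        neg_polylog l (nome z) + (if l = 0 then 1 / 2 else 0) + nome_series l z \<tau>
          + - ((-1) ^ l * nome_series l (-z) \<tau>) + (if l = 0 then of_int c0 else 0)"
      by (simp only: kronecker_eis_def[of l z \<tau>] diff_conv_add_uminus)
    have Im_z: "Im z = of_int c1 / 6 * Im \<tau>" by (simp add: z_def)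
    \<comment> \<open>For c1 = 0 the point z = d/6 does not move with tau; otherwise nome z lies in
      the disc of radius 1/2.\<close>
    have "norm (neg_polylog l (nome z)) \<le> norm (neg_polylog l (nome (of_int d / 6))) + C"
    proof (cases "c1 = 0")
      case True
      thus ?thesis using C(1) by (simp add: z_def)
    next
      case False
      hence "1 * 1 \<le> of_int c1 * Im \<tau>" using c1 \<tau> by (intro mult_mono) auto
      hence "norm (nome z) \<le> exp (- (pi / 3))"
        unfolding norm_nome exp_le_cancel_iff Im_z using mult_left_mono[of 1 "of_int c1 * Im \<tau>"
            pi] by (simp add: mult.commute)
      hence n: "norm (nome z) \<le> 1 / 2" using exp_minus_pi_third_le by linarith
      from C(2)[OF n] have "norm (neg_polylog l (nome z)) \<le> C * norm (nome z)" .
      also have "\<dots> \<le> C * 1" using n C(1) by (intro mult_left_mono) auto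
      finally show ?thesis by (simp add: add_increasing)
    qed
    moreover have "norm (nome_series l z \<tau>) \<le> C'"
    proof (rule C')
      fix j
      have "of_nat (Suc j) / 6 \<le> of_nat (Suc j) * (1 :: real)" by simp
      also have "\<dots> \<le> (of_int c1 / 6 + of_nat (Suc j)) * Im \<tau>"
        using c1 \<tau> by (intro mult_mono) auto
      also have "\<dots> = Im (z + of_nat (Suc j) * \<tau>)" by (simp add: Im_z algebra_simps)
      finally show "of_nat (Suc j) / 6 \<le> Im (z + of_nat (Suc j) * \<tau>)" .
    qed
    moreover have "norm (nome_series l (-z) \<tau>) \<le> C'"
    proof (rule C')
      fix j
      have "of_int c1 \<le> (5 :: real)" using c1 by simp
      hence 1: "of_nat (Suc j) / 6 \<le> of_nat (Suc j) - of_int c1 / (6 :: real)" by (simp add: field_simps)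
      hence "of_nat (Suc j) / 6 * 1 \<le> (of_nat (Suc j) - of_int c1 / 6) * Im \<tau>"
        using \<tau> by (intro mult_mono order.trans[OF _ 1]) auto
      also have "\<dots> = Im (-z + of_nat (Suc j) * \<tau>)" by (simp add: Im_z algebra_simps)
      finally show "of_nat (Suc j) / 6 \<le> Im (-z + of_nat (Suc j) * \<tau>)" by simp
    qed
    hence "norm (- ((-1) ^ l * nome_series l (-z) \<tau>)) \<le> C'"
      by (simp add: norm_mult norm_power)
    moreover have "norm (if l = 0 then 1 / 2 else 0 :: complex) \<le> 1 / 2"
      "norm (if l = 0 then of_int c0 else 0 :: complex) \<le> \<bar>of_int c0\<bar>" by auto
    ultimately show ?thesis
      unfolding eq B_def by (intro norm_add_rule_thm)
  qed
  with that show ?thesis by blast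
qed

lemma kronecker_eis_torsion_holomorphic:
  "(\<lambda>\<tau>. kronecker_eis l (1 / 6) \<tau>) holomorphic_on upper_half_plane"
proof -
  have H: "open upper_half_plane"
    unfolding upper_half_plane_def by (intro open_Collect_less continuous_intros)
  have "(\<lambda>\<tau>. nome_series l z \<tau>) holomorphic_on upper_half_plane" if "Im z = 0" for z
    unfolding holomorphic_on_open[OF H]
  proof
    fix \<tau> assume \<tau>: "\<tau> \<in> upper_half_plane"
    have "z + of_nat (Suc j) * \<tau> \<notin> \<int>" if "\<tau> \<in> upper_half_plane" for \<tau> j
      using that \<open>Im z = 0\<close> by (auto simp: complex_is_Int_iff upper_half_plane_def)
    hence "((\<lambda>\<tau>. nome_series l z \<tau>) has_field_derivative
        (\<Sum>j. neg_polylog (Suc l) (nome (z + of_nat (Suc j) * \<tau>)) *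
           (2 * of_real pi * \<i> * (0 + of_nat (Suc j) * 1)))) (at \<tau>)"
      by (intro nome_series_derivative[OF H, where a' = "\<lambda>_. 0" and b' = "\<lambda>_. 1"])
         (use \<tau> in \<open>auto simp: upper_half_plane_def\<close>)
    thus "\<exists>f'. ((\<lambda>\<tau>. nome_series l z \<tau>) has_field_derivative f') (at \<tau>)" by blast
  qed
  thus ?thesis unfolding kronecker_eis_def by (intro holomorphic_intros) auto
qed

text \<open>At an arbitrary cusp the transformation law for the full modular group turns the form
  into its value at J/6, which is bounded, minus a defect divided by J^(l+1).\<close>

lemma quasimodular_form_kronecker_eis:
  "quasimodular_form 6 (int (Suc l)) (if l = 1 then 1 else 0) (torsion_char (Suc l))
     (\<lambda>\<tau>. kronecker_eis l (1 / 6) \<tau>)"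
proof -
  let ?f = "\<lambda>\<tau>. kronecker_eis l (1 / 6) \<tau>"
  let ?h = "if l = 1 then 1 else 0 :: nat"
  \<comment> \<open>The second component is the coefficient of c/J in
    \<open>kronecker_eis_torsion_Gamma0\<close>; it enters only for l = 1.\<close>
  define gs where "gs j = (if j = 0 then ?f else (\<lambda>_. - 1 / (2 * of_real pi * \<i>)))" for j :: nat
  have "gs j holomorphic_on upper_half_plane" for j
    using kronecker_eis_torsion_holomorphic[of l] by (auto simp: gs_def)
  moreover have "\<exists>\<tau>\<in>upper_half_plane. gs ?h \<tau> \<noteq> 0" if "\<not> (\<forall>\<tau>\<in>upper_half_plane. ?f \<tau> = 0)"
  proof (cases "l = 1")
    case True
    thus ?thesis by (intro bexI[of _ \<i>]) (auto simp: gs_def upper_half_plane_def)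
  qed (use that in \<open>auto simp: gs_def\<close>)
  moreover have "?f (moebius_action a b c d \<tau>) =
                 torsion_char (Suc l) d * (of_int c * \<tau> + of_int d) powi (int (Suc l)) *
                 (\<Sum>j\<le>?h. gs j \<tau> * (of_int c / (of_int c * \<tau> + of_int d)) ^ j)"
    if "a * d - b * c = 1" "6 dvd c" "\<tau> \<in> upper_half_plane" for a b c d \<tau>
  proof -
    have "\<tau> \<in> upper_half_plane \<Longrightarrow> Im \<tau> > 0" by (simp add: upper_half_plane_def)
    with that show ?thesis
      unfolding kronecker_eis_torsion_Gamma0[OF that(1,2) \<open>_ \<Longrightarrow> Im \<tau> > 0\<close>[OF that(3)]] power_int_of_nat
      by (auto simp: gs_def algebra_simps)
  qed
  moreover have "\<exists>B. \<exists>Y>0. \<forall>\<tau>. Im \<tau> \<ge> Y \<longrightarrow>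
               norm ((of_int c * \<tau> + of_int d) powi (- (int (Suc l) - 2 * int r)) *
                     gs r (moebius_action a b c d \<tau>)) \<le> B"
    if r: "r \<le> ?h" and det: "a * d - b * c = 1" for r a b c d
  proof (cases "r = 0")
    case False
    with r have "l = 1" "r = 1" by (auto split: if_splits)
    thus ?thesis by (intro exI[of _ "norm (- 1 / (2 * of_real pi * \<i>) :: complex)"] exI[of _ 1])
        (auto simp: gs_def)
  next
    case True
    obtain B where B: "\<And>\<tau>. Im \<tau> \<ge> 1 \<Longrightarrow> norm (kronecker_eis l ((of_int c * \<tau> + of_int d) / 6) \<tau>) \<le> B"
      by (rule kronecker_eis_torsion_bounded[OF det_1_not_both_dvd[OF det], of l]) blast
    have "norm ((of_int c * \<tau> + of_int d) powi (- (int (Suc l) - 2 * int r)) *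
                     gs r (moebius_action a b c d \<tau>)) \<le> B + \<bar>of_int c\<bar>" if \<tau>: "Im \<tau> \<ge> 1" for \<tau>
    proof -
      define J where "J = of_int c * \<tau> + of_int d"
      have \<tau>0: "Im \<tau> > 0" using \<tau> by simp
      have J: "J \<noteq> 0"
        using moebius_action_upper_half_plane[OF det \<tau>0] by (auto simp: J_def)
      have lat: "J / 6 \<notin> lattice \<tau>"
        unfolding J_def by (rule torsion_6_notin_lattice[OF \<tau>0 det_1_not_both_dvd[OF det]])
      have "?f (moebius_action a b c d \<tau>) = J ^ Suc l * kronecker_eis l (J / 6) \<tau> -
          eis_defect l (of_int c) J (J / 6)"
        using kronecker_eis_transform[OF det \<tau>0 lat[unfolded J_def], of l] J
        unfolding J_def[symmetric] by simp
      hence eq: "J powi (- int (Suc l)) * ?f (moebius_action a b c d \<tau>) =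
          kronecker_eis l (J / 6) \<tau> - eis_defect l (of_int c) J (J / 6) / J ^ Suc l"
        using J by (simp only: power_int_minus power_int_of_nat) (simp add: field_simps)
      have "norm (eis_defect l (of_int c) J (J / 6) / J ^ Suc l) \<le> \<bar>of_int c\<bar>"
      proof (cases "l = 1")
        case True
        show ?thesis
        proof (cases "c = 0")
          case False
          \<comment> \<open>For c nonzero |J| >= |c| Im tau >= 1, so the weight-2 defect c / (2 pi i
            J) is at most |c| in norm.\<close>
          have "1 * 1 \<le> \<bar>of_int c\<bar> * Im \<tau>" using False \<tau> by (intro mult_mono) auto
          also have "\<dots> = \<bar>Im J\<bar>" using \<tau> by (simp add: J_def abs_mult)
          also have "\<dots> \<le> norm J" by (rule abs_Im_le_cmod)
          finally have "1 * 1 \<le> 2 * pi * norm J" using pi_gt3 by (intro mult_mono) auto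
          hence "\<bar>of_int c\<bar> * 1 \<le> \<bar>of_int c\<bar> * (2 * pi * norm J)" by (intro mult_left_mono) auto
          moreover have "norm (eis_defect l (of_int c) J (J / 6) / J ^ Suc l) =
              \<bar>of_int c\<bar> / (2 * pi * norm J)"
            using True J by (simp add: eis_defect_def norm_mult norm_divide power2_eq_square)
          ultimately show ?thesis using J by (simp add: divide_le_eq)
        qed (use True in \<open>auto simp: eis_defect_def\<close>)
      qed (use J in \<open>auto simp: eis_defect_def norm_divide norm_mult\<close>)
      with norm_triangle_ineq4[of "kronecker_eis l (J / 6) \<tau>"
          "eis_defect l (of_int c) J (J / 6) / J ^ Suc l"]
        B[OF \<tau>] eq show ?thesis
        using True by (simp add: J_def gs_def)
    qed
    thus ?thesis by (intro exI[of _ "B + \<bar>of_int c\<bar>"] exI[of _ 1]) auto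
  qed
  ultimately show ?thesis
    unfolding quasimodular_form_def
    using dirichlet_character_torsion_char[of "Suc l"] kronecker_eis_torsion_holomorphic[of l]
    by (cases "\<forall>\<tau>\<in>upper_half_plane. ?f \<tau> = 0") (simp, intro conjI disjI2 exI[of _ gs], auto)
qed

text \<open>Carries the constant of the linear combination: the principal character is 1 on every
  lower right entry d occurring in level 6.\<close>

lemma modular_form_1: "modular_form 6 0 (torsion_char 0) (\<lambda>_. 1)"
proof -
  have "torsion_char 0 d = 1" if "a * d - b * c = 1" "6 dvd c" for a b c d
    using det_1_mod_6[OF that] by (auto simp: torsion_char_def)
  hence "\<forall>a b c d. a * d - b * c = 1 \<and> int 6 dvd c \<longrightarrow> (\<forall>\<tau>\<in>upper_half_plane.
           (1 :: complex) = torsion_char 0 d * (of_int c * \<tau> + of_int d) powi 0 *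
             (\<Sum>j\<le>0. 1 * (of_int c / (of_int c * \<tau> + of_int d)) ^ j))" by auto
  moreover have "\<exists>\<tau>\<in>upper_half_plane. (1 :: complex) \<noteq> 0"
    by (intro bexI[of _ \<i>]) (auto simp: upper_half_plane_def)
  moreover have "\<forall>r\<le>0. \<forall>a b c d :: int. a * d - b * c = 1 \<longrightarrow> (\<exists>B. \<exists>Y>0. \<forall>\<tau>. Im \<tau> \<ge> Y \<longrightarrow>
               norm ((of_int c * \<tau> + of_int d) powi (- (0 - 2 * int r)) * 1) \<le> B)"
    by (auto intro!: exI[of _ 1])
  ultimately show ?thesis
    unfolding modular_form_def quasimodular_form_def
    using dirichlet_character_torsion_char[of 0]
    by (intro conjI disjI2 exI[of _ "\<lambda>_ _. 1"]) auto
qed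


section \<open>The Lambert series of a symmetric fraction\<close>

lemma nome_one_sixth: "nome (1 / 6) = root_of_unity 6"
  by (simp add: nome_def root_of_unity_def)

text \<open>Subtracting the part of \<open>kronecker_eis\<close> outside the two series leaves
  exactly the weight-(l + 1) piece of the fraction, summed over x = q^n.\<close>

lemma sums_kronecker_eis:
  assumes "\<tau> \<in> upper_half_plane"
  shows "(\<lambda>n. neg_polylog l (root_of_unity 6 * nome \<tau> ^ Suc n) +
              (-1) ^ Suc l * neg_polylog l (inverse (root_of_unity 6) * nome \<tau> ^ Suc n)) sums
         (kronecker_eis l (1 / 6) \<tau> - neg_polylog l (root_of_unity 6) - (if l = 0 then 1 / 2 else 0))"
proof -
  have \<tau>: "Im \<tau> > 0" using assms by (simp add: upper_half_plane_def)
  have "(\<lambda>n. neg_polylog l (root_of_unity 6 * nome \<tau> ^ Suc n)) sums nome_series l (1 / 6) \<tau>"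
    using nome_series_sums[OF \<tau>, of l "1 / 6"] unfolding nome_add nome_mult nome_one_sixth .
  moreover have "(\<lambda>n. neg_polylog l (inverse (root_of_unity 6) * nome \<tau> ^ Suc n)) sums
      nome_series l (- (1 / 6)) \<tau>"
    using nome_series_sums[OF \<tau>, of l "- (1 / 6)"]
    unfolding nome_add nome_mult nome_uminus nome_one_sixth .
  ultimately have "(\<lambda>n. neg_polylog l (root_of_unity 6 * nome \<tau> ^ Suc n) +
       (-1) ^ Suc l * neg_polylog l (inverse (root_of_unity 6) * nome \<tau> ^ Suc n)) sums
       (nome_series l (1 / 6) \<tau> + (-1) ^ Suc l * nome_series l (- (1 / 6)) \<tau>)"
    by (intro sums_add sums_mult)
  thus ?thesis by (simp add: kronecker_eis_def nome_one_sixth)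
qed

theorem theorem3p5:
  fixes k :: nat and Q :: "complex poly"
  assumes "k \<ge> 1"
    and "degree Q \<le> 2 * k - 1"
    and "\<forall>x. x \<noteq> 0 \<longrightarrow> poly Q x = x ^ (2 * k) * poly Q (1 / x)"
    and "poly Q 0 = 0"
  shows "(\<forall>\<tau>\<in>upper_half_plane.
            (\<lambda>n. poly Q (nome \<tau> ^ Suc n) / (1 - nome \<tau> ^ Suc n + nome \<tau> ^ (2 * Suc n)) ^ k) sums
              (- poly Q 1 / 2
               + \<i> * of_real (sqrt 3) *
                 (\<Sum>l | l \<in> {1..k} \<and> odd l. d_coeff k Q l *
                    (2 ^ l * eisenstein_G_char l chi32 (2 * \<tau>) + eisenstein_G_char l chi32 \<tau>))
               + (\<Sum>l | l \<in> {1..k} \<and> even l. d_coeff k Q l *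
                    (6 ^ l * eisenstein_G l (6 * \<tau>) - 3 ^ l * eisenstein_G l (3 * \<tau>)
                     - 2 ^ l * eisenstein_G l (2 * \<tau>) + eisenstein_G l \<tau>)))) \<and>
         modular_lincomb 6 k
           (\<lambda>\<tau>. \<Sum>n. poly Q (nome \<tau> ^ Suc n) /
                       (1 - nome \<tau> ^ Suc n + nome \<tau> ^ (2 * Suc n)) ^ k)"
proof -
  define d where "d = d_coeff k Q"
  let ?z = "root_of_unity 6"
  define t where "t l x = neg_polylog (l - 1) (?z * x) + (-1) ^ l * neg_polylog (l - 1) (inverse ?z * x)"
    for l x
  have expansion: "poly Q x / (1 - x + x ^ 2) ^ k = (\<Sum>l=1..k. d l * t l x)"
    if "1 - x + x ^ 2 \<noteq> 0" for x
    unfolding d_def t_def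
  proof (rule symmetric_fraction_eq_neg_polylog_sum[OF _ assms(4) _ that])
    show "degree Q \<le> 2 * k" using assms(2) by simp
  qed (use assms(3) in blast)
  \<comment> \<open>At x = 1 the denominator is 1, so the expansion evaluates Q itself.\<close>
  have Q1: "poly Q 1 = (\<Sum>l=1..k. d l * t l 1)"
    using expansion[of 1] by simp
  have summand: "poly Q (nome \<tau> ^ Suc n) / (1 - nome \<tau> ^ Suc n + nome \<tau> ^ (2 * Suc n)) ^ k =
                   (\<Sum>l=1..k. d l * t l (nome \<tau> ^ Suc n))" if \<tau>: "\<tau> \<in> upper_half_plane" for \<tau> n
  proof -
    \<comment> \<open>The zeros of 1 - x + x^2 lie on the unit circle, while q^n is inside.\<close>
    have "norm (nome \<tau>) ^ Suc n < 1"
      using norm_nome_less_1[OF \<tau>] by (simp add: power_less_one_iff del: power_Suc)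
    hence "norm (?z * nome \<tau> ^ Suc n) \<noteq> norm (1 :: complex)"
      "norm (inverse ?z * nome \<tau> ^ Suc n) \<noteq> norm (1 :: complex)"
      by (simp_all only: norm_mult norm_power norm_inverse_root_of_unity_6 root_of_unity_6_props(2)
          norm_one mult_1)
    hence "?z * nome \<tau> ^ Suc n \<noteq> 1" "inverse ?z * nome \<tau> ^ Suc n \<noteq> 1"
      using arg_cong[of _ "1 :: complex" norm] by blast+
    hence "1 - nome \<tau> ^ Suc n + (nome \<tau> ^ Suc n) ^ 2 \<noteq> 0"
      unfolding root_of_unity_6_factor by auto
    from expansion[OF this] show ?thesis
      by (simp only: mult.commute[of 2] power_mult)
  qed
  define M where "M l \<tau> = (if odd l then \<i> * of_real (sqrt 3) *
        (2 ^ l * eisenstein_G_char l chi32 (2 * \<tau>) + eisenstein_G_char l chi32 \<tau>)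
      else 6 ^ l * eisenstein_G l (6 * \<tau>) - 3 ^ l * eisenstein_G l (3 * \<tau>)
                     - 2 ^ l * eisenstein_G l (2 * \<tau>) + eisenstein_G l \<tau>)" for l \<tau>
  have "(\<lambda>n. poly Q (nome \<tau> ^ Suc n) / (1 - nome \<tau> ^ Suc n + nome \<tau> ^ (2 * Suc n)) ^ k) sums
          (- poly Q 1 / 2
               + \<i> * of_real (sqrt 3) *
                 (\<Sum>l | l \<in> {1..k} \<and> odd l. d l *
                    (2 ^ l * eisenstein_G_char l chi32 (2 * \<tau>) + eisenstein_G_char l chi32 \<tau>))
               + (\<Sum>l | l \<in> {1..k} \<and> even l. d l *
                    (6 ^ l * eisenstein_G l (6 * \<tau>) - 3 ^ l * eisenstein_G l (3 * \<tau>)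
                     - 2 ^ l * eisenstein_G l (2 * \<tau>) + eisenstein_G l \<tau>)))"
    if \<tau>: "\<tau> \<in> upper_half_plane" for \<tau>
  proof -
    \<comment> \<open>The sign (-1)^l selects the difference for odd l and the sum for even l; the
      half-values at 1 add up to Q(1)/2.\<close>
    have "(\<lambda>n. t l (nome \<tau> ^ Suc n)) sums (M l \<tau> - t l 1 / 2)" if "l \<in> {1..k}" for l
      using sums_odd_eisenstein[OF \<tau>, of l] sums_even_eisenstein[OF \<tau>, of l] that
      by (cases "odd l") (auto simp: t_def M_def)
    hence "(\<lambda>n. \<Sum>l=1..k. d l * t l (nome \<tau> ^ Suc n)) sums (\<Sum>l=1..k. d l * (M l \<tau> - t l 1 / 2))"
      by (intro sums_sum sums_mult)
    also have "(\<Sum>l=1..k. d l * (M l \<tau> - t l 1 / 2)) = (\<Sum>l=1..k. d l * M l \<tau>) -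
        (\<Sum>l=1..k. d l * t l 1) / 2"
      by (simp add: right_diff_distrib sum_subtractf sum_divide_distrib)
    also have "(\<Sum>l=1..k. d l * M l \<tau>) =
        (\<Sum>l | l \<in> {1..k} \<and> odd l. d l * M l \<tau>) + (\<Sum>l | l \<in> {1..k} \<and> even l. d l * M l \<tau>)"
      by (subst sum.union_disjoint[symmetric]) (auto intro!: sum.cong)
    also have "(\<Sum>l | l \<in> {1..k} \<and> odd l. d l * M l \<tau>) =
        \<i> * of_real (sqrt 3) * (\<Sum>l | l \<in> {1..k} \<and> odd l. d l *
                    (2 ^ l * eisenstein_G_char l chi32 (2 * \<tau>) + eisenstein_G_char l chi32 \<tau>))"
      unfolding sum_distrib_left by (intro sum.cong) (auto simp: M_def)
    also have "(\<Sum>l | l \<in> {1..k} \<and> even l. d l * M l \<tau>) =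
        (\<Sum>l | l \<in> {1..k} \<and> even l. d l *
                    (6 ^ l * eisenstein_G l (6 * \<tau>) - 3 ^ l * eisenstein_G l (3 * \<tau>)
                     - 2 ^ l * eisenstein_G l (2 * \<tau>) + eisenstein_G l \<tau>))"
      by (intro sum.cong) (auto simp: M_def)
    finally show ?thesis
      unfolding summand[OF \<tau>] Q1 by (simp add: algebra_simps)
  qed
  moreover have "modular_lincomb 6 k
           (\<lambda>\<tau>. \<Sum>n. poly Q (nome \<tau> ^ Suc n) /
                       (1 - nome \<tau> ^ Suc n + nome \<tau> ^ (2 * Suc n)) ^ k)"
  proof -
    \<comment> \<open>The index is the weight: slot 0 holds the constant function, slot l the
      torsion value of order l - 1. All constants \<open>s l\<close> are gathered in
      \<open>c 0\<close>.\<close>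
    define f where "f l = (if l = 0 then (\<lambda>_. 1) else (\<lambda>\<tau>. kronecker_eis (l - 1) (1 / 6) \<tau>))"
        for l :: nat
    define s where "s l = neg_polylog (l - 1) ?z + (if l = 1 then 1 / 2 else 0)" for l :: nat
    define c where "c l = (if l = 0 then - (\<Sum>l=1..k. d l * s l) else d l)" for l
    have "modular_form 6 (int l) (torsion_char l) (f l) \<or>
            l = 2 \<and> (\<exists>h. quasimodular_form 6 2 h (torsion_char l) (f l))" for l
    proof (cases l)
      case 0
      thus ?thesis using modular_form_1 by (simp add: f_def)
    next
      case (Suc l')
      thus ?thesis using quasimodular_form_kronecker_eis[of l']
        by (cases "l' = 1") (auto simp: f_def modular_form_def)
    qed
    moreover have "(\<Sum>n. poly Q (nome \<tau> ^ Suc n) /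
        (1 - nome \<tau> ^ Suc n + nome \<tau> ^ (2 * Suc n)) ^ k) = (\<Sum>j<Suc k. c j * f j \<tau>)"
      if \<tau>: "\<tau> \<in> upper_half_plane" for \<tau>
    proof -
      have "(\<lambda>n. t l (nome \<tau> ^ Suc n)) sums (f l \<tau> - s l)" if "l \<in> {1..k}" for l
      proof -
        have "Suc (l - 1) = l" "l - 1 = 0 \<longleftrightarrow> l = 1" "l \<noteq> 0" using that by auto
        thus ?thesis
          using sums_kronecker_eis[OF \<tau>, of "l - 1"] by (simp only: t_def f_def s_def diff_diff_eq
              if_False)
      qed
      hence "(\<lambda>n. \<Sum>l=1..k. d l * t l (nome \<tau> ^ Suc n)) sums (\<Sum>l=1..k. d l * (f l \<tau> - s l))"
        by (intro sums_sum sums_mult)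
      hence "(\<Sum>n. poly Q (nome \<tau> ^ Suc n) /
        (1 - nome \<tau> ^ Suc n + nome \<tau> ^ (2 * Suc n)) ^ k) = (\<Sum>l=1..k. d l * (f l \<tau> - s l))"
        unfolding summand[OF \<tau>] by (simp only: sums_iff)
      also have "\<dots> = (\<Sum>l=1..k. c l * f l \<tau>) + c 0 * f 0 \<tau>"
        by (simp add: right_diff_distrib sum_subtractf c_def f_def)
      also have "\<dots> = (\<Sum>j<Suc k. c j * f j \<tau>)"
        by (simp only: lessThan_Suc_atMost atMost_atLeast0 sum.atLeast_Suc_atMost[of 0 k] le0
            add.commute One_nat_def)
      finally show ?thesis .
    qed
    ultimately show ?thesis
      unfolding modular_lincomb_def
      by (intro exI[of _ "Suc k"] exI[of _ c] exI[of _ "\<lambda>l. l"] exI[of _ torsion_char] exI[of _ f]) simp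
  qed
  ultimately show ?thesis unfolding d_def by blast
qed

end
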